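(* Let $0<p\le1$ and let $W\in\mathcal{LP}$. Then the identity embedding $$\mathrm{id}:\mathcal Q_p\longrightarrow L^2(W\,dA)$$ is compact if and only if $$\lim_{\rho\to1^-}\ \sup_{\mathcal D}\ \big\|h_{\widetilde W^\rho}\big\|_{\mathcal B_p(\mathcal D)}=0,$$ where the supremum is taken over all dyadic systems $\mathcal D$ on $\mathbb T$, and $$\widetilde W(z):=(1-|z|)^2W(z),\qquad \widetilde W^\rho(z):=\widetilde W(z)\mathbf 1_{\{|z|>\rho\}}(z),\qquad h_{\widetilde W^\rho}(I):=\frac{1}{|I|^{p+2}}\int_{Q_I^{\mathrm{up}}}\widetilde W^\rho(z)\,dA(z)$$ for $z\in\mathbb D$, $0<\rho<1$ and arcs $I\subseteq\mathbb T$.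
   Context: $\mathbb D$ is the open unit disc, $\mathbb T$ the unit circle, $dA$ is normalized area measure on $\mathbb D$, and $H(\mathbb D)$ is the space of holomorphic functions on $\mathbb D$. For $a\in\mathbb D$, $\sigma_a(z)=\frac{a-z}{1-\overline a z}$ and $g(z,a)=\log\frac{1}{|\sigma_a(z)|}$. $\mathcal Q_p$ is the space of $f\in H(\mathbb D)$ with $\|f\|_{\mathcal Q_p,*}^2:=\sup_{a\in\mathbb D}\int_{\mathbb D}|f'(z)|^2g(z,a)^p\,dA(z)<\infty$, normed by $\|f\|_{\mathcal Q_p}:=|f(0)|+\|f\|_{\mathcal Q_p,*}$. Compactness of the embedding includes that it is well defined, i.e. $\mathcal Q_p\subseteq L^2(W\,dA)$. A weight $W\ge0$ on $\mathbb D$ (a nonnegative measurable function) belongs to the Littlewood–Paley class $\mathcal{LP}$ if for every $n\in\mathbb N$ ($n\geq 1$) and every $0<q<\infty$, $$\int_{\mathbb D}|f(z)|^qW(z)\,dA(z)\simeq\int_{\mathbb D}|f^{(n)}(z)|^q(1-|z|)^{nq}W(z)\,dA(z)+\sum_{j=0}^{n-1}|f^{(j)}(0)|^q$$ for all $f\in H(\mathbb D)$, where $\simeq$ means two-sided inequality up to positive constants which may depend on $W,n,q$ but not on $f$. $|I|$ denotes arc length normalized so that $|\mathbb T|=1$; arcs include $\mathbb T$ itself. For an arc $I$, $Q_I^{\mathrm{up}}:=\{re^{it}: e^{it}\in I,\ 1-|I|\le r<1-\frac{|I|}{2}\}$. A dyadic system on $\mathbb T$ is a family $\mathcal D=\bigcup_{k\ge0}\mathcal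 D_k$ of half-open arcs where $\mathcal D_0=\{\mathbb T\}$, each $\mathcal D_k$ is a partition of $\mathbb T$ into $2^k$ arcs of length $2^{-k}$, and each arc of $\mathcal D_{k+1}$ is contained in an arc of $\mathcal D_k$. For a nonnegative sequence $h=\{h(I)\}_{I\in\mathcal D}$, the dyadic $p$-capacity gauge is $$\|h\|_{\mathcal B_p(\mathcal D)}:=\inf\Big\{\sum_{J\in\mathcal D}\lambda_J|J|^p:\ \lambda_J\ge0,\ \sum_{J\in\mathcal D,\,J\supseteq I}\lambda_J\ge h(I)\ \text{for all }I\in\mathcal D\Big\}\in[0,\infty],$$ with $\inf\emptyset=+\infty$; in $\|h_{\widetilde W^\rho}\|_{\mathcal B_p(\mathcal D)}$ the sequence is $\{h_{\widetilde W^\rho}(I)\}_{I\in\mathcal D}$. *)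

theory Defs
  imports "HOL-Complex_Analysis.Complex_Analysis" "HOL-Library.Disjoint_Sets"
begin

abbreviation unit_disc :: "complex set" where
  "unit_disc \<equiv> ball 0 1"

abbreviation unit_circle :: "complex set" where
  "unit_circle \<equiv> sphere 0 1"

definition area_measure :: "complex measure" where
  "area_measure = scale_measure (ennreal (1 / pi)) (lebesgue_on unit_disc)"


definition disc_involution :: "complex \<Rightarrow> complex \<Rightarrow> complex" where
  "disc_involution a z = (a - z) / (1 - cnj a * z)"

text \<open>At \<open>z = a\<close> the Green function is \<open>+\<infinity>\<close>, whereas HOL gives it an arbitrary real value there.
  It is only ever integrated in \<open>z\<close>, so this single point plays no role.\<close>

definition green :: "complex \<Rightarrow> complex \<Rightarrow> real" where
  "green z a = ln (1 / cmod (disc_involution a z))"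

definition Qp_seminorm_sq :: "real \<Rightarrow> (complex \<Rightarrow> complex) \<Rightarrow> ennreal" where
  "Qp_seminorm_sq p f =
     (SUP a\<in>unit_disc. \<integral>\<^sup>+z. ennreal ((cmod (deriv f z))\<^sup>2 * green z a powr p) \<partial>area_measure)"

definition Qp_space :: "real \<Rightarrow> (complex \<Rightarrow> complex) set" where
  "Qp_space p = {f. f holomorphic_on unit_disc \<and> Qp_seminorm_sq p f < \<infinity>}"

definition Qp_norm :: "real \<Rightarrow> (complex \<Rightarrow> complex) \<Rightarrow> real" where
  "Qp_norm p f = cmod (f 0) + sqrt (enn2real (Qp_seminorm_sq p f))"


text \<open>The space \<open>L\<^sup>2(M)\<close> is represented by functions rather than by classes modulo null sets;
  accordingly \<open>L2_norm M\<close> is a seminorm on \<open>L2_space M\<close>.\<close>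

definition L2_space :: "complex measure \<Rightarrow> (complex \<Rightarrow> complex) set" where
  "L2_space M = {f. f \<in> borel_measurable M \<and> (\<integral>\<^sup>+z. ennreal ((cmod (f z))\<^sup>2) \<partial>M) < \<infinity>}"

definition L2_norm :: "complex measure \<Rightarrow> (complex \<Rightarrow> complex) \<Rightarrow> real" where
  "L2_norm M f = sqrt (enn2real (\<integral>\<^sup>+z. ennreal ((cmod (f z))\<^sup>2) \<partial>M))"

text \<open>The identity from \<open>(X, nX)\<close> to \<open>(Y, nY)\<close> is well defined and compact: every sequence bounded
  in \<open>X\<close> has a subsequence converging in \<open>Y\<close>.\<close>

definition compact_embedding ::
  "(complex \<Rightarrow> complex) set \<Rightarrow> ((complex \<Rightarrow> complex) \<Rightarrow> real) \<Rightarrow>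
   (complex \<Rightarrow> complex) set \<Rightarrow> ((complex \<Rightarrow> complex) \<Rightarrow> real) \<Rightarrow> bool" where
  "compact_embedding X nX Y nY \<longleftrightarrow>
     X \<subseteq> Y \<and>
     (\<forall>f :: nat \<Rightarrow> complex \<Rightarrow> complex.
        (\<forall>k. f k \<in> X) \<and> (\<exists>B. \<forall>k. nX (f k) \<le> B) \<longrightarrow>
        (\<exists>r :: nat \<Rightarrow> nat. strict_mono r \<and>
           (\<exists>F\<in>Y. (\<lambda>k. nY (\<lambda>z. f (r k) z - F z)) \<longlonglongrightarrow> 0)))"


definition weight :: "(complex \<Rightarrow> real) \<Rightarrow> bool" where
  "weight W \<longleftrightarrow> W \<in> borel_measurable area_measure \<and> (\<forall>z\<in>unit_disc. 0 \<le> W z)"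

definition weighted_area :: "(complex \<Rightarrow> real) \<Rightarrow> complex measure" where
  "weighted_area W = density area_measure (\<lambda>z. ennreal (W z))"

definition LP_lhs :: "(complex \<Rightarrow> real) \<Rightarrow> real \<Rightarrow> (complex \<Rightarrow> complex) \<Rightarrow> ennreal" where
  "LP_lhs W q f = (\<integral>\<^sup>+z. ennreal (cmod (f z) powr q * W z) \<partial>area_measure)"

definition LP_rhs :: "(complex \<Rightarrow> real) \<Rightarrow> nat \<Rightarrow> real \<Rightarrow> (complex \<Rightarrow> complex) \<Rightarrow> ennreal" where
  "LP_rhs W n q f =
     (\<integral>\<^sup>+z. ennreal (cmod ((deriv ^^ n) f z) powr q * (1 - cmod z) powr (real n * q) * W z)
        \<partial>area_measure)
     + (\<Sum>j<n. ennreal (cmod ((deriv ^^ j) f 0) powr q))"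

definition Littlewood_Paley_weight :: "(complex \<Rightarrow> real) \<Rightarrow> bool" where
  "Littlewood_Paley_weight W \<longleftrightarrow>
     weight W \<and>
     (\<forall>n\<ge>1. \<forall>q>0. \<exists>c>0. \<exists>C>0. \<forall>f. f holomorphic_on unit_disc \<longrightarrow>
        ennreal c * LP_rhs W n q f \<le> LP_lhs W q f \<and>
        LP_lhs W q f \<le> ennreal C * LP_rhs W n q f)"


text \<open>Arcs are sets of points of the unit circle, and \<open>arc_length\<close> is normalized so that the
  circle has length 1. The circle itself is a half-open arc (\<open>l = 1\<close>).\<close>

definition arc_length :: "complex set \<Rightarrow> real" where
  "arc_length I = measure lebesgue {t \<in> {0..<1}. cis (2 * pi * t) \<in> I}"

definition half_open_arc :: "complex set \<Rightarrow> bool" where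
  "half_open_arc I \<longleftrightarrow>
     (\<exists>\<alpha> l :: real. 0 < l \<and> l \<le> 1 \<and>
        (I = (\<lambda>t. cis (2 * pi * t)) ` {\<alpha>..<\<alpha> + l} \<or>
         I = (\<lambda>t. cis (2 * pi * t)) ` {\<alpha><..\<alpha> + l}))"

definition dyadic_system :: "complex set set \<Rightarrow> bool" where
  "dyadic_system \<D> \<longleftrightarrow>
     (\<exists>D :: nat \<Rightarrow> complex set set.
        \<D> = (\<Union>k. D k) \<and>
        D 0 = {unit_circle} \<and>
        (\<forall>k. partition_on unit_circle (D k) \<and> card (D k) = 2 ^ k \<and>
             (\<forall>I\<in>D k. half_open_arc I \<and> arc_length I = 1 / 2 ^ k)) \<and>
        (\<forall>k. \<forall>J\<in>D (Suc k). \<exists>I\<in>D k. J \<subseteq> I))"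

definition dyadic_gauge :: "real \<Rightarrow> complex set set \<Rightarrow> (complex set \<Rightarrow> ennreal) \<Rightarrow> ennreal" where
  "dyadic_gauge p \<D> h =
     Inf {(\<Sum>\<^sub>\<infinity>J\<in>\<D>. ennreal (c J * arc_length J powr p)) | c :: complex set \<Rightarrow> real.
            (\<forall>J\<in>\<D>. 0 \<le> c J) \<and>
            (\<forall>I\<in>\<D>. h I \<le> (\<Sum>\<^sub>\<infinity>J\<in>{J \<in> \<D>. I \<subseteq> J}. ennreal (c J)))}"

definition upper_half_box :: "complex set \<Rightarrow> complex set" where
  "upper_half_box I =
     {of_real r * w | (r :: real) w. w \<in> I \<and> 1 - arc_length I \<le> r \<and> r < 1 - arc_length I / 2}"

definition tilde_weight :: "(complex \<Rightarrow> real) \<Rightarrow> complex \<Rightarrow> real" where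
  "tilde_weight W z = (1 - cmod z)\<^sup>2 * W z"

definition truncated_weight :: "real \<Rightarrow> (complex \<Rightarrow> real) \<Rightarrow> complex \<Rightarrow> real" where
  "truncated_weight \<rho> V z = V z * indicator {z. cmod z > \<rho>} z"

definition box_average :: "real \<Rightarrow> (complex \<Rightarrow> real) \<Rightarrow> complex set \<Rightarrow> ennreal" where
  "box_average p V I =
     (\<integral>\<^sup>+z\<in>upper_half_box I. ennreal (V z) \<partial>area_measure) / ennreal (arc_length I powr (p + 2))"

end

theory Submission
  imports Defs
begin

text \<open>
  Write \<open>l I\<close> for the length of an arc \<open>I\<close> and \<open>Q I\<close> for its upper half box. The boxes of one
  dyadic system tile the disc, \<open>Q I\<close> has diameter and distance to the circle comparable to \<open>l I\<close>,
  and a Littlewood-Paley weight turns the norm of \<open>f\<close> in \<open>L\<^sup>2(W dA)\<close> into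
  \<open>\<bar>f 0\<bar>\<^sup>2 + \<integral> \<bar>f'\<bar>\<^sup>2 (1 - \<bar>z\<bar>)\<^sup>2 W dA\<close>. So the embedding is governed by the size of \<open>f'\<close> on
  boxes, that is, by the numbers \<open>\<mu> I = l I powr (p + 2) * sup\<^bsub>Q I\<^esub> \<bar>f'\<bar>\<^sup>2\<close>, paired with the box averages
  \<open>h I\<close> of the weight. Up to a constant these \<open>\<mu>\<close> are \<open>p\<close>-Carleson sequences, which means
  \<open>(\<Sum>I \<subseteq> J. \<mu> I) \<le> l J powr p\<close> for all \<open>J\<close>; conversely, every finite \<open>p\<close>-Carleson sequence can be
  realized by functions in \<open>\<Q>\<^sub>p\<close> well enough to bound its pairing with \<open>h\<close>. And the dyadic gauge of
  \<open>h\<close> is the supremum of \<open>\<Sum>I. h I * \<mu> I\<close> over \<open>p\<close>-Carleson sequences. Both sides of the equivalence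
  therefore say that the part of \<open>\<integral> \<bar>f'\<bar>\<^sup>2 (1 - \<bar>z\<bar>)\<^sup>2 W dA\<close> over \<open>\<bar>z\<bar> > \<rho>\<close> tends to 0 uniformly on
  bounded sets of \<open>\<Q>\<^sub>p\<close>.

  From the gauge to compactness. That a function in \<open>\<Q>\<^sub>p\<close> gives a Carleson sequence is
  \<open>Qp_carleson_boxes\<close>: by the mean value property point values of \<open>f'\<close> are controlled by its
  square integral near the box, and the Green function with pole at height \<open>l J / 2\<close> above \<open>J\<close> is at
  least a multiple of \<open>(1 - \<bar>z\<bar>) / l J\<close> there. Pairing with a cover admitted in the gauge of
  the standard dyadic system (\<open>derivative_integral_le_of_gauge_less\<close>, the easy half of the duality)
  makes the tails small. On \<open>\<bar>z\<bar> \<le> \<rho>\<close> bounded sets of \<open>\<Q>\<^sub>p\<close> are normal families, so Montel's theorem,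
  Fatou's lemma and dominated convergence finish this half.

  From compactness to the gauge. Compactness makes the tails small uniformly
  (\<open>uniform_tails_of_compact_embedding\<close>), since \<open>f \<mapsto> f'\<close> is bounded between the weighted spaces.
  The hard half of the duality (\<open>laminar_greedy_duality\<close>, \<open>gauge_le_of_dual_bound\<close>) reduces the
  gauge to finite Carleson sequences \<open>\<mu>\<close>. Each of them comes from \<open>\<Q>\<^sub>p\<close>: attach to \<open>I\<close> the atom
  \<open>(l I / (1 - cnj w * z))\<^sup>2\<close> with \<open>w\<close> above \<open>I\<close>, whose derivative has size \<open>1 / l I\<close> on \<open>Q I\<close>, and
  sum the atoms with coefficients \<open>\<plusminus>x I\<close>, where \<open>(x I)\<^sup>2 * l I powr p = \<mu> I\<close>. These sums are
  bounded in \<open>\<Q>\<^sub>p\<close> whatever the signs (\<open>discrete_schur\<close>, \<open>Qp_seminorm_atomic_sum_le\<close>), and the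
  parallelogram law provides signs for which the square integral of the sum dominates the sum of the
  square integrals (\<open>exists_signs\<close>), that is, a multiple of \<open>\<Sum>I. h I * \<mu> I\<close>. All constants depend
  on \<open>p\<close> only, which gives the supremum over all dyadic systems.
\<close>

section \<open>Area measure and the mean value property\<close>

lemma nn_integral_lborel_translate:
  fixes c :: "'a::euclidean_space"
  assumes [measurable]: "f \<in> borel_measurable borel"
  shows "(\<integral>\<^sup>+x. f (c + x) \<partial>lborel) = (\<integral>\<^sup>+x. f x \<partial>lborel)"
proof -
  have "(\<integral>\<^sup>+x. f x \<partial>lborel) = (\<integral>\<^sup>+x. f x \<partial>distr lborel borel ((+) c))"
    by (simp add: lborel_distr_plus)
  then show ?thesis by (simp add: nn_integral_distr)
qed

text \<open>The uniqueness argument for Haar measure, tested against the unit ball \<open>B\<close>: in the double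
  integral of \<open>1\<^sub>A (u * x + y) * 1\<^sub>B y\<close>, translating \<open>x\<close> gives the measure of the rotated \<open>A\<close> times
  that of \<open>B\<close>, and translating \<open>y\<close> gives the measure of \<open>A\<close> times that of a unit ball, because
  \<open>y - u * x\<close> and \<open>cnj u * y - x\<close> have the same modulus.\<close>

lemma lborel_distr_rotation:
  fixes u :: complex
  assumes u: "cmod u = 1"
  shows "distr lborel borel ((*) u) = lborel"
proof (rule measure_eqI)
  fix A assume "A \<in> sets (distr lborel borel ((*) u))"
  then have A[measurable]: "A \<in> sets borel" by simp
  define B where "B = (ball 0 1 :: complex set)"
  have B[measurable]: "B \<in> sets borel" by (simp add: B_def)
  have eB: "emeasure lborel (ball c 1 :: complex set) = ennreal pi" for c
    by (subst emeasure_ball) (simp_all add: unit_ball_vol_2)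
  have "emeasure (distr lborel borel ((*) u)) A * ennreal pi
      = (\<integral>\<^sup>+x. indicator A (u * x) \<partial>lborel) * ennreal pi"
  proof -
    have "emeasure (distr lborel borel ((*) u)) A = (\<integral>\<^sup>+x. indicator A x \<partial>distr lborel borel ((*) u))"
      by simp
    also have "\<dots> = (\<integral>\<^sup>+x. indicator A (u * x) \<partial>lborel)"
      by (rule nn_integral_distr) measurable
    finally show ?thesis by simp
  qed
  also have "\<dots> = (\<integral>\<^sup>+y. (\<integral>\<^sup>+x. indicator A (u * x) * indicator B y \<partial>lborel) \<partial>lborel)"
  proof -
    have "(\<integral>\<^sup>+x. indicator A (u * x) * indicator B y \<partial>lborel)
        = (\<integral>\<^sup>+x. indicator A (u * x) \<partial>lborel) * indicator B y" for y
      by (rule nn_integral_multc) measurable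
    moreover have "(\<integral>\<^sup>+y. (\<integral>\<^sup>+x. indicator A (u * x) \<partial>lborel) * indicator B y \<partial>lborel)
        = (\<integral>\<^sup>+x. indicator A (u * x) \<partial>lborel) * (\<integral>\<^sup>+y. indicator B y \<partial>lborel)"
      by (rule nn_integral_cmult) measurable
    moreover have "(\<integral>\<^sup>+y. indicator B y \<partial>lborel) = ennreal pi"
      using eB[of 0] by (simp add: B_def[symmetric])
    ultimately show ?thesis by simp
  qed
  also have "\<dots> = (\<integral>\<^sup>+y. (\<integral>\<^sup>+x. indicator A (u * (cnj u * y + x)) * indicator B y \<partial>lborel) \<partial>lborel)"
    by (intro nn_integral_cong nn_integral_lborel_translate[symmetric]) measurable
  also have "\<dots> = (\<integral>\<^sup>+y. (\<integral>\<^sup>+x. indicator A (u * x + y) * indicator B y \<partial>lborel) \<partial>lborel)"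
  proof -
    have "u * (cnj u * y + x) = u * x + y" for x y
      using u complex_norm_square[of u] by (simp add: algebra_simps)
    then show ?thesis by simp
  qed
  also have "\<dots> = (\<integral>\<^sup>+x. (\<integral>\<^sup>+y. indicator A (u * x + y) * indicator B y \<partial>lborel) \<partial>lborel)"
    by (rule lborel_pair.Fubini') measurable
  also have "\<dots> = (\<integral>\<^sup>+x. (\<integral>\<^sup>+y. indicator A (u * x + (- (u * x) + y)) * indicator B (- (u * x) + y) \<partial>lborel) \<partial>lborel)"
    by (intro nn_integral_cong nn_integral_lborel_translate[symmetric]) measurable
  also have "\<dots> = (\<integral>\<^sup>+x. (\<integral>\<^sup>+y. indicator A y * indicator B (y - u * x) \<partial>lborel) \<partial>lborel)"
    by simp
  also have "\<dots> = (\<integral>\<^sup>+y. (\<integral>\<^sup>+x. indicator A y * indicator B (y - u * x) \<partial>lborel) \<partial>lborel)"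
    by (rule lborel_pair.Fubini') measurable
  also have "\<dots> = (\<integral>\<^sup>+y. indicator A y * (\<integral>\<^sup>+x. indicator (ball (cnj u * y) 1) x \<partial>lborel) \<partial>lborel)"
  proof (intro nn_integral_cong)
    fix y :: complex
    have "indicator B (y - u * x) = (indicator (ball (cnj u * y) 1) x :: ennreal)" for x
    proof -
      have "y - u * x = u * (cnj u * y - x)"
        using u complex_norm_square[of u] by (simp add: algebra_simps)
      then have "cmod (y - u * x) = cmod (cnj u * y - x)" by (simp add: norm_mult u)
      then show ?thesis by (simp add: B_def indicator_def dist_norm norm_minus_commute)
    qed
    then have "(\<integral>\<^sup>+x. indicator A y * indicator B (y - u * x) \<partial>lborel)
        = (\<integral>\<^sup>+x. indicator A y * indicator (ball (cnj u * y) 1) x \<partial>lborel)" by simp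
    also have "\<dots> = indicator A y * (\<integral>\<^sup>+x. indicator (ball (cnj u * y) 1) x \<partial>lborel)"
      by (rule nn_integral_cmult) (intro borel_measurable_indicator, simp)
    finally show "(\<integral>\<^sup>+x. indicator A y * indicator B (y - u * x) \<partial>lborel)
        = indicator A y * (\<integral>\<^sup>+x. indicator (ball (cnj u * y) 1) x \<partial>lborel)" .
  qed
  also have "\<dots> = emeasure lborel A * ennreal pi"
    by (simp add: eB nn_integral_multc)
  finally show "emeasure (distr lborel borel ((*) u)) A = emeasure lborel A"
    by (simp add: ennreal_mult_cancel_left mult.commute[of _ "ennreal pi"])
qed simp

text \<open>The rotation by \<open>u\<close> with \<open>u ^ k = -1\<close> preserves the integral and changes its sign.\<close>

lemma integral_ball_monomial:
  assumes k: "0 < k"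
  shows "(\<integral>w. indicator (ball 0 r) w *\<^sub>R (w ^ k) \<partial>lborel) = (0::complex)"
proof -
  define u where "u = cis (pi / real k)"
  have u: "cmod u = 1" "u ^ k = -1"
    using k by (simp_all add: u_def Complex.DeMoivre)
  let ?f = "\<lambda>w::complex. indicator (ball 0 r) w *\<^sub>R (w ^ k)"
  have [measurable]: "?f \<in> borel_measurable borel"
    by (intro borel_measurable_continuous_on_indicator continuous_intros) auto
  have "(\<integral>w. ?f w \<partial>lborel) = (\<integral>w. ?f w \<partial>distr lborel borel ((*) u))"
    using u by (simp add: lborel_distr_rotation)
  also have "\<dots> = (\<integral>w. ?f (u * w) \<partial>lborel)"
    by (rule integral_distr) measurable
  also have "\<dots> = (\<integral>w. - ?f w \<partial>lborel)"
    by (intro Bochner_Integration.integral_cong)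
       (auto simp: indicator_def norm_mult u power_mult_distrib)
  also have "\<dots> = - (\<integral>w. ?f w \<partial>lborel)" by (rule integral_minus)
  finally show ?thesis by (simp add: eq_neg_iff_add_eq_0)
qed

text \<open>Only the constant term of the power series survives integration over a disc.\<close>

lemma area_mean_value_zero:
  assumes G: "G holomorphic_on ball 0 R" and r: "0 < r" "r < R"
  shows "(\<integral>w. indicator (ball 0 r) w *\<^sub>R G w \<partial>lborel) = of_real (pi * r\<^sup>2) * G 0"
proof -
  define a where "a n = (deriv ^^ n) G 0 / fact n" for n
  have ser: "(\<lambda>n. a n * w ^ n) sums G w" if "w \<in> ball 0 R" for w
    using holomorphic_power_series[OF G that] by (simp add: a_def)
  let ?f = "\<lambda>n w. indicator (ball 0 r) w *\<^sub>R (a n * w ^ n)"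
  have abs: "summable (\<lambda>n. norm (a n) * r ^ n)"
  proof -
    define s where "s = (r + R) / 2"
    have s: "r < s" "s < R" "0 < s" using r by (auto simp: s_def)
    have "summable (\<lambda>n. a n * of_real s ^ n)"
      using ser[of "of_real s"] s by (simp add: sums_iff)
    then have "summable (\<lambda>n. norm (a n * of_real r ^ n))"
      by (rule powser_insidea) (use r s in simp)
    then show ?thesis using r by (simp add: norm_mult norm_power)
  qed
  have fin: "emeasure lborel (ball 0 r :: complex set) < \<infinity>" using r by (simp add: emeasure_ball)
  have int: "integrable lborel (?f n)" for n
    by (rule integrableI_bounded_set_indicator[where B="norm (a n) * r ^ n"])
       (use r in \<open>auto simp: norm_mult norm_power emeasure_ball intro!: AE_I2 mult_left_mono power_mono\<close>)
  have nint: "(\<integral>w. norm (?f n w) \<partial>lborel) \<le> norm (a n) * r ^ n * (pi * r\<^sup>2)" for n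
  proof -
    have "(\<integral>w. norm (?f n w) \<partial>lborel) \<le> (\<integral>w. indicator (ball 0 r :: complex set) w *\<^sub>R (norm (a n) * r ^ n) \<partial>lborel)"
    proof (rule integral_mono)
      show "integrable lborel (\<lambda>w. norm (?f n w))" by (rule integrable_norm[OF int])
      show "integrable lborel (\<lambda>w. indicator (ball 0 r :: complex set) w *\<^sub>R (norm (a n) * r ^ n))"
        using fin by (intro integrable_indicator integrable_scaleR_left) auto
      show "norm (?f n w) \<le> indicator (ball 0 r :: complex set) w *\<^sub>R (norm (a n) * r ^ n)" for w
        using r by (cases "w \<in> ball 0 r") (auto simp: norm_mult norm_power intro!: mult_left_mono power_mono)
    qed
    also have "\<dots> = norm (a n) * r ^ n * (pi * r\<^sup>2)"
      using r by (simp add: content_ball unit_ball_vol_2)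
    finally show ?thesis .
  qed
  have "(\<lambda>n. integral\<^sup>L lborel (?f n)) sums (\<integral>w. (\<Sum>n. ?f n w) \<partial>lborel)"
  proof (rule sums_integral[OF int])
    show "AE w in lborel. summable (\<lambda>n. norm (?f n w))"
    proof (intro AE_I2)
      fix w :: complex
      show "summable (\<lambda>n. norm (?f n w))"
        by (rule summable_comparison_test'[OF abs, of 0])
           (use r in \<open>auto simp: norm_mult norm_power indicator_def intro!: mult_left_mono power_mono\<close>)
    qed
    show "summable (\<lambda>n. \<integral>w. norm (?f n w) \<partial>lborel)"
      by (rule summable_comparison_test'[OF summable_mult2[OF abs, of "pi * r\<^sup>2"], of 0])
         (use nint in auto)
  qed
  moreover have "(\<Sum>n. ?f n w) = indicator (ball 0 r) w *\<^sub>R G w" for w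
    using ser[of w] r by (auto simp: indicator_def sums_iff)
  moreover have "integral\<^sup>L lborel (?f n) = (if n = 0 then of_real (pi * r\<^sup>2) * G 0 else 0)" for n
  proof -
    have "?f n = (\<lambda>w. a n * (indicator (ball 0 r) w *\<^sub>R w ^ n))" by (auto simp: indicator_def)
    then have "integral\<^sup>L lborel (?f n) = a n * integral\<^sup>L lborel (\<lambda>w. indicator (ball 0 r) w *\<^sub>R w ^ n)"
      by (simp only: integral_mult_right_zero)
    then show ?thesis
      using integral_ball_monomial[of n r] r
      by (auto simp: a_def content_ball unit_ball_vol_2 scaleR_conv_of_real)
  qed
  ultimately have "(\<lambda>n. if n = 0 then of_real (pi * r\<^sup>2) * G 0 else 0) sums
      (\<integral>w. indicator (ball 0 r) w *\<^sub>R G w \<partial>lborel)" by simp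
  moreover have "(\<lambda>n. if n = 0 then of_real (pi * r\<^sup>2) * G 0 else 0) sums (of_real (pi * r\<^sup>2) * G 0)"
    using sums_single[of 0 "\<lambda>_. of_real (pi * r\<^sup>2) * G 0"] by simp
  ultimately show ?thesis by (metis sums_unique2)
qed

lemma sets_area_measure: "sets area_measure = sets (restrict_space lebesgue unit_disc)"
  and space_area_measure [simp]: "space area_measure = unit_disc"
  by (simp_all add: area_measure_def space_scale_measure space_restrict_space)

lemma measurable_area_measure: "borel_measurable area_measure = borel_measurable (lebesgue_on unit_disc)"
  by (intro measurable_cong_sets) (simp_all add: sets_area_measure)

lemma nn_integral_area_measure:
  assumes f: "f \<in> borel_measurable borel"
  shows "(\<integral>\<^sup>+z. f z \<partial>area_measure) = ennreal (1 / pi) * (\<integral>\<^sup>+z. f z * indicator unit_disc z \<partial>lborel)"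
proof -
  have "f \<in> borel_measurable area_measure"
    unfolding measurable_area_measure
    by (rule measurable_restrict_space1, rule measurable_completion) (use f in simp)
  then have "(\<integral>\<^sup>+z. f z \<partial>area_measure) = ennreal (1 / pi) * (\<integral>\<^sup>+z. f z \<partial>(lebesgue_on unit_disc))"
    by (simp add: area_measure_def nn_integral_scale_measure measurable_area_measure)
  also have "(\<integral>\<^sup>+z. f z \<partial>(lebesgue_on unit_disc)) = (\<integral>\<^sup>+z. f z * indicator unit_disc z \<partial>lebesgue)"
    by (rule nn_integral_restrict_space) simp
  also have "\<dots> = (\<integral>\<^sup>+z. f z * indicator unit_disc z \<partial>lborel)"
    by (rule nn_integral_completion)
  finally show ?thesis .
qed

lemma continuous_imp_measurable_area:
  fixes f :: "complex \<Rightarrow> 'a::{second_countable_topology, t2_space}"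
  assumes "continuous_on unit_disc f"
  shows "f \<in> borel_measurable area_measure"
  unfolding measurable_area_measure
  using assms by (rule continuous_imp_measurable_on_sets_lebesgue) simp

text \<open>The mean value property of \<open>g\<^sup>2\<close>. Later \<open>g\<close> is a derivative: the square integrals in the
  definition of \<open>\<Q>\<^sub>p\<close> control its point values.\<close>

lemma norm_sq_le_area_integral:
  assumes g: "g holomorphic_on unit_disc" and r: "0 < r" "cmod z + r < 1"
  shows "ennreal ((cmod (g z))\<^sup>2 * r\<^sup>2) \<le> (\<integral>\<^sup>+w. ennreal ((cmod (g w))\<^sup>2) * indicator (ball z r) w \<partial>area_measure)"
proof -
  define G where "G w = (g (z + w))\<^sup>2" for w
  define R where "R = 1 - cmod z"
  have sub: "z + w \<in> unit_disc" if "w \<in> ball 0 R" for w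
    using that norm_triangle_ineq[of z w] by (simp add: R_def)
  have holG: "G holomorphic_on ball 0 R"
    unfolding G_def
  proof -
    have "(g \<circ> (\<lambda>w. z + w)) holomorphic_on ball 0 R"
    proof (rule holomorphic_on_compose)
      show "g holomorphic_on (\<lambda>w. z + w) ` ball 0 R"
        by (rule holomorphic_on_subset[OF g]) (use sub in blast)
    qed (intro holomorphic_intros)
    then show "(\<lambda>w. (g (z + w))\<^sup>2) holomorphic_on ball 0 R"
      by (intro holomorphic_intros) (simp add: o_def)
  qed
  let ?g = "\<lambda>w. indicator (ball 0 r) w *\<^sub>R G w"
  have sub0: "ball 0 r \<subseteq> ball 0 R" using r by (auto simp: R_def)
  have [measurable]: "?g \<in> borel_measurable borel"
    using continuous_on_subset[OF holomorphic_on_imp_continuous_on[OF holG] sub0]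
    by (intro borel_measurable_continuous_on_indicator) auto
  have "of_real (pi * r\<^sup>2) * G 0 = (\<integral>w. ?g w \<partial>lborel)"
    using area_mean_value_zero[OF holG, of r] r by (simp add: R_def)
  then have "ennreal (pi * r\<^sup>2 * cmod (G 0)) = ennreal (norm (\<integral>w. ?g w \<partial>lborel))"
    by (metis abs_of_nonneg mult_nonneg_nonneg norm_mult norm_of_real pi_ge_zero zero_le_power2)
  also have "\<dots> \<le> (\<integral>\<^sup>+w. ennreal (norm (?g w)) \<partial>lborel)"
  proof (cases "integrable lborel ?g")
    case True then show ?thesis by (rule integral_norm_bound_ennreal)
  qed (simp add: not_integrable_integral_eq)
  also have "\<dots> = (\<integral>\<^sup>+w. ennreal (norm (?g (-z + w))) \<partial>lborel)"
    by (rule nn_integral_lborel_translate[symmetric]) measurable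
  also have "\<dots> = (\<integral>\<^sup>+w. ennreal ((cmod (g w))\<^sup>2) * indicator (ball z r) w * indicator unit_disc w \<partial>lborel)"
  proof (intro nn_integral_cong)
    fix w
    have "-z + w \<in> ball 0 r \<longleftrightarrow> w \<in> ball z r" by (simp add: dist_norm norm_minus_commute)
    moreover have "w \<in> unit_disc" if "w \<in> ball z r"
      using that r norm_triangle_ineq2[of w z] by (auto simp: dist_norm norm_minus_commute)
    ultimately show "ennreal (norm (?g (-z + w))) = ennreal ((cmod (g w))\<^sup>2) * indicator (ball z r) w * indicator unit_disc w"
      by (cases "w \<in> ball z r") (auto simp: G_def norm_power)
  qed
  finally have *: "ennreal (pi * r\<^sup>2 * cmod (G 0)) \<le>
     (\<integral>\<^sup>+w. ennreal ((cmod (g w))\<^sup>2) * indicator (ball z r) w * indicator unit_disc w \<partial>lborel)" .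
  let ?h = "\<lambda>w. ennreal (norm (?g (-z + w)))"
  have hm: "?h \<in> borel_measurable borel" by measurable
  have heq: "?h w = ennreal ((cmod (g w))\<^sup>2) * indicator (ball z r) w" for w
    by (cases "w \<in> ball z r") (auto simp: G_def norm_power dist_norm norm_minus_commute)
  have "ennreal ((cmod (g z))\<^sup>2 * r\<^sup>2) = ennreal (1 / pi) * ennreal (pi * r\<^sup>2 * cmod (G 0))"
    by (subst ennreal_mult[symmetric]) (auto simp: G_def norm_power field_simps)
  also have "\<dots> \<le> ennreal (1 / pi) * (\<integral>\<^sup>+w. ennreal ((cmod (g w))\<^sup>2) * indicator (ball z r) w * indicator unit_disc w \<partial>lborel)"
    by (intro mult_left_mono *) simp
  also have "\<dots> = (\<integral>\<^sup>+w. ennreal ((cmod (g w))\<^sup>2) * indicator (ball z r) w \<partial>area_measure)"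
    using nn_integral_area_measure[OF hm] by (simp only: heq)
  finally show ?thesis .
qed

lemma emeasure_area_ball: "emeasure area_measure (ball z r \<inter> unit_disc) \<le> ennreal (r\<^sup>2)"
proof (cases "0 < r")
  case True
  have "emeasure area_measure (ball z r \<inter> unit_disc) = (\<integral>\<^sup>+w. indicator (ball z r) w \<partial>area_measure)"
    by (subst nn_integral_indicator[symmetric])
       (auto simp: sets_area_measure sets_restrict_space indicator_def intro!: nn_integral_cong)
  also have "\<dots> = ennreal (1 / pi) * (\<integral>\<^sup>+w. indicator (ball z r) w * indicator unit_disc w \<partial>lborel)"
    by (rule nn_integral_area_measure) (intro borel_measurable_indicator borel_open open_ball)
  also have "\<dots> \<le> ennreal (1 / pi) * (\<integral>\<^sup>+w. indicator (ball z r) w \<partial>lborel)"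
    by (intro mult_left_mono nn_integral_mono) (auto simp: indicator_def)
  also have "\<dots> = ennreal (r\<^sup>2)"
    using True by (simp add: emeasure_ball unit_ball_vol_2 ennreal_mult[symmetric])
  finally show ?thesis .
next
  case False
  then have "ball z r = {}" by (simp add: ball_empty)
  then have "ball z r \<inter> unit_disc = {}" by blast
  then show ?thesis by simp
qed

section \<open>Half-open arcs and dyadic systems\<close>

lemma cis_eq_iff_int: "cis a = cis b \<longleftrightarrow> (\<exists>m::int. a = b + 2 * pi * m)"
  using sin_cos_eq_iff[of a b] by (auto simp: complex_eq_iff)

lemma cis_turn_eq_iff: "cis (2 * pi * a) = cis (2 * pi * b) \<longleftrightarrow> (\<exists>m::int. a = b + m)"
proof -
  have "2 * pi * a = 2 * pi * b + 2 * pi * m \<longleftrightarrow> a = b + m" for m :: real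
    using pi_gt_zero by (simp add: ring_distribs[symmetric])
  then show ?thesis by (simp add: cis_eq_iff_int)
qed

lemma unit_circle_turn:
  assumes "z \<in> unit_circle"
  obtains \<tau> where "0 \<le> \<tau>" "\<tau> < 1" "z = cis (2 * pi * \<tau>)"
proof -
  have z: "cmod z = 1" using assms by simp
  then have "z \<noteq> 0" by auto
  then have "z = cis (Arg z)" using z by (simp add: cis_Arg sgn_eq)
  also have "\<dots> = cis (2 * pi * frac (Arg z / (2 * pi)))"
    unfolding cis_eq_iff_int
    by (rule exI[of _ "\<lfloor>Arg z / (2 * pi)\<rfloor>"]) (simp add: frac_def field_simps)
  finally show ?thesis by (intro that[of "frac (Arg z / (2 * pi))"]) (simp_all add: frac_lt_1)
qed

lemma norm_cis_diff: "cmod (cis a - cis b) = 2 * \<bar>sin ((a - b) / 2)\<bar>"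
proof -
  have "cis a = cis b * cis (a - b)" by (simp add: cis_mult)
  then have "cis a - cis b = cis b * (exp (\<i> * of_real (a - b)) - 1)"
    by (simp add: cis_conv_exp right_diff_distrib)
  then show ?thesis by (simp add: norm_mult dist_exp_i_1 del: of_real_diff)
qed

lemma jordan_inequality:
  assumes "0 \<le> x" "x \<le> pi / 2"
  shows "2 / pi * x \<le> sin (x::real)"
proof -
  have "concave_on {0..pi/2} sin"
    by (rule f''_le0_imp_concave[where f'=cos and f''="\<lambda>x. - sin x"])
       (auto intro!: derivative_eq_intros sin_ge_zero)
  from concave_onD[OF this, of "2 / pi * x" 0 "pi / 2"] assms
  show ?thesis by (simp add: field_simps)
qed

text \<open>The parameter interval is shifted so that it starts in \<open>[0, 1)\<close>. The parameters in \<open>[0, 1)\<close> of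
  the points of the arc then form the part of the interval below 1 and the part beyond 1, moved back by
  a full turn.\<close>

lemma arc_length_half_open:
  assumes l: "0 < l" "l \<le> (1::real)"
    and I: "I = (\<lambda>t. cis (2 * pi * t)) ` {\<alpha>..<\<alpha> + l} \<or> I = (\<lambda>t. cis (2 * pi * t)) ` {\<alpha><..\<alpha> + l}"
  shows "arc_length I = l"
proof -
  obtain \<beta> :: real and n :: int where \<beta>: "0 \<le> \<beta>" "\<beta> < 1" and \<alpha>: "\<alpha> = \<beta> + n"
    by (rule that[of "frac \<alpha>" "\<lfloor>\<alpha>\<rfloor>"]) (simp_all add: frac_lt_1, simp add: frac_def)
  have key: "{t \<in> {0..<1}. cis (2 * pi * t) \<in> (\<lambda>t. cis (2 * pi * t)) ` S}
     = {t \<in> {0..<1}. t + real_of_int n \<in> S} \<union> {t \<in> {0..<1}. t + real_of_int n + 1 \<in> S}"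
    if S: "\<And>s. s \<in> S \<Longrightarrow> \<alpha> \<le> s \<and> s \<le> \<alpha> + l" for S :: "real set"
  proof -
    have shift: "(\<exists>s\<in>S. \<exists>m::int. t = s + m) \<longleftrightarrow> t + n \<in> S \<or> t + n + 1 \<in> S"
      if t: "0 \<le> t" "t < 1" for t :: real
    proof
      assume "\<exists>s\<in>S. \<exists>m::int. t = s + m"
      then obtain s and m :: int where s: "s \<in> S" "t = s + m" by blast
      have b: "\<beta> + n \<le> s" "s \<le> \<beta> + n + l" using S[OF s(1)] by (simp_all add: \<alpha>)
      define j where "j = - m - n"
      have sj: "s = t + n + j" using s by (simp add: j_def)
      have "- 1 < (of_int j :: real)" "(of_int j :: real) < 2"
        using b sj t l \<beta> by linarith+
      then have "j = 0 \<or> j = 1" by linarith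
      then have "s = t + n \<or> s = t + n + 1" using sj by (elim disjE) simp_all
      then show "t + n \<in> S \<or> t + n + 1 \<in> S" using s(1) by (elim disjE) simp_all
    next
      assume "t + n \<in> S \<or> t + n + 1 \<in> S"
      then show "\<exists>s\<in>S. \<exists>m::int. t = s + m"
      proof
        assume "t + n \<in> S"
        then show ?thesis by (intro bexI[of _ "t + n"] exI[of _ "- n"]) auto
      next
        assume "t + n + 1 \<in> S"
        then show ?thesis by (intro bexI[of _ "t + n + 1"] exI[of _ "- n - 1"]) auto
      qed
    qed
    have im: "cis (2 * pi * t) \<in> (\<lambda>t. cis (2 * pi * t)) ` S \<longleftrightarrow> (\<exists>s\<in>S. \<exists>m::int. t = s + m)" for t
      unfolding image_iff cis_turn_eq_iff ..
    show ?thesis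
    proof (rule set_eqI)
      fix t :: real
      show "t \<in> {t \<in> {0..<1}. cis (2 * pi * t) \<in> (\<lambda>t. cis (2 * pi * t)) ` S} \<longleftrightarrow>
        t \<in> {t \<in> {0..<1}. t + real_of_int n \<in> S} \<union> {t \<in> {0..<1}. t + real_of_int n + 1 \<in> S}"
      proof (cases "0 \<le> t \<and> t < 1")
        case True
        then show ?thesis using shift[of t] unfolding mem_Collect_eq Un_iff im by simp
      qed auto
    qed
  qed
  have meas: "measure lebesgue (A \<union> B) = measure lebesgue A + measure lebesgue B"
    if "A \<in> lmeasurable" "B \<in> lmeasurable" "A \<inter> B = {}" for A B :: "real set"
    using that by (simp add: measure_Un3)
  from I show ?thesis
  proof
    assume I: "I = (\<lambda>t. cis (2 * pi * t)) ` {\<alpha>..<\<alpha> + l}"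
    have e1: "{t \<in> {0..<1}. t + real_of_int n \<in> {\<alpha>..<\<alpha> + l}} = {\<beta>..<min (\<beta> + l) 1}"
      using \<beta>(1,2) unfolding \<alpha> by (intro set_eqI) (simp, linarith)
    have e2: "{t \<in> {0..<1}. t + real_of_int n + 1 \<in> {\<alpha>..<\<alpha> + l}} = {0..<max (\<beta> + l - 1) 0}"
      using \<beta>(1,2) l unfolding \<alpha> by (intro set_eqI) (simp, linarith)
    have T: "{t \<in> {0..<1}. cis (2 * pi * t) \<in> I} = {\<beta>..<min (\<beta> + l) 1} \<union> {0..<max (\<beta> + l - 1) 0}"
      unfolding I e1[symmetric] e2[symmetric] by (rule key) auto
    have "arc_length I = measure lebesgue {\<beta>..<min (\<beta> + l) 1} + measure lebesgue {0..<max (\<beta> + l - 1) 0}"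
      unfolding arc_length_def T by (rule meas) (use l \<beta>(1,2) in \<open>auto intro!: bounded_set_imp_lmeasurable\<close>)
    then show ?thesis using l \<beta>(1,2) by (simp add: min_def max_def)
  next
    assume I: "I = (\<lambda>t. cis (2 * pi * t)) ` {\<alpha><..\<alpha> + l}"
    have e1: "{t \<in> {0..<1}. t + real_of_int n \<in> {\<alpha><..\<alpha> + l}} = (if \<beta> + l < 1 then {\<beta><..\<beta> + l} else {\<beta><..<1})"
      using \<beta>(1,2) unfolding \<alpha> by (intro set_eqI) (simp, linarith)
    have e2: "{t \<in> {0..<1}. t + real_of_int n + 1 \<in> {\<alpha><..\<alpha> + l}} = {0..\<beta> + l - 1}"
      using \<beta>(1,2) l unfolding \<alpha> by (intro set_eqI) (simp, linarith)
    have T: "{t \<in> {0..<1}. cis (2 * pi * t) \<in> I} = (if \<beta> + l < 1 then {\<beta><..\<beta> + l} else {\<beta><..<1}) \<union> {0..\<beta> + l - 1}"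
      unfolding I e1[symmetric] e2[symmetric] by (rule key) auto
    have "arc_length I = measure lebesgue (if \<beta> + l < 1 then {\<beta><..\<beta> + l} else {\<beta><..<1}) + measure lebesgue {0..\<beta> + l - 1}"
      unfolding arc_length_def T by (rule meas) (use l \<beta>(1,2) in \<open>auto intro!: bounded_set_imp_lmeasurable\<close>)
    then show ?thesis using l \<beta>(1,2) by simp
  qed
qed

lemma half_open_arc_lengthE:
  assumes "half_open_arc I"
  obtains \<alpha> where "0 < arc_length I" "arc_length I \<le> 1"
    "I = (\<lambda>t. cis (2 * pi * t)) ` {\<alpha>..<\<alpha> + arc_length I} \<or>
     I = (\<lambda>t. cis (2 * pi * t)) ` {\<alpha><..\<alpha> + arc_length I}"
proof -
  from assms obtain \<alpha> l where *: "0 < l" "l \<le> 1"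
    "I = (\<lambda>t. cis (2 * pi * t)) ` {\<alpha>..<\<alpha> + l} \<or> I = (\<lambda>t. cis (2 * pi * t)) ` {\<alpha><..\<alpha> + l}"
    unfolding half_open_arc_def by auto
  have "arc_length I = l" by (rule arc_length_half_open[OF *])
  with * show ?thesis by (intro that[of \<alpha>]) simp_all
qed

text \<open>The factor 7 is a rational bound for \<open>2 * pi\<close>.\<close>

lemma half_open_arc_diameter:
  assumes "half_open_arc I" "x \<in> I" "y \<in> I"
  shows "cmod (x - y) \<le> 7 * arc_length I"
proof -
  from half_open_arc_lengthE[OF assms(1)] obtain \<alpha> where
    l: "0 < arc_length I" "arc_length I \<le> 1" and
    I: "I = (\<lambda>t. cis (2 * pi * t)) ` {\<alpha>..<\<alpha> + arc_length I} \<or>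
        I = (\<lambda>t. cis (2 * pi * t)) ` {\<alpha><..\<alpha> + arc_length I}" .
  have sub: "I \<subseteq> (\<lambda>t. cis (2 * pi * t)) ` {\<alpha>..\<alpha> + arc_length I}"
    using I
  proof
    assume "I = (\<lambda>t. cis (2 * pi * t)) ` {\<alpha>..<\<alpha> + arc_length I}"
    also have "\<dots> \<subseteq> (\<lambda>t. cis (2 * pi * t)) ` {\<alpha>..\<alpha> + arc_length I}" by (rule image_mono) auto
    finally show ?thesis .
  next
    assume "I = (\<lambda>t. cis (2 * pi * t)) ` {\<alpha><..\<alpha> + arc_length I}"
    also have "\<dots> \<subseteq> (\<lambda>t. cis (2 * pi * t)) ` {\<alpha>..\<alpha> + arc_length I}" by (rule image_mono) auto
    finally show ?thesis .
  qed
  obtain s where s: "x = cis (2 * pi * s)" "s \<in> {\<alpha>..\<alpha> + arc_length I}" using sub assms(2) by blast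
  obtain t where t: "y = cis (2 * pi * t)" "t \<in> {\<alpha>..\<alpha> + arc_length I}" using sub assms(3) by blast
  note st = s(1) t(1)
  have st': "\<bar>s - t\<bar> \<le> arc_length I" using s t by auto
  have "cmod (x - y) \<le> 2 * \<bar>(2 * pi * s - 2 * pi * t) / 2\<bar>"
    unfolding st norm_cis_diff by (intro mult_left_mono abs_sin_x_le_abs_x) simp
  also have "\<dots> = 2 * pi * \<bar>s - t\<bar>"
    by (simp add: abs_mult flip: right_diff_distrib)
  also have "\<dots> \<le> 7 * arc_length I"
    using st' pi_approx by (intro mult_mono) auto
  finally show ?thesis .
qed

text \<open>With its missing endpoint the arc is compact.\<close>

lemma half_open_arc_borel:
  assumes "half_open_arc I"
  shows "I \<in> sets borel"
proof -
  let ?c = "\<lambda>t. cis (2 * pi * t)"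
  have cl: "closed (?c ` {a..b})" for a b :: real
    by (intro compact_imp_closed compact_continuous_image continuous_intros) auto
  have *: "X \<in> sets borel" if "insert p X = C" "closed C" for X C and p :: complex
  proof -
    have "X = C \<or> X = C - {p}" using that by blast
    moreover have "C \<in> sets borel" using that(2) by (rule borel_closed)
    ultimately show ?thesis by (metis borel_singleton sets.Diff sets.empty_sets)
  qed
  from assms obtain \<alpha> l where l: "0 < l"
    and I: "I = ?c ` {\<alpha>..<\<alpha> + l} \<or> I = ?c ` {\<alpha><..\<alpha> + l}"
    unfolding half_open_arc_def by auto
  have ins: "insert (\<alpha> + l) {\<alpha>..<\<alpha> + l} = {\<alpha>..\<alpha> + l}" "insert \<alpha> {\<alpha><..\<alpha> + l} = {\<alpha>..\<alpha> + l}"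
    using l by auto
  from I show ?thesis
  proof
    assume I: "I = ?c ` {\<alpha>..<\<alpha> + l}"
    have "insert (?c (\<alpha> + l)) I = ?c ` {\<alpha>..\<alpha> + l}"
      unfolding I ins(1)[symmetric] by (rule image_insert[symmetric])
    then show ?thesis using cl by (rule *)
  next
    assume I: "I = ?c ` {\<alpha><..\<alpha> + l}"
    have "insert (?c \<alpha>) I = ?c ` {\<alpha>..\<alpha> + l}"
      unfolding I ins(2)[symmetric] by (rule image_insert[symmetric])
    then show ?thesis using cl by (rule *)
  qed
qed

lemma half_open_arc_subset_circle: "half_open_arc I \<Longrightarrow> I \<subseteq> unit_circle"
  unfolding half_open_arc_def by auto

text \<open>By Jordan's inequality, points at distance at most \<open>R\<close> are at most \<open>R / 4\<close> of a turn apart. The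
  parameters thus lie in three translates of one interval of length \<open>R / 2\<close>.\<close>

lemma cap_measure_le:
  assumes \<zeta>: "cmod \<zeta> = 1" and R: "0 \<le> R"
    and T: "T \<in> sets lebesgue" "T \<subseteq> {t \<in> {0..<1}. cmod (cis (2 * pi * t) - \<zeta>) \<le> R}"
  shows "measure lebesgue T \<le> 2 * R" and "T \<in> lmeasurable"
proof -
  have "\<zeta> \<in> unit_circle" using \<zeta> by simp
  then obtain \<tau> where \<tau>: "0 \<le> \<tau>" "\<tau> < 1" and \<zeta>': "\<zeta> = cis (2 * pi * \<tau>)" by (rule unit_circle_turn)
  let ?U = "{\<tau> - R/4..\<tau> + R/4} \<union> {\<tau> - 1 - R/4..\<tau> - 1 + R/4} \<union> {\<tau> + 1 - R/4..\<tau> + 1 + R/4}"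
  have sub: "T \<subseteq> ?U"
  proof
    fix t assume "t \<in> T"
    then have t: "0 \<le> t" "t < 1" "cmod (cis (2 * pi * t) - \<zeta>) \<le> R" using T by auto
    define m :: real where "m = (if t - \<tau> > 1/2 then 1 else if t - \<tau> < -1/2 then -1 else 0)"
    define d where "d = t - \<tau> - m"
    have d: "\<bar>d\<bar> \<le> 1/2" using t \<tau> unfolding d_def m_def abs_le_iff by auto
    have m: "m = 0 \<or> m = 1 \<or> m = - 1" by (simp add: m_def)
    have "cis (2 * pi * t) = cis (2 * pi * (\<tau> + d))"
      unfolding cis_turn_eq_iff
      by (rule exI[of _ "if t - \<tau> > 1/2 then 1 else if t - \<tau> < -1/2 then -1 else 0"]) (simp add: d_def m_def)
    then have "cmod (cis (2 * pi * t) - \<zeta>) = 2 * \<bar>sin (pi * d)\<bar>"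
      unfolding \<zeta>' by (simp add: norm_cis_diff algebra_simps)
    also have "\<bar>sin (pi * d)\<bar> = sin (pi * \<bar>d\<bar>)"
    proof -
      have "0 \<le> sin (pi * \<bar>d\<bar>)" using d by (intro sin_ge_zero) (auto simp: field_simps)
      then show ?thesis by (cases "d \<ge> 0") auto
    qed
    also have "2 * sin (pi * \<bar>d\<bar>) \<ge> 2 * (2 / pi * (pi * \<bar>d\<bar>))"
      using d by (intro mult_left_mono jordan_inequality) (auto simp: field_simps)
    finally have "\<bar>d\<bar> \<le> R / 4" using t by simp
    then have "\<tau> + m - R / 4 \<le> t \<and> t \<le> \<tau> + m + R / 4" unfolding d_def abs_le_iff by linarith
    with m show "t \<in> ?U" by (elim disjE) simp_all
  qed
  have U: "?U \<in> lmeasurable" by (intro fmeasurable.Un) auto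
  show "T \<in> lmeasurable"
    using U sub T(1) by (rule fmeasurableI2)
  have "measure lebesgue T \<le> measure lebesgue ?U"
    using sub T U by (intro measure_mono_fmeasurable) auto
  also have "\<dots> \<le> measure lebesgue {\<tau> - R/4..\<tau> + R/4} + measure lebesgue {\<tau> - 1 - R/4..\<tau> - 1 + R/4}
      + measure lebesgue {\<tau> + 1 - R/4..\<tau> + 1 + R/4}"
    by (intro order_trans[OF measure_Un_le] add_right_mono measure_Un_le) auto
  also have "\<dots> \<le> 2 * R" using R by simp
  finally show "measure lebesgue T \<le> 2 * R" .
qed

text \<open>A dyadic system is the union of its generations; the estimates below are organized by generation,
  so the locale keeps the sequence of generations itself.\<close>

locale dyadic_levels =
  fixes D :: "nat \<Rightarrow> complex set set"
  assumes level_0: "D 0 = {unit_circle}"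
    and partition: "partition_on unit_circle (D k)"
    and card_level: "card (D k) = 2 ^ k"
    and arc: "I \<in> D k \<Longrightarrow> half_open_arc I"
    and arc_length_level: "I \<in> D k \<Longrightarrow> arc_length I = 1 / 2 ^ k"
    and nested: "J \<in> D (Suc k) \<Longrightarrow> \<exists>I\<in>D k. J \<subseteq> I"
begin

definition nodes :: "complex set set" where "nodes = (\<Union>k. D k)"

text \<open>An arbitrary point of the arc, used to locate the arc up to its length.\<close>

definition pt :: "complex set \<Rightarrow> complex" where "pt I = (SOME x. x \<in> I)"

lemma nodesE: assumes "I \<in> nodes" obtains k where "I \<in> D k" "arc_length I = 1 / 2 ^ k"
  using assms arc_length_level by (auto simp: nodes_def)

lemma level_nodes: "I \<in> D k \<Longrightarrow> I \<in> nodes" by (auto simp: nodes_def)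

lemma finite_level [simp]: "finite (D k)"
  using card_level[of k] by (metis card.infinite power_not_zero zero_neq_numeral)

lemma node_nonempty: "I \<in> nodes \<Longrightarrow> I \<noteq> {}"
  using partition partition_onD3 by (auto simp: nodes_def)

lemma pt_in: "I \<in> nodes \<Longrightarrow> pt I \<in> I"
  using node_nonempty unfolding pt_def by (simp add: some_in_eq)

lemma node_subset_circle: "I \<in> nodes \<Longrightarrow> I \<subseteq> unit_circle"
  using arc half_open_arc_subset_circle by (auto simp: nodes_def)

lemma norm_pt: "I \<in> nodes \<Longrightarrow> cmod (pt I) = 1"
  using pt_in node_subset_circle by fastforce

lemma node_arc: "I \<in> nodes \<Longrightarrow> half_open_arc I" using arc by (auto simp: nodes_def)

lemma arc_length_pos: "I \<in> nodes \<Longrightarrow> 0 < arc_length I" by (erule nodesE) simp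

lemma arc_length_le_1: "I \<in> nodes \<Longrightarrow> arc_length I \<le> 1" by (erule nodesE) simp

lemma node_diameter: "I \<in> nodes \<Longrightarrow> x \<in> I \<Longrightarrow> y \<in> I \<Longrightarrow> cmod (x - y) \<le> 7 * arc_length I"
  by (intro half_open_arc_diameter node_arc)

lemma level_disjoint: "I \<in> D k \<Longrightarrow> J \<in> D k \<Longrightarrow> I \<inter> J \<noteq> {} \<Longrightarrow> I = J"
  using partition_onD2[OF partition[of k]] unfolding disjoint_def by blast

lemma level_unique: "I \<in> D k \<Longrightarrow> I \<in> D m \<Longrightarrow> k = m"
  using arc_length_level[of I k] arc_length_level[of I m] by simp

lemma ancestor: "k \<le> n \<Longrightarrow> I \<in> D n \<Longrightarrow> \<exists>J\<in>D k. I \<subseteq> J"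
proof (induction n arbitrary: I)
  case 0 then show ?case by auto
next
  case (Suc n)
  show ?case
  proof (cases "k = Suc n")
    case False
    from nested[OF Suc.prems(2)] obtain I' where I': "I' \<in> D n" "I \<subseteq> I'" by auto
    from Suc.IH[OF _ I'(1)] False Suc.prems obtain J where "J \<in> D k" "I' \<subseteq> J" by auto
    then show ?thesis using I' by blast
  qed (use Suc in auto)
qed

lemma level_subset_if_meet:
  assumes I: "I \<in> D n" and J: "J \<in> D k" and "k \<le> n" "I \<inter> J \<noteq> {}"
  shows "I \<subseteq> J"
proof -
  from ancestor[OF \<open>k \<le> n\<close> I] obtain J' where J': "J' \<in> D k" "I \<subseteq> J'" by auto
  then have "J' = J" using assms by (intro level_disjoint[of J' k]) auto
  then show ?thesis using J' by simp
qed

lemma laminar: "I \<in> nodes \<Longrightarrow> J \<in> nodes \<Longrightarrow> I \<inter> J \<noteq> {} \<Longrightarrow> I \<subseteq> J \<or> J \<subseteq> I"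
  unfolding nodes_def
  using level_subset_if_meet[of I _ J] level_subset_if_meet[of J _ I]
  by (metis UN_iff inf_commute nat_le_linear)

lemma subset_level_le:
  assumes I: "I \<in> D n" and J: "J \<in> D k" and sub: "I \<subseteq> J"
  shows "k \<le> n"
proof (rule ccontr)
  assume "\<not> k \<le> n"
  moreover have "J \<inter> I \<noteq> {}" using sub node_nonempty[OF level_nodes[OF I]] by auto
  ultimately have "J \<subseteq> I" using level_subset_if_meet[OF J I] by auto
  then have "I = J" using sub by auto
  then show False using level_unique I J \<open>\<not> k \<le> n\<close> by auto
qed

lemma arc_length_mono:
  assumes "I \<in> nodes" "J \<in> nodes" "I \<subseteq> J"
  shows "arc_length I \<le> arc_length J"
proof -
  from assms obtain n k where nk: "I \<in> D n" "J \<in> D k" by (auto simp: nodes_def)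
  have "k \<le> n" using subset_level_le nk assms by blast
  then show ?thesis
    unfolding arc_length_level[OF nk(1)] arc_length_level[OF nk(2)] by (intro divide_left_mono power_increasing) simp_all
qed

lemma finite_ancestors: assumes "I \<in> nodes" shows "finite {J \<in> nodes. I \<subseteq> J}"
proof -
  from assms obtain n where n: "I \<in> D n" by (auto simp: nodes_def)
  have "{J \<in> nodes. I \<subseteq> J} \<subseteq> (\<Union>k\<le>n. D k)"
    using subset_level_le[OF n] by (auto simp: nodes_def)
  then show ?thesis by (rule finite_subset) auto
qed

lemma circle_covered: "\<zeta> \<in> unit_circle \<Longrightarrow> \<exists>I\<in>D k. \<zeta> \<in> I"
  using partition partition_onD1[of unit_circle "D k"] by auto

text \<open>Arcs of one generation are disjoint and of equal length, and those that come close to \<open>\<zeta>\<close> lie in a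
  slightly larger cap. Comparing measures bounds their number.\<close>

lemma count_level_near:
  assumes \<zeta>: "cmod \<zeta> = 1" and R: "0 \<le> R"
    and S: "S \<subseteq> D k" "\<And>I. I \<in> S \<Longrightarrow> \<exists>x\<in>I. cmod (x - \<zeta>) \<le> R"
  shows "real (card S) \<le> 14 * (R * 2 ^ k + 1)"
proof -
  define T where "T I = {t \<in> {0..<1}. cis (2 * pi * t) \<in> I}" for I
  have fin: "finite S" using S(1) finite_level finite_subset by blast
  have mT: "measure lebesgue (T I) = 1 / 2 ^ k" if "I \<in> S" for I
    using that S arc_length_level[of I k] by (auto simp: arc_length_def T_def)
  have sT: "T I \<in> sets lebesgue" if "I \<in> S" for I
    using mT[OF that] measure_notin_sets by fastforce
  have sub: "T I \<subseteq> {t \<in> {0..<1}. cmod (cis (2 * pi * t) - \<zeta>) \<le> R + 7 * (1 / 2 ^ k)}" if "I \<in> S" for I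
  proof
    fix t assume t: "t \<in> T I"
    obtain x where x: "x \<in> I" "cmod (x - \<zeta>) \<le> R" using S(2)[OF \<open>I \<in> S\<close>] by blast
    have "cmod (cis (2 * pi * t) - x) \<le> 7 * (1 / 2 ^ k)"
    proof -
      have I: "I \<in> D k" using that S(1) by blast
      show ?thesis
        using node_diameter[OF level_nodes[OF I], of "cis (2 * pi * t)" x] t x
        unfolding arc_length_level[OF I] by (simp add: T_def)
    qed
    then have "cmod (cis (2 * pi * t) - \<zeta>) \<le> R + 7 * (1 / 2 ^ k)"
      using x norm_triangle_ineq[of "cis (2 * pi * t) - x" "x - \<zeta>"] by simp
    then show "t \<in> {t \<in> {0..<1}. cmod (cis (2 * pi * t) - \<zeta>) \<le> R + 7 * (1 / 2 ^ k)}"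
      using t by (simp add: T_def)
  qed
  have disj: "disjoint_family_on T S"
    using level_disjoint S(1) by (auto simp: disjoint_family_on_def T_def)
  have lm: "T I \<in> lmeasurable" if "I \<in> S" for I
    using cap_measure_le(2)[OF \<zeta> _ sT[OF that] sub[OF that]] R by simp
  have "real (card S) * (1 / 2 ^ k) = (\<Sum>I\<in>S. measure lebesgue (T I))"
    using mT by simp
  also have "\<dots> = measure lebesgue (\<Union>I\<in>S. T I)"
    using fin disj lm by (intro measure_UNION'[symmetric]) (auto simp: disjoint_family_on_def pairwise_def disjnt_def)
  also have "\<dots> \<le> 2 * (R + 7 * (1 / 2 ^ k))"
    using sub sT fin R by (intro cap_measure_le(1)[OF \<zeta>]) auto
  finally have "real (card S) \<le> 2 * (R * 2 ^ k) + 14" by (simp add: field_simps)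
  moreover have "0 \<le> R * 2 ^ k" using R by simp
  ultimately show ?thesis by (simp add: field_simps)
qed

end

section \<open>Duality for the dyadic gauge\<close>

text \<open>The gauge is the value of a linear program whose dual maximizes \<open>\<Sum>I. h I * \<mu> I\<close> over
  nonnegative \<open>\<mu>\<close> with \<open>(\<Sum>I \<subseteq> J. \<mu> I) \<le> c J\<close>. The predicate describes, for
  the sequence \<open>h - m\<close> on the finite family \<open>F\<close>, feasible \<open>\<mu>\<close> and \<open>l\<close> such that \<open>l\<close> costs no more
  than the value of \<open>\<mu>\<close>; by weak duality both are optimal. The disjoint family \<open>T\<close>
  of tight sets covering \<open>F\<close> is what allows the level \<open>m\<close> to be lowered.\<close>

definition optimal_pair :: "'a set set \<Rightarrow> ('a set \<Rightarrow> real) \<Rightarrow> ('a set \<Rightarrow> real) \<Rightarrow> 'a set set \<Rightarrow> real \<Rightarrow>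
    ('a set \<Rightarrow> real) \<Rightarrow> 'a set set \<Rightarrow> ('a set \<Rightarrow> real) \<Rightarrow> bool" where
  "optimal_pair N c h F m \<mu> T l \<longleftrightarrow>
      (\<forall>I. 0 \<le> \<mu> I) \<and> (\<forall>J\<in>N. (\<Sum>I | I \<in> F \<and> I \<subseteq> J. \<mu> I) \<le> c J) \<and>
      T \<subseteq> N \<and> finite T \<and> disjoint T \<and> (\<forall>J\<in>T. (\<Sum>I | I \<in> F \<and> I \<subseteq> J. \<mu> I) = c J) \<and>
      (\<forall>I\<in>F. \<exists>J\<in>T. I \<subseteq> J) \<and> (\<forall>J. 0 \<le> l J) \<and>
      (\<forall>I\<in>F. h I - m \<le> (\<Sum>J | J \<in> N \<and> I \<subseteq> J. l J)) \<and>
      (\<forall>B. finite B \<and> B \<subseteq> N \<longrightarrow> (\<Sum>J\<in>B. l J * c J) \<le> (\<Sum>I\<in>F. (h I - m) * \<mu> I))"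

lemma subset_inter_empty: "A \<inter> B = {} \<Longrightarrow> I \<subseteq> A \<Longrightarrow> I \<subseteq> B \<Longrightarrow> I = {}"
  by blast

text \<open>For a laminar family the dual program is solved greedily: treat the sets in order of decreasing
  \<open>h\<close> and give each as much mass as the constraints permit, so that it ends up inside a tight set. Lowering
  the level from \<open>m0\<close> to \<open>m\<close> raises \<open>l\<close> by \<open>m0 - m\<close> on the tight family. This costs
  \<open>(m0 - m) * (\<Sum>J\<in>T. c J)\<close>, which is at most \<open>m0 - m\<close> times the total mass, because the sets in \<open>T\<close> are
  tight and disjoint; so \<open>l\<close> still costs no more than the value of \<open>\<mu>\<close>. The induction removes a set where \<open>h\<close> is least,
  which is the one treated last.\<close>

lemma laminar_greedy_duality:
  fixes N :: "'a set set" and c h :: "'a set \<Rightarrow> real"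
  assumes lam: "\<And>I J. I \<in> N \<Longrightarrow> J \<in> N \<Longrightarrow> I \<inter> J \<noteq> {} \<Longrightarrow> I \<subseteq> J \<or> J \<subseteq> I"
    and ne: "{} \<notin> N"
    and fin: "\<And>I. I \<in> N \<Longrightarrow> finite {J \<in> N. I \<subseteq> J}"
    and c: "\<And>J. J \<in> N \<Longrightarrow> 0 \<le> c J"
  shows "finite F \<Longrightarrow> F \<subseteq> N \<Longrightarrow> (\<And>I. I \<in> F \<Longrightarrow> m \<le> h I) \<Longrightarrow>
    \<exists>\<mu> T l. optimal_pair N c h F m \<mu> T l"
proof (induction "card F" arbitrary: F m)
  case 0
  then have "F = {}" by simp
  then show ?case
    by (intro exI[of _ "\<lambda>_. 0"] exI[of _ "{}"]) (use c in \<open>simp add: optimal_pair_def disjoint_def\<close>)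
next
  case (Suc n)
  have "F \<noteq> {}" using Suc.hyps(2) by auto
  then obtain I0 where I0: "I0 \<in> F" "\<And>I. I \<in> F \<Longrightarrow> h I0 \<le> h I"
    using ex_is_arg_min_if_finite[OF Suc.prems(1), of h] by (auto simp: is_arg_min_linorder)
  define F' where "F' = F - {I0}"
  define m0 where "m0 = h I0"
  have F: "F = insert I0 F'" "I0 \<notin> F'" "finite F'" "F' \<subseteq> N" "I0 \<in> N"
    using I0 Suc.prems by (auto simp: F'_def)
  have mm0: "m \<le> m0" using Suc.prems(3) I0 by (auto simp: m0_def)
  have "n = card F'" using Suc.hyps(2) F by simp
  from Suc.hyps(1)[OF this F(3,4), of m0] obtain \<mu>' T' l where IH: "optimal_pair N c h F' m0 \<mu>' T' l"
    using I0(2) F(1) by (auto simp: m0_def)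
  note \<mu>' = IH[unfolded optimal_pair_def, THEN conjunct1, rule_format]
    IH[unfolded optimal_pair_def, THEN conjunct2, THEN conjunct1, rule_format]
  note T' = IH[unfolded optimal_pair_def, THEN conjunct2, THEN conjunct2, THEN conjunct1]
    IH[unfolded optimal_pair_def, THEN conjunct2, THEN conjunct2, THEN conjunct2, THEN conjunct1]
    IH[unfolded optimal_pair_def, THEN conjunct2, THEN conjunct2, THEN conjunct2, THEN conjunct2, THEN conjunct1]
    IH[unfolded optimal_pair_def, THEN conjunct2, THEN conjunct2, THEN conjunct2, THEN conjunct2, THEN conjunct2, THEN conjunct1, rule_format]
    IH[unfolded optimal_pair_def, THEN conjunct2, THEN conjunct2, THEN conjunct2, THEN conjunct2, THEN conjunct2, THEN conjunct2, THEN conjunct1, rule_format]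
  note l = IH[unfolded optimal_pair_def, THEN conjunct2, THEN conjunct2, THEN conjunct2, THEN conjunct2, THEN conjunct2, THEN conjunct2, THEN conjunct2, THEN conjunct1, rule_format]
    IH[unfolded optimal_pair_def, THEN conjunct2, THEN conjunct2, THEN conjunct2, THEN conjunct2, THEN conjunct2, THEN conjunct2, THEN conjunct2, THEN conjunct2, THEN conjunct1, rule_format]
    IH[unfolded optimal_pair_def, THEN conjunct2, THEN conjunct2, THEN conjunct2, THEN conjunct2, THEN conjunct2, THEN conjunct2, THEN conjunct2, THEN conjunct2, THEN conjunct2, rule_format]
  have split: "(\<Sum>I | I \<in> F \<and> I \<subseteq> J. (\<mu>'(I0 := v)) I) =
      (\<Sum>I | I \<in> F' \<and> I \<subseteq> J. \<mu>' I) + (if I0 \<subseteq> J then v else 0)" for v J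
  proof -
    have "{I. I \<in> F \<and> I \<subseteq> J} = (if I0 \<subseteq> J then insert I0 {I. I \<in> F' \<and> I \<subseteq> J} else {I. I \<in> F' \<and> I \<subseteq> J})"
      using F by auto
    moreover have "(\<Sum>I | I \<in> F' \<and> I \<subseteq> J. (\<mu>'(I0 := v)) I) = (\<Sum>I | I \<in> F' \<and> I \<subseteq> J. \<mu>' I)"
      using F by (intro sum.cong) auto
    ultimately show ?thesis using F by auto
  qed
  \<comment> \<open>If \<open>I0\<close> lies in a tight set it gets no mass. Otherwise its mass is the least slack among its
    ancestors, and the ancestor \<open>J0\<close> where the slack is attained replaces the tight sets inside it.\<close>
  obtain v T where v: "0 \<le> v" "\<And>J. J \<in> N \<Longrightarrow> (\<Sum>I | I \<in> F' \<and> I \<subseteq> J. \<mu>' I) + (if I0 \<subseteq> J then v else 0) \<le> c J"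
    and T: "T \<subseteq> N" "finite T" "disjoint T" "\<And>J. J \<in> T \<Longrightarrow> (\<Sum>I | I \<in> F' \<and> I \<subseteq> J. \<mu>' I) + (if I0 \<subseteq> J then v else 0) = c J"
      "\<And>I. I \<in> F \<Longrightarrow> \<exists>J\<in>T. I \<subseteq> J"
  proof (cases "\<exists>J\<in>T'. I0 \<subseteq> J")
    case True
    show thesis
      by (rule that[of 0 T']) (use True T' \<mu>' F in auto)
  next
    case False
    define s where "s J = c J - (\<Sum>I | I \<in> F' \<and> I \<subseteq> J. \<mu>' I)" for J
    define A where "A = {J \<in> N. I0 \<subseteq> J}"
    have A: "finite A" "A \<noteq> {}" using fin[OF F(5)] F by (auto simp: A_def)
    then obtain J0 where J0: "J0 \<in> A" "\<And>J. J \<in> A \<Longrightarrow> s J0 \<le> s J"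
      using ex_is_arg_min_if_finite[of A s] by (auto simp: is_arg_min_linorder)
    define T where "T = insert J0 {J \<in> T'. J \<inter> J0 = {}}"
    show thesis
    proof (rule that[of "s J0" T])
      show "0 \<le> s J0" using \<mu>'(2)[of J0] J0 by (auto simp: s_def A_def)
      show "(\<Sum>I | I \<in> F' \<and> I \<subseteq> J. \<mu>' I) + (if I0 \<subseteq> J then s J0 else 0) \<le> c J" if "J \<in> N" for J
        using \<mu>'(2)[OF that] J0(2)[of J] that by (auto simp: s_def A_def)
      show "T \<subseteq> N" "finite T" using T' J0 by (auto simp: T_def A_def)
      show "disjoint T" using T'(3) by (auto simp: T_def disjoint_def)
      show "(\<Sum>I | I \<in> F' \<and> I \<subseteq> J. \<mu>' I) + (if I0 \<subseteq> J then s J0 else 0) = c J" if "J \<in> T" for J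
      proof (cases "J = J0")
        case True then show ?thesis using J0 by (simp add: s_def A_def)
      next
        case False
        then have "J \<in> T'" using that by (auto simp: T_def)
        then show ?thesis using T'(4) \<open>\<not> (\<exists>J\<in>T'. I0 \<subseteq> J)\<close> by auto
      qed
      show "\<exists>J\<in>T. I \<subseteq> J" if IF: "I \<in> F" for I
      proof (cases "I = I0")
        case True then show ?thesis using J0 by (auto simp: T_def A_def)
      next
        case False
        then obtain J where J: "J \<in> T'" "I \<subseteq> J" using IF T'(5)[of I] F(1) False by blast
        show ?thesis
        proof (cases "J \<inter> J0 = {}")
          case False
          then have "J \<subseteq> J0 \<or> J0 \<subseteq> J" using lam J T' J0 by (auto simp: A_def)
          moreover have "\<not> J0 \<subseteq> J"
          proof
            assume "J0 \<subseteq> J"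
            moreover have "I0 \<subseteq> J0" using J0 by (simp add: A_def)
            ultimately show False using \<open>\<not> (\<exists>J\<in>T'. I0 \<subseteq> J)\<close> J(1) by blast
          qed
          ultimately show ?thesis using J by (auto simp: T_def)
        qed (use J in \<open>auto simp: T_def\<close>)
      qed
    qed
  qed
  define \<mu> where "\<mu> = \<mu>'(I0 := v)"
  define l' where "l' J = l J + (if J \<in> T then m0 - m else 0)" for J
  have tight_le: "(\<Sum>J\<in>T. c J) \<le> (\<Sum>I\<in>F. \<mu> I)"
  proof -
    have "(\<Sum>J\<in>T. c J) = (\<Sum>J\<in>T. \<Sum>I | I \<in> F \<and> I \<subseteq> J. \<mu> I)"
      using T(4) by (intro sum.cong refl) (simp only: \<mu>_def split)
    also have "\<dots> = (\<Sum>I\<in>(\<Union>J\<in>T. {I. I \<in> F \<and> I \<subseteq> J}). \<mu> I)"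
    proof (rule sum.UNION_disjoint[symmetric])
      show "\<forall>i\<in>T. \<forall>j\<in>T. i \<noteq> j \<longrightarrow> {I. I \<in> F \<and> I \<subseteq> i} \<inter> {I. I \<in> F \<and> I \<subseteq> j} = {}"
      proof (intro ballI impI)
        fix i j assume *: "i \<in> T" "j \<in> T" "i \<noteq> j"
        then have "i \<inter> j = {}" using T(3) by (auto simp: disjoint_def)
        then show "{I. I \<in> F \<and> I \<subseteq> i} \<inter> {I. I \<in> F \<and> I \<subseteq> j} = {}"
          using subset_inter_empty[OF \<open>i \<inter> j = {}\<close>] ne Suc.prems(2) by (intro equals0I) auto
      qed
    qed (use T Suc.prems in auto)
    also have "\<dots> \<le> (\<Sum>I\<in>F. \<mu> I)"
      using Suc.prems \<mu>'(1) v by (intro sum_mono2) (auto simp: \<mu>_def)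
    finally show ?thesis .
  qed
  show ?case
    unfolding optimal_pair_def
  proof (rule exI[of _ \<mu>], rule exI[of _ T], rule exI[of _ l'], intro conjI allI ballI impI)
    show "0 \<le> \<mu> I" for I using \<mu>' v by (simp add: \<mu>_def)
    show "(\<Sum>I | I \<in> F \<and> I \<subseteq> J. \<mu> I) \<le> c J" if "J \<in> N" for J
      using v(2)[OF that] by (simp only: \<mu>_def split)
    show "(\<Sum>I | I \<in> F \<and> I \<subseteq> J. \<mu> I) = c J" if "J \<in> T" for J
      using T(4)[OF that] by (simp only: \<mu>_def split)
    show "0 \<le> l' J" for J using l(1)[of J] mm0 by (simp add: l'_def)
    show "h I - m \<le> (\<Sum>J | J \<in> N \<and> I \<subseteq> J. l' J)" if IF: "I \<in> F" for I
    proof -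
      have IN: "I \<in> N" using that Suc.prems by auto
      obtain J where J: "J \<in> T" "I \<subseteq> J" using T(5)[OF IF] by auto
      have "h I - m0 \<le> (\<Sum>J | J \<in> N \<and> I \<subseteq> J. l J)"
      proof (cases "I = I0")
        case True then show ?thesis using l(1) by (simp add: m0_def sum_nonneg)
      qed (use l(2) that F in auto)
      moreover have "m0 - m \<le> (\<Sum>J | J \<in> N \<and> I \<subseteq> J. if J \<in> T then m0 - m else 0)"
      proof -
        have "m0 - m = (\<Sum>J\<in>{J}. if J \<in> T then m0 - m else 0)" using J by simp
        also have "\<dots> \<le> (\<Sum>J | J \<in> N \<and> I \<subseteq> J. if J \<in> T then m0 - m else 0)"
          using J T mm0 fin[OF IN] by (intro sum_mono2) auto
        finally show ?thesis .
      qed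
      ultimately show ?thesis by (simp add: l'_def sum.distrib)
    qed
    show "(\<Sum>J\<in>B. l' J * c J) \<le> (\<Sum>I\<in>F. (h I - m) * \<mu> I)" if B: "finite B \<and> B \<subseteq> N" for B
    proof -
      have "(\<Sum>J\<in>B. l' J * c J) = (\<Sum>J\<in>B. l J * c J) + (m0 - m) * (\<Sum>J\<in>B. if J \<in> T then c J else 0)"
      proof -
        have "l' J * c J = l J * c J + (m0 - m) * (if J \<in> T then c J else 0)" for J
          by (simp add: l'_def ring_distribs)
        then show ?thesis by (simp only: sum.distrib sum_distrib_left)
      qed
      also have "(\<Sum>J\<in>B. if J \<in> T then c J else 0) = (\<Sum>J\<in>B \<inter> T. c J)"
        using B by (simp add: sum.inter_restrict)
      also have "\<dots> \<le> (\<Sum>J\<in>T. c J)" using T c by (intro sum_mono2) auto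
      also note tight_le
      also have "(\<Sum>J\<in>B. l J * c J) \<le> (\<Sum>I\<in>F'. (h I - m0) * \<mu>' I)" using l(3)[OF B] .
      also have "\<dots> = (\<Sum>I\<in>F. (h I - m0) * \<mu> I)"
      proof -
        have "(\<Sum>I\<in>F'. (h I - m0) * \<mu>' I) = (\<Sum>I\<in>F'. (h I - m0) * \<mu> I)"
          using F(2) by (intro sum.cong) (auto simp: \<mu>_def)
        then show ?thesis unfolding F(1) using F(2,3) by (simp add: m0_def)
      qed
      finally have "(\<Sum>J\<in>B. l' J * c J) \<le> (\<Sum>I\<in>F. (h I - m0) * \<mu> I) + (m0 - m) * (\<Sum>I\<in>F. \<mu> I)"
        using mm0 by (simp add: mult_left_mono)
      also have "\<dots> = (\<Sum>I\<in>F. (h I - m) * \<mu> I)"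
        by (simp add: sum_distrib_left algebra_simps flip: sum.distrib)
      finally show ?thesis .
    qed
  qed (use T in auto)
qed

context dyadic_levels
begin

text \<open>The greedy algorithm solves the program for finitely many arcs at a time, with costs bounded by
  \<open>M\<close>. The value at a single arc \<open>J\<close> is then at most \<open>M / l J powr p\<close>, so all solutions lie in a product
  of compact intervals. Every constraint involves finitely many coordinates and is closed, hence
  the finite intersection property yields a solution for all arcs at once.\<close>

lemma gauge_le_of_dual_bound:
  assumes p: "0 < p" and h: "\<And>I. I \<in> nodes \<Longrightarrow> 0 \<le> h I"
    and bound: "\<And>F \<mu>. finite F \<Longrightarrow> F \<subseteq> nodes \<Longrightarrow> (\<And>I. 0 \<le> \<mu> I) \<Longrightarrow>
      (\<And>J. J \<in> nodes \<Longrightarrow> (\<Sum>I | I \<in> F \<and> I \<subseteq> J. \<mu> I) \<le> arc_length J powr p) \<Longrightarrow>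
      (\<Sum>I\<in>F. h I * \<mu> I) \<le> M"
  shows "dyadic_gauge p nodes (\<lambda>I. ennreal (h I)) \<le> ennreal M"
proof -
  define c where "c J = arc_length J powr p" for J
  have cpos: "0 < c J" if "J \<in> nodes" for J using arc_length_pos[OF that] by (simp add: c_def)
  define b where "b J = (if J \<in> nodes then M / c J else 0)" for J
  define K where "K = (\<Pi>\<^sub>E J\<in>(UNIV::complex set set). {0..b J})"
  define C where "C F = {l :: complex set \<Rightarrow> real. (\<forall>I\<in>F. h I \<le> (\<Sum>J | J \<in> nodes \<and> I \<subseteq> J. l J)) \<and>
      (\<Sum>J\<in>F. l J * c J) \<le> M}" for F
  let ?\<F> = "{F. finite F \<and> F \<subseteq> nodes}"
  have "compactin (product_topology (\<lambda>_. euclidean) UNIV) K"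
    unfolding K_def compactin_PiE by simp
  then have "compact K" by (simp add: euclidean_product_topology)
  moreover have "closed (C F)" if "F \<in> ?\<F>" for F
  proof -
    have "C F = (\<Inter>I\<in>F. {l. h I \<le> (\<Sum>J | J \<in> nodes \<and> I \<subseteq> J. l J)}) \<inter> {l. (\<Sum>J\<in>F. l J * c J) \<le> M}"
      by (auto simp: C_def)
    then show ?thesis
      by (simp only:) (intro closed_Int closed_INT ballI closed_Collect_le continuous_intros continuous_on_product_coordinates)
  qed
  moreover have "K \<inter> (\<Inter>F\<in>\<S>. C F) \<noteq> {}" if \<S>: "finite \<S>" "\<S> \<subseteq> ?\<F>" for \<S>
  proof -
    define F where "F = \<Union>\<S>"
    have F: "finite F" "F \<subseteq> nodes" using \<S> by (auto simp: F_def)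
    have "\<exists>\<mu> T l. optimal_pair nodes c h F 0 \<mu> T l"
      by (rule laminar_greedy_duality)
         (use laminar node_nonempty finite_ancestors cpos F h in \<open>auto intro: less_imp_le\<close>)
    then obtain \<mu> T l where opt: "optimal_pair nodes c h F 0 \<mu> T l" by blast
    have \<mu>: "0 \<le> \<mu> I" "J \<in> nodes \<Longrightarrow> (\<Sum>I | I \<in> F \<and> I \<subseteq> J. \<mu> I) \<le> c J" for I J
      using opt by (simp_all add: optimal_pair_def)
    have l: "0 \<le> l J" "I \<in> F \<Longrightarrow> h I \<le> (\<Sum>J | J \<in> nodes \<and> I \<subseteq> J. l J)"
      "finite B \<Longrightarrow> B \<subseteq> nodes \<Longrightarrow> (\<Sum>J\<in>B. l J * c J) \<le> (\<Sum>I\<in>F. h I * \<mu> I)" for I J B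
      using opt by (simp_all add: optimal_pair_def)
    have M: "(\<Sum>J\<in>B. l J * c J) \<le> M" if "finite B" "B \<subseteq> nodes" for B
      using l(3)[OF that] bound[OF F \<mu>(1)] \<mu>(2) by (force simp: c_def)
    define l' where "l' J = (if J \<in> nodes then l J else 0)" for J
    have "l J \<le> M / c J" if "J \<in> nodes" for J
      using M[of "{J}"] that cpos[OF that] by (simp add: field_simps)
    then have "l' \<in> K" using l(1) by (auto simp: K_def l'_def b_def)
    moreover have "l' \<in> C G" if "G \<in> \<S>" for G
    proof -
      have G: "G \<subseteq> F" "finite G" "G \<subseteq> nodes" using that \<S> by (auto simp: F_def)
      have "(\<Sum>J\<in>G. l' J * c J) = (\<Sum>J\<in>G. l J * c J)"
        using G by (intro sum.cong) (auto simp: l'_def)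
      moreover have "(\<Sum>J | J \<in> nodes \<and> I \<subseteq> J. l' J) = (\<Sum>J | J \<in> nodes \<and> I \<subseteq> J. l J)" for I
        by (intro sum.cong) (auto simp: l'_def)
      ultimately show ?thesis using G l(2) M[OF G(2,3)] by (auto simp: C_def)
    qed
    ultimately show ?thesis by blast
  qed
  ultimately have "K \<inter> (\<Inter>F\<in>?\<F>. C F) \<noteq> {}" by (rule compact_imp_fip_image)
  then obtain l where l: "l \<in> K" "\<And>F. F \<in> ?\<F> \<Longrightarrow> l \<in> C F" by blast
  have l0: "0 \<le> l J" for J using l(1) by (auto simp: K_def PiE_iff)
  have "(\<Sum>\<^sub>\<infinity>J\<in>nodes. ennreal (l J * arc_length J powr p)) \<le> ennreal M"
  proof (rule infsum_le_finite_sums)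
    show "(\<lambda>J. ennreal (l J * arc_length J powr p)) summable_on nodes"
      by (rule nonneg_summable_on_complete) simp
    fix F assume F: "finite F" "F \<subseteq> nodes"
    have "(\<Sum>J\<in>F. ennreal (l J * arc_length J powr p)) = ennreal (\<Sum>J\<in>F. l J * c J)"
      using l0 by (subst sum_ennreal) (auto simp: c_def)
    also have "\<dots> \<le> ennreal M" using l(2)[of F] F by (intro ennreal_leI) (auto simp: C_def)
    finally show "(\<Sum>J\<in>F. ennreal (l J * arc_length J powr p)) \<le> ennreal M" .
  qed
  moreover have "dyadic_gauge p nodes (\<lambda>I. ennreal (h I)) \<le> (\<Sum>\<^sub>\<infinity>J\<in>nodes. ennreal (l J * arc_length J powr p))"
    unfolding dyadic_gauge_def
  proof (intro Inf_lower CollectI exI[of _ l] conjI ballI refl)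
    fix I assume I: "I \<in> nodes"
    have "ennreal (h I) \<le> ennreal (\<Sum>J | J \<in> nodes \<and> I \<subseteq> J. l J)"
      using l(2)[of "{I}"] I by (intro ennreal_leI) (auto simp: C_def)
    also have "\<dots> = (\<Sum>J | J \<in> nodes \<and> I \<subseteq> J. ennreal (l J))" using l0 by simp
    also have "\<dots> = (\<Sum>\<^sub>\<infinity>J\<in>{J \<in> nodes. I \<subseteq> J}. ennreal (l J))"
      using finite_ancestors[OF I] by simp
    finally show "ennreal (h I) \<le> (\<Sum>\<^sub>\<infinity>J\<in>{J \<in> nodes. I \<subseteq> J}. ennreal (l J))" .
  qed (use l0 in auto)
  ultimately show ?thesis by (rule order_trans[rotated])
qed

end

section \<open>Sums over dyadic arcs\<close>

text \<open>Decompose into the shells \<open>2 ^ k * \<delta> \<le> d i < 2 ^ (k + 1) * \<delta>\<close>: each shell contributes at most a constant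
  times \<open>K * (2 ^ k * \<delta>) powr - Q\<close>, a geometric series. All sums over dyadic arcs below are of this kind.\<close>

lemma sum_decay_le:
  fixes m d :: "'i \<Rightarrow> real"
  assumes F: "finite F" and m: "\<And>i. i \<in> F \<Longrightarrow> 0 \<le> m i" and \<delta>: "0 < \<delta>"
    and d: "\<And>i. i \<in> F \<Longrightarrow> \<delta> \<le> d i" and P: "0 \<le> P" and Q: "0 < Q" and K: "0 \<le> K"
    and grow: "\<And>R. \<delta> \<le> R \<Longrightarrow> (\<Sum>i | i \<in> F \<and> d i \<le> R. m i) \<le> K * R powr P"
  shows "(\<Sum>i\<in>F. m i * d i powr - (P + Q)) \<le> 2 powr P / (1 - 2 powr - Q) * K * \<delta> powr - Q"
proof -
  define n where "n i = nat \<lfloor>log 2 (d i / \<delta>)\<rfloor>" for i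
  have n: "2 ^ n i * \<delta> \<le> d i" "d i \<le> 2 ^ Suc (n i) * \<delta>" if i: "i \<in> F" for i
  proof -
    have q: "1 \<le> d i / \<delta>" using d[OF i] \<delta> by (simp add: field_simps)
    define x where "x = log 2 (d i / \<delta>)"
    have x: "0 \<le> x" "2 powr x = d i / \<delta>" using q by (simp_all add: x_def zero_le_log_cancel_iff)
    have nx: "real (n i) \<le> x" "x \<le> real (Suc (n i))" using x(1) by (simp_all add: n_def x_def[symmetric]) linarith+
    have "2 powr real (n i) \<le> 2 powr x" "2 powr x \<le> 2 powr real (Suc (n i))"
      by (rule powr_mono; use nx in simp)+
    then show "2 ^ n i * \<delta> \<le> d i" "d i \<le> 2 ^ Suc (n i) * \<delta>"
      using \<delta> unfolding x(2) by (simp_all only: powr_realpow zero_less_numeral) (simp_all add: field_simps)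
  qed
  define N where "N = (if F = {} then 0 else Max (n ` F))"
  have nN: "n i \<le> N" if "i \<in> F" for i using that F by (auto simp: N_def)
  define r where "r = (2::real) powr - Q"
  have r: "0 < r" "r < 1" using Q by (simp_all add: r_def powr_less_one)
  have "(\<Sum>i\<in>F. m i * d i powr - (P + Q)) \<le>
      (\<Sum>i\<in>F. \<Sum>k\<le>N. if d i \<le> 2 ^ Suc k * \<delta> then m i * (2 ^ k * \<delta>) powr - (P + Q) else 0)"
  proof (rule sum_mono)
    fix i assume i: "i \<in> F"
    have "m i * d i powr - (P + Q) \<le> m i * (2 ^ n i * \<delta>) powr - (P + Q)"
      using n[OF i] \<delta> P Q m[OF i] by (intro mult_left_mono powr_mono2') auto
    also have "\<dots> = (\<Sum>k\<in>{n i}. if d i \<le> 2 ^ Suc k * \<delta> then m i * (2 ^ k * \<delta>) powr - (P + Q) else 0)"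
      using n[OF i] by simp
    also have "\<dots> \<le> (\<Sum>k\<le>N. if d i \<le> 2 ^ Suc k * \<delta> then m i * (2 ^ k * \<delta>) powr - (P + Q) else 0)"
      using nN[OF i] m[OF i] by (intro sum_mono2) auto
    finally show "m i * d i powr - (P + Q) \<le> (\<Sum>k\<le>N. if d i \<le> 2 ^ Suc k * \<delta> then m i * (2 ^ k * \<delta>) powr - (P + Q) else 0)" .
  qed
  also have "\<dots> = (\<Sum>k\<le>N. \<Sum>i\<in>F. if d i \<le> 2 ^ Suc k * \<delta> then m i * (2 ^ k * \<delta>) powr - (P + Q) else 0)"
    by (rule sum.swap)
  also have "\<dots> = (\<Sum>k\<le>N. (2 ^ k * \<delta>) powr - (P + Q) * (\<Sum>i | i \<in> F \<and> d i \<le> 2 ^ Suc k * \<delta>. m i))"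
    using F by (intro sum.cong refl) (simp add: sum.inter_filter[symmetric] sum_distrib_left mult.commute)
  also have "\<dots> \<le> (\<Sum>k\<le>N. (2 ^ k * \<delta>) powr - (P + Q) * (K * (2 ^ Suc k * \<delta>) powr P))"
  proof (intro sum_mono mult_left_mono grow)
    fix k show "\<delta> \<le> 2 ^ Suc k * \<delta>" using \<delta> one_le_power[of "2::real" "Suc k"] by simp
  qed simp
  also have "\<dots> = (\<Sum>k\<le>N. 2 powr P * K * \<delta> powr - Q * r ^ k)"
  proof (intro sum.cong refl)
    fix k
    have e: "(2 ^ k * \<delta>) powr a = 2 powr (real k * a) * \<delta> powr a" for a
      using \<delta> by (simp add: powr_mult powr_powr flip: powr_realpow)
    have "(2 ^ Suc k * \<delta>) powr P = 2 powr P * ((2 ^ k * \<delta>) powr P)"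
      using \<delta> by (simp add: powr_mult)
    then have "(2 ^ k * \<delta>) powr - (P + Q) * (K * (2 ^ Suc k * \<delta>) powr P)
       = 2 powr P * K * ((2 ^ k * \<delta>) powr - (P + Q) * (2 ^ k * \<delta>) powr P)" by simp
    also have "(2 ^ k * \<delta>) powr - (P + Q) * (2 ^ k * \<delta>) powr P = (2 ^ k * \<delta>) powr - Q"
      by (simp add: powr_add[symmetric])
    also have "\<dots> = r ^ k * \<delta> powr - Q"
      unfolding e by (simp add: r_def powr_powr mult.commute flip: powr_realpow)
    finally show "(2 ^ k * \<delta>) powr - (P + Q) * (K * (2 ^ Suc k * \<delta>) powr P) = 2 powr P * K * \<delta> powr - Q * r ^ k"
      by (simp only: mult_ac)
  qed
  also have "\<dots> = 2 powr P * K * \<delta> powr - Q * (\<Sum>k\<le>N. r ^ k)" by (simp add: sum_distrib_left)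
  also have "\<dots> \<le> 2 powr P * K * \<delta> powr - Q * (1 / (1 - r))"
  proof (intro mult_left_mono)
    have "(\<Sum>k\<le>N. r ^ k) = (1 - r ^ Suc N) / (1 - r)" using r by (subst sum_gp0) auto
    also have "\<dots> \<le> 1 / (1 - r)" using r by (intro divide_right_mono) auto
    finally show "(\<Sum>k\<le>N. r ^ k) \<le> 1 / (1 - r)" .
  qed (use K in auto)
  finally show ?thesis by (simp add: r_def)
qed

lemma sum_geometric_tail_le:
  assumes S: "finite S" and r: "0 < r" "r < (1::real)" and b: "\<And>k. k \<in> S \<Longrightarrow> r ^ k \<le> B" and B: "0 \<le> B"
  shows "(\<Sum>k\<in>S. r ^ k) \<le> B / (1 - r)"
proof (cases "S = {}")
  case True then show ?thesis using B r by simp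
next
  case False
  define k0 where "k0 = Min S"
  define n where "n = Max S"
  have k0: "k0 \<in> S" "\<And>k. k \<in> S \<Longrightarrow> k0 \<le> k" "\<And>k. k \<in> S \<Longrightarrow> k \<le> n"
    using S False by (auto simp: k0_def n_def)
  have "(\<Sum>k\<in>S. r ^ k) \<le> (\<Sum>k\<in>{k0..n}. r ^ k)"
    using k0 r by (intro sum_mono2) auto
  also have "\<dots> = (r ^ k0 - r ^ Suc n) / (1 - r)"
    using r k0(3)[OF k0(1)] sum_gp[of r k0 n] by auto
  also have "\<dots> \<le> B / (1 - r)" using b[OF k0(1)] r by (intro divide_right_mono) (auto intro: order_trans[rotated])
  finally show ?thesis .
qed

context dyadic_levels
begin

text \<open>A generation of arcs of length \<open>a \<le> R\<close> has \<open>O(R / a)\<close> members near \<open>\<zeta>\<close>, which contribute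
  \<open>O(R * a powr s)\<close>. Since \<open>s > 0\<close>, the generations sum to a geometric series.\<close>

lemma sum_powr_near_le:
  assumes s: "0 < s" and F: "finite F" "F \<subseteq> nodes" and \<zeta>: "cmod \<zeta> = 1" and R: "0 < R"
    and near: "\<And>I. I \<in> F \<Longrightarrow> arc_length I \<le> R \<and> cmod (pt I - \<zeta>) \<le> R"
  shows "(\<Sum>I\<in>F. arc_length I powr (1 + s)) \<le> 28 / (1 - 2 powr - s) * R powr (1 + s)"
proof -
  define r where "r = (2::real) powr - s"
  have r: "0 < r" "r < 1" using s by (simp_all add: r_def powr_less_one)
  have rk: "(1 / 2 ^ k) powr s = r ^ k" for k :: nat
    by (simp add: r_def powr_divide powr_powr powr_minus field_simps mult.commute flip: powr_realpow)
  define S where "S = {k. \<exists>I\<in>F. I \<in> D k}"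
  have Fk: "F = (\<Union>k\<in>S. {I \<in> F. I \<in> D k})" using F 
  proof (intro equalityI subsetI)
    fix I assume I: "I \<in> F"
    then obtain k where "I \<in> D k" using F(2) by (auto simp: nodes_def)
    then show "I \<in> (\<Union>k\<in>S. {I \<in> F. I \<in> D k})" using I by (intro UN_I[of k]) (auto simp: S_def)
  qed auto
  have finS: "finite S"
  proof -
    have "S = (\<Union>I\<in>F. {k. I \<in> D k})" by (auto simp: S_def)
    moreover have "finite {k. I \<in> D k}" for I
    proof (cases "\<exists>k. I \<in> D k")
      case True
      then obtain k where "I \<in> D k" by blast
      then have "{k. I \<in> D k} \<subseteq> {k}" using level_unique by blast
      then show ?thesis by (rule finite_subset) simp
    qed simp
    ultimately show ?thesis using F by simp
  qed
  have kR: "1 / 2 ^ k \<le> R" if kS: "k \<in> S" for k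
  proof -
    obtain I where "I \<in> F" "I \<in> D k" using kS by (auto simp: S_def)
    then show ?thesis using near[of I] arc_length_level[of I k] by simp
  qed
  have lev: "(\<Sum>I | I \<in> F \<and> I \<in> D k. arc_length I powr (1 + s)) \<le> 28 * R * r ^ k" if k: "k \<in> S" for k
  proof -
    have "(\<Sum>I | I \<in> F \<and> I \<in> D k. arc_length I powr (1 + s)) = (\<Sum>I | I \<in> F \<and> I \<in> D k. (1 / 2 ^ k) powr (1 + s))"
      by (intro sum.cong) (auto simp: arc_length_level)
    also have "\<dots> = real (card {I \<in> F. I \<in> D k}) * (1 / 2 ^ k) powr (1 + s)"
      by simp
    also have "\<dots> \<le> (28 * R * 2 ^ k) * (1 / 2 ^ k) powr (1 + s)"
    proof (rule mult_right_mono)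
      have "real (card {I \<in> F. I \<in> D k}) \<le> 14 * (R * 2 ^ k + 1)"
      proof (rule count_level_near[OF \<zeta>])
        fix I assume "I \<in> {I \<in> F. I \<in> D k}"
        then have "I \<in> F" by simp
        then show "\<exists>x\<in>I. cmod (x - \<zeta>) \<le> R" using near pt_in F(2) by (intro bexI[of _ "pt I"]) auto
      qed (use R in auto)
      also have "\<dots> \<le> 28 * R * 2 ^ k" using kR[OF k] by (simp add: field_simps)
      finally show "real (card {I \<in> F. I \<in> D k}) \<le> 28 * R * 2 ^ k" .
    qed simp
    also have "\<dots> = 28 * R * r ^ k"
      unfolding rk[symmetric] by (simp add: powr_add)
    finally show ?thesis .
  qed
  have "(\<Sum>I\<in>F. arc_length I powr (1 + s)) = (\<Sum>k\<in>S. \<Sum>I | I \<in> F \<and> I \<in> D k. arc_length I powr (1 + s))"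
    by (subst Fk, rule sum.UNION_disjoint) (use finS F in \<open>auto dest: level_unique\<close>)
  also have "\<dots> \<le> (\<Sum>k\<in>S. 28 * R * r ^ k)" by (intro sum_mono lev)
  also have "\<dots> = 28 * R * (\<Sum>k\<in>S. r ^ k)" by (simp add: sum_distrib_left)
  also have "\<dots> \<le> 28 * R * (R powr s / (1 - r))"
  proof (intro mult_left_mono sum_geometric_tail_le finS r)
    show "r ^ k \<le> R powr s" if "k \<in> S" for k
      unfolding rk[symmetric] using kR[OF that] s by (intro powr_mono2) auto
  qed (use R in auto)
  also have "\<dots> = 28 / (1 - r) * R powr (1 + s)" using R by (simp add: powr_add)
  finally show ?thesis by (simp add: r_def)
qed

text \<open>The arcs in question lie inside boundedly many arcs of one generation of length comparable to
  \<open>R\<close>, or inside the circle if \<open>R\<close> is large.\<close>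

lemma carleson_near_le:
  assumes p: "0 < p" "p \<le> 1" and F: "finite F" "F \<subseteq> nodes" and \<mu>: "\<And>I. 0 \<le> \<mu> I"
    and carl: "\<And>J. J \<in> nodes \<Longrightarrow> (\<Sum>I | I \<in> F \<and> I \<subseteq> J. \<mu> I) \<le> arc_length J powr p"
    and \<zeta>: "cmod \<zeta> = 1" and R: "0 < R"
  shows "(\<Sum>I | I \<in> F \<and> arc_length I \<le> R \<and> cmod (pt I - \<zeta>) \<le> R. \<mu> I) \<le> 56 * R powr p"
proof -
  obtain k where k: "1 / 2 ^ k \<le> 2 * R" "R \<le> 1 / 2 ^ k \<or> k = 0"
  proof -
    define k where "k = (LEAST k. 1 / 2 ^ k \<le> 2 * R)"
    have "\<exists>k. 1 / 2 ^ k \<le> 2 * R"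
      using real_arch_pow_inv[of "2 * R" "1/2"] R by (auto simp: power_one_over intro: less_imp_le)
    then have 1: "1 / 2 ^ k \<le> 2 * R" unfolding k_def by (rule LeastI_ex)
    moreover have "R \<le> 1 / 2 ^ k" if k0: "k \<noteq> 0"
    proof -
      obtain j where j: "k = Suc j" using k0 by (cases k) auto
      then have "\<not> 1 / 2 ^ j \<le> 2 * R" using not_less_Least[of j "\<lambda>k. 1 / 2 ^ k \<le> 2 * R"] by (simp add: k_def)
      then show ?thesis using j by (simp add: field_simps)
    qed
    ultimately show ?thesis using that by blast
  qed
  define G where "G = {I. I \<in> F \<and> arc_length I \<le> R \<and> cmod (pt I - \<zeta>) \<le> R}"
  define S where "S = {J \<in> D k. \<exists>x\<in>J. cmod (x - \<zeta>) \<le> R}"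
  have finS: "finite S" by (simp add: S_def)
  have GS: "G \<subseteq> (\<Union>J\<in>S. {I. I \<in> F \<and> I \<subseteq> J})"
  proof
    fix I assume I: "I \<in> G"
    then have "I \<in> nodes" using F by (auto simp: G_def)
    then obtain n where n: "I \<in> D n" "arc_length I = 1 / 2 ^ n" by (rule nodesE)
    have "k \<le> n"
      using k(2)
    proof
      assume "R \<le> 1 / 2 ^ k"
      then have "1 / 2 ^ n \<le> (1 / 2 ^ k :: real)" using I n by (simp add: G_def)
      then show ?thesis by (simp add: field_simps)
    qed simp
    then obtain J where J: "J \<in> D k" "I \<subseteq> J" using ancestor n by blast
    then have "pt I \<in> J" using pt_in \<open>I \<in> nodes\<close> by auto
    then show "I \<in> (\<Union>J\<in>S. {I. I \<in> F \<and> I \<subseteq> J})" using I J by (auto simp: S_def G_def)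
  qed
  have "(\<Sum>I\<in>G. \<mu> I) \<le> (\<Sum>I\<in>(\<Union>J\<in>S. {I. I \<in> F \<and> I \<subseteq> J}). \<mu> I)"
    using GS \<mu> F finS by (intro sum_mono2) auto
  also have "\<dots> \<le> (\<Sum>J\<in>S. \<Sum>I | I \<in> F \<and> I \<subseteq> J. \<mu> I)"
  proof (rule eq_refl, rule sum.UNION_disjoint)
    show "\<forall>i\<in>S. \<forall>j\<in>S. i \<noteq> j \<longrightarrow> {I. I \<in> F \<and> I \<subseteq> i} \<inter> {I. I \<in> F \<and> I \<subseteq> j} = {}"
    proof (intro ballI impI)
      fix i j assume *: "i \<in> S" "j \<in> S" "i \<noteq> j"
      then have "i \<inter> j = {}" using level_disjoint[of i k j] by (auto simp: S_def)
      then show "{I. I \<in> F \<and> I \<subseteq> i} \<inter> {I. I \<in> F \<and> I \<subseteq> j} = {}"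
        using subset_inter_empty[OF \<open>i \<inter> j = {}\<close>] node_nonempty[of "{}"] F(2) by (intro equals0I) auto
    qed
  qed (use finS F in auto)
  also have "\<dots> \<le> (\<Sum>J\<in>S. arc_length J powr p)"
    by (intro sum_mono carl) (auto simp: S_def intro: level_nodes)
  also have "\<dots> = (\<Sum>J\<in>S. (1 / 2 ^ k) powr p)"
    by (intro sum.cong) (auto simp: S_def arc_length_level)
  also have "\<dots> = real (card S) * (1 / 2 ^ k) powr p" by simp
  also have "\<dots> \<le> 28 * (2 * R) powr p"
  proof (rule mult_mono)
    show "real (card S) \<le> 28"
    proof (cases "R \<le> 1 / 2 ^ k")
      case True
      have "real (card S) \<le> 14 * (R * 2 ^ k + 1)"
        using R by (intro count_level_near[OF \<zeta>, of R S k]) (auto simp: S_def)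
      also have "\<dots> \<le> 28" using True by (simp add: field_simps)
      finally show ?thesis .
    next
      case False
      then have "card S \<le> card (D k)" "k = 0" using k(2) by (auto simp: S_def intro!: card_mono)
      then show ?thesis using card_level[of 0] by simp
    qed
    show "(1 / 2 ^ k) powr p \<le> (2 * R) powr p" using k(1) p by (intro powr_mono2) auto
  qed auto
  also have "\<dots> \<le> 28 * (2 * R powr p)"
  proof -
    have "(2 * R) powr p = 2 powr p * R powr p" using R by (simp add: powr_mult)
    also have "\<dots> \<le> 2 powr 1 * R powr p" using p by (intro mult_right_mono powr_mono) auto
    finally show ?thesis by simp
  qed
  finally show ?thesis by (simp add: G_def)
qed

end

section \<open>The Green function on upper half boxes\<close>

lemma borel_Int_disc_sets:
  assumes "A \<in> sets borel" shows "A \<inter> unit_disc \<in> sets area_measure"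
proof -
  have "unit_disc \<inter> A \<in> (\<inter>) unit_disc ` sets lebesgue" using assms by (intro imageI) simp
  then show ?thesis by (simp add: sets_area_measure sets_restrict_space Int_commute)
qed

text \<open>Summation over the annuli \<open>r / 2 ^ (n + 1) \<le> \<bar>z - a\<bar> < r / 2 ^ n\<close>.\<close>

lemma nn_integral_inverse_dist_ball_le:
  assumes r: "0 < r"
  shows "(\<integral>\<^sup>+z. ennreal (1 / cmod (z - a)) * indicator (ball a r) z \<partial>area_measure) \<le> ennreal (4 * r)"
proof -
  let ?B = "\<lambda>n. ball a (r / 2 ^ n) \<inter> unit_disc"
  have mB: "?B n \<in> sets area_measure" for n
    by (rule borel_Int_disc_sets) simp
  have "(\<integral>\<^sup>+z. ennreal (1 / cmod (z - a)) * indicator (ball a r) z \<partial>area_measure)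
      \<le> (\<integral>\<^sup>+z. (\<Sum>n. ennreal (2 ^ Suc n / r) * indicator (?B n) z) \<partial>area_measure)"
  proof (rule nn_integral_mono)
    fix z assume "z \<in> space area_measure"
    then have z: "z \<in> unit_disc" by simp
    show "ennreal (1 / cmod (z - a)) * indicator (ball a r) z \<le> (\<Sum>n. ennreal (2 ^ Suc n / r) * indicator (?B n) z)"
    proof (cases "z \<in> ball a r \<and> z \<noteq> a")
      case True
      define d where "d = cmod (z - a)"
      have d: "0 < d" "d < r" using True by (auto simp: d_def dist_norm norm_minus_commute)
      define n where "n = (LEAST n. r / 2 ^ Suc n \<le> d)"
      have "\<exists>n. r / 2 ^ Suc n \<le> d"
      proof -
        obtain n where "(1/2) ^ n < d / r" using real_arch_pow_inv[of "d / r" "1/2"] d r by auto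
        then have "r / 2 ^ n < d" using r by (simp add: field_simps power_one_over)
        moreover have "r / 2 ^ Suc n \<le> r / 2 ^ n" using r by (intro divide_left_mono) auto
        ultimately show ?thesis by (intro exI[of _ n]) linarith
      qed
      then have n1: "r / 2 ^ Suc n \<le> d" unfolding n_def by (rule LeastI_ex)
      have n2: "d < r / 2 ^ n"
      proof (cases n)
        case (Suc m)
        then have "\<not> r / 2 ^ Suc m \<le> d" using not_less_Least[of m "\<lambda>n. r / 2 ^ Suc n \<le> d"] by (simp add: n_def)
        then show ?thesis using Suc by simp
      qed (use d in simp)
      have "ennreal (1 / cmod (z - a)) * indicator (ball a r) z \<le> ennreal (2 ^ Suc n / r) * indicator (?B n) z"
      proof -
        have "z \<in> ?B n" using n2 z by (simp add: d_def dist_norm norm_minus_commute)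
        moreover have "1 / d \<le> 2 ^ Suc n / r" using n1 d r by (simp add: field_simps)
        ultimately show ?thesis using True by (auto simp: d_def intro: ennreal_leI)
      qed
      also have "\<dots> \<le> (\<Sum>n. ennreal (2 ^ Suc n / r) * indicator (?B n) z)"
      proof -
        define f where "f n = ennreal (2 ^ Suc n / r) * indicator (?B n) z" for n
        have "sum f {n} \<le> suminf f" by (rule sum_le_suminf) auto
        then show ?thesis by (simp add: f_def[symmetric] del: power_Suc)
      qed
      finally show ?thesis .
    qed (auto simp: indicator_def)
  qed
  also have "\<dots> = (\<Sum>n. \<integral>\<^sup>+z. ennreal (2 ^ Suc n / r) * indicator (?B n) z \<partial>area_measure)"
    by (rule nn_integral_suminf) (intro borel_measurable_times_ennreal borel_measurable_indicator mB borel_measurable_const)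
  also have "\<dots> = (\<Sum>n. ennreal (2 ^ Suc n / r) * emeasure area_measure (?B n))"
    by (intro suminf_cong nn_integral_cmult_indicator mB)
  also have "\<dots> \<le> (\<Sum>n. ennreal (2 * r * (1/2) ^ n))"
  proof (intro suminf_le summableI)
    fix n
    have "ennreal (2 ^ Suc n / r) * emeasure area_measure (?B n) \<le> ennreal (2 ^ Suc n / r) * ennreal ((r / 2 ^ n)\<^sup>2)"
      by (intro mult_left_mono emeasure_area_ball) simp
    also have "\<dots> = ennreal (2 ^ Suc n / r * (r / 2 ^ n)\<^sup>2)" using r by (intro ennreal_mult[symmetric]) auto
    also have "2 ^ Suc n / r * (r / 2 ^ n)\<^sup>2 = 2 * r * (1/2) ^ n"
      using r by (simp add: power2_eq_square field_simps power_one_over)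
    finally show "ennreal (2 ^ Suc n / r) * emeasure area_measure (?B n) \<le> ennreal (2 * r * (1/2) ^ n)" .
  qed
  also have "\<dots> = ennreal (\<Sum>n. 2 * r * (1/2) ^ n)"
    using r by (intro suminf_ennreal2) (auto intro: summable_mult)
  also have "(\<Sum>n. 2 * r * (1/2) ^ n) = 4 * r"
    by (subst suminf_mult) (auto simp: suminf_geometric)
  finally show ?thesis .
qed

text \<open>The quantity \<open>\<bar>1 - cnj w * z\<bar>\<close> dominates the heights of \<open>w\<close> and \<open>z\<close> above the circle and the
  distance between their radial projections.\<close>

lemma denominator_bounds:
  assumes \<zeta>: "cmod \<zeta> = 1" and x: "cmod x = 1" and t: "0 \<le> t" "t < 1" and r: "0 \<le> r" "r < 1"
  defines "q \<equiv> cmod (1 - cnj (of_real t * \<zeta>) * (of_real r * x))"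
  shows "1 - t \<le> q" "1 - r \<le> q" "cmod (\<zeta> - x) \<le> 2 * q" "0 < q"
proof -
  define s where "s = t * r"
  have s: "s \<le> t" "s \<le> r" "0 \<le> s" using t r by (auto simp: s_def mult_left_le mult_left_le_one_le)
  have "\<zeta> * (1 - cnj (of_real t * \<zeta>) * (of_real r * x)) = \<zeta> - of_real s * x"
    using \<zeta> complex_norm_square[of \<zeta>] by (simp add: s_def algebra_simps)
  then have q: "q = cmod (\<zeta> - of_real s * x)" using \<zeta> unfolding q_def by (metis mult_1 norm_mult)
  have "1 - s \<le> q"
    using norm_triangle_ineq2[of \<zeta> "of_real s * x"] s \<zeta> x by (simp add: q norm_mult)
  then show "1 - t \<le> q" "1 - r \<le> q" "0 < q" using s t by linarith+
  have "cmod (of_real s * x - x) = 1 - s"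
  proof -
    have "of_real s * x - x = of_real (s - 1) * x" by (simp add: algebra_simps)
    then have "cmod (of_real s * x - x) = \<bar>s - 1\<bar>" using x by (simp only: norm_mult norm_of_real mult_1_right)
    then show ?thesis using s r by simp
  qed
  then have "cmod (\<zeta> - x) \<le> q + (1 - s)"
    using norm_triangle_ineq[of "\<zeta> - of_real s * x" "of_real s * x - x"] by (simp add: q)
  then show "cmod (\<zeta> - x) \<le> 2 * q" using \<open>1 - s \<le> q\<close> by simp
qed

lemma one_minus_cnj_mult_nonzero:
  assumes "a \<in> unit_disc" "z \<in> unit_disc" shows "1 - cnj a * z \<noteq> 0"
proof
  assume "1 - cnj a * z = 0"
  then have "cmod (cnj a * z) = 1" by simp
  moreover have "cmod a * cmod z < 1 * 1" using assms by (intro mult_strict_mono') auto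
  ultimately show False by (simp add: norm_mult)
qed

lemma one_minus_disc_involution_sq:
  assumes "a \<in> unit_disc" "z \<in> unit_disc"
  shows "1 - (cmod (disc_involution a z))\<^sup>2 = (1 - (cmod a)\<^sup>2) * (1 - (cmod z)\<^sup>2) / (cmod (1 - cnj a * z))\<^sup>2"
proof -
  have ne: "1 - cnj a * z \<noteq> 0" by (rule one_minus_cnj_mult_nonzero[OF assms])
  have "(cmod (1 - cnj a * z))\<^sup>2 - (cmod (a - z))\<^sup>2 = (1 - (cmod a)\<^sup>2) * (1 - (cmod z)\<^sup>2)"
    by (simp add: cmod_power2 algebra_simps) (simp add: power2_eq_square algebra_simps)
  then show ?thesis using ne
    by (simp add: disc_involution_def norm_divide power_divide field_simps)
qed

lemma norm_disc_involution_less_1: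
  assumes "a \<in> unit_disc" "z \<in> unit_disc"
  shows "cmod (disc_involution a z) < 1"
proof -
  have "(cmod a)\<^sup>2 < 1" "(cmod z)\<^sup>2 < 1"
    using assms by (auto simp: power_less_one_iff abs_square_less_1)
  moreover have "1 - cnj a * z \<noteq> 0" by (rule one_minus_cnj_mult_nonzero[OF assms])
  ultimately have "0 < 1 - (cmod (disc_involution a z))\<^sup>2"
    unfolding one_minus_disc_involution_sq[OF assms] by (intro divide_pos_pos mult_pos_pos) auto
  then show ?thesis by (simp add: abs_square_less_1)
qed

lemma ln_inverse_le:
  assumes "0 < t" "t \<le> (1::real)"
  shows "ln (1 / t) \<le> (1 - t\<^sup>2) / t"
proof -
  have "ln (1 / t) \<le> 1 / t - 1" using assms by (intro ln_le_minus_one) auto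
  also have "\<dots> \<le> (1 - t\<^sup>2) / t"
    using assms by (simp add: field_simps power2_eq_square mult_left_le)
  finally show ?thesis .
qed

lemma green_nonneg: "a \<in> unit_disc \<Longrightarrow> z \<in> unit_disc \<Longrightarrow> 0 \<le> green z a"
  using norm_disc_involution_less_1[of a z] by (cases "disc_involution a z = 0") (auto simp: green_def ln_div)

text \<open>The factor \<open>1 / \<bar>\<sigma>\<^sub>a\<bar>\<close> absorbs the logarithmic pole at \<open>a\<close> and is integrable. Everywhere else
  the Green function behaves like \<open>1 - \<bar>\<sigma>\<^sub>a\<bar>\<^sup>2\<close>, so one bound serves both near \<open>a\<close> and far from it.\<close>

lemma green_powr_le:
  assumes p: "0 < p" "p \<le> 1" and a: "a \<in> unit_disc" and z: "z \<in> unit_disc"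
  shows "green z a powr p \<le> (1 - (cmod (disc_involution a z))\<^sup>2) powr p * (1 / cmod (disc_involution a z))"
proof (cases "disc_involution a z = 0")
  case True then show ?thesis by (simp add: green_def)
next
  case False
  define t where "t = cmod (disc_involution a z)"
  have t: "0 < t" "t < 1" using False norm_disc_involution_less_1[OF a z] by (auto simp: t_def)
  have t2: "0 \<le> 1 - t\<^sup>2" using t by (simp add: abs_square_le_1)
  have "green z a powr p \<le> ((1 - t\<^sup>2) / t) powr p"
    using ln_inverse_le[of t] t green_nonneg[OF a z] p by (intro powr_mono2) (auto simp: green_def t_def)
  also have "\<dots> = (1 - t\<^sup>2) powr p * (1 / t) powr p"
    using t t2 by (simp add: powr_mult[symmetric])
  also have "\<dots> \<le> (1 - t\<^sup>2) powr p * (1 / t) powr 1"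
    using t p by (intro mult_left_mono powr_mono) auto
  finally show ?thesis using t by (simp add: t_def)
qed

text \<open>The point \<open>z = a\<close> has to be excluded: there \<open>1 / 0 = 0\<close> and \<open>ln 0 = 0\<close> give the value 0.\<close>

lemma green_ge:
  assumes a: "a \<in> unit_disc" and z: "z \<in> unit_disc" and "z \<noteq> a"
  shows "(1 - (cmod (disc_involution a z))\<^sup>2) / 2 \<le> green z a"
proof -
  define t where "t = cmod (disc_involution a z)"
  have "1 - cnj a * z \<noteq> 0" by (rule one_minus_cnj_mult_nonzero[OF a z])
  then have t: "0 < t" "t < 1" using assms norm_disc_involution_less_1[OF a z] by (auto simp: t_def disc_involution_def)
  have "ln t \<le> t - 1" using t by (intro ln_le_minus_one)
  moreover have "(1 - t\<^sup>2) / 2 \<le> 1 - t"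
  proof -
    have "0 \<le> (1 - t)\<^sup>2" by simp
    then show ?thesis by (simp add: power2_diff field_simps)
  qed
  ultimately have "(1 - t\<^sup>2) / 2 \<le> - ln t" by linarith
  also have "- ln t = green z a" using t by (simp add: green_def ln_div flip: t_def)
  finally show ?thesis by (simp add: t_def)
qed

lemma inverse_disc_involution_le:
  assumes z: "z \<in> unit_disc" and "z \<noteq> a"
  shows "1 / cmod (disc_involution a z) \<le> 1 + 2 * (1 - cmod z) / cmod (z - a)"
proof -
  have "1 - cnj a * z = (1 - of_real ((cmod z)\<^sup>2)) + cnj (z - a) * z"
    unfolding complex_norm_square by (simp add: algebra_simps)
  then have "cmod (1 - cnj a * z) \<le> cmod (1 - of_real ((cmod z)\<^sup>2)) + cmod (z - a) * cmod z"
    by (metis complex_mod_cnj norm_mult norm_triangle_ineq)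
  moreover have "cmod (1 - of_real ((cmod z)\<^sup>2)) = 1 - (cmod z)\<^sup>2"
  proof -
    have "1 - of_real ((cmod z)\<^sup>2) = (of_real (1 - (cmod z)\<^sup>2) :: complex)" by simp
    moreover have "(cmod z)\<^sup>2 \<le> 1" using z by (simp add: abs_square_le_1)
    ultimately show ?thesis by (metis abs_of_nonneg diff_ge_0_iff_ge norm_of_real)
  qed
  moreover have "1 - (cmod z)\<^sup>2 \<le> 2 * (1 - cmod z)"
  proof -
    have "0 \<le> (1 - cmod z)\<^sup>2" by simp
    then show ?thesis by (simp add: power2_eq_square algebra_simps)
  qed
  moreover have "cmod (z - a) * cmod z \<le> cmod (z - a)" using z by (intro mult_left_le) auto
  ultimately have "cmod (1 - cnj a * z) \<le> 2 * (1 - cmod z) + cmod (z - a)" by linarith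
  then have "cmod (1 - cnj a * z) / cmod (z - a) \<le> (2 * (1 - cmod z) + cmod (z - a)) / cmod (z - a)"
    by (intro divide_right_mono) auto
  also have "\<dots> = 1 + 2 * (1 - cmod z) / cmod (z - a)" using assms by (simp add: field_simps)
  finally show ?thesis by (simp add: disc_involution_def norm_divide norm_minus_commute)
qed

context dyadic_levels
begin

lemma boxE:
  assumes "z \<in> upper_half_box I" "I \<in> nodes"
  obtains r x where "z = of_real r * x" "x \<in> I" "cmod x = 1" "cmod z = r" "0 \<le> r" "r < 1"
    "1 - arc_length I \<le> r" "r < 1 - arc_length I / 2"
proof -
  from assms(1) obtain r x where rx: "z = of_real r * x" "x \<in> I" "1 - arc_length I \<le> r" "r < 1 - arc_length I / 2"
    by (auto simp: upper_half_box_def)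
  have "cmod x = 1" using node_subset_circle[OF assms(2)] rx by auto
  moreover have "0 \<le> r" using rx arc_length_le_1[OF assms(2)] by linarith
  ultimately show ?thesis
    using rx arc_length_pos[OF assms(2)] by (intro that[of r x]) (auto simp: norm_mult)
qed

lemma box_subset_disc: "I \<in> nodes \<Longrightarrow> upper_half_box I \<subseteq> unit_disc"
  by (auto elim: boxE)

lemma box_borel:
  assumes I: "I \<in> nodes" shows "upper_half_box I \<in> sets borel"
proof (cases "arc_length I = 1")
  case True
  obtain k where k: "I \<in> D k" "arc_length I = 1 / 2 ^ k" using I by (rule nodesE)
  then have "(2::real) ^ k = 2 ^ 0" using True by simp
  then have "k = 0" by (simp only: power_inject_exp one_less_numeral_iff semiring_norm)
  then have "I = unit_circle" using k level_0 by simp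
  have "upper_half_box I = ball 0 (1/2)"
  proof (intro equalityI subsetI)
    fix z assume "z \<in> upper_half_box I"
    then show "z \<in> ball 0 (1/2)" using I True by (auto elim!: boxE)
  next
    fix z :: complex assume z: "z \<in> ball 0 (1/2)"
    define x where "x = (if z = 0 then 1 else sgn z)"
    have "z = of_real (cmod z) * x" "cmod x = 1" by (simp add: x_def sgn_eq) (simp add: x_def norm_sgn)
    then show "z \<in> upper_half_box I"
      using z True \<open>I = unit_circle\<close> unfolding upper_half_box_def
      by (auto intro!: exI[of _ "cmod z"] exI[of _ x])
  qed
  then show ?thesis by simp
next
  case False
  then have l: "arc_length I < 1" using arc_length_le_1[OF I] by simp
  have [measurable]: "I \<in> sets borel" by (intro half_open_arc_borel node_arc I)
  have [measurable]: "(\<lambda>z::complex. sgn z) \<in> borel_measurable borel"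
    unfolding sgn_eq by (intro borel_measurable_divide borel_measurable_of_real borel_measurable_norm measurable_ident_sets) auto
  have "upper_half_box I = {z. 1 - arc_length I \<le> cmod z \<and> cmod z < 1 - arc_length I / 2 \<and> sgn z \<in> I}"
  proof (intro equalityI subsetI CollectI)
    fix z assume "z \<in> upper_half_box I"
    then obtain r x where rx: "z = of_real r * x" "x \<in> I" "cmod x = 1" "cmod z = r" "1 - arc_length I \<le> r" "r < 1 - arc_length I / 2"
      using I by (rule boxE)
    have "sgn z = x" using rx l by (simp add: sgn_eq)
    then show "1 - arc_length I \<le> cmod z \<and> cmod z < 1 - arc_length I / 2 \<and> sgn z \<in> I" using rx by simp
  next
    fix z assume "z \<in> {z. 1 - arc_length I \<le> cmod z \<and> cmod z < 1 - arc_length I / 2 \<and> sgn z \<in> I}"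
    then show "z \<in> upper_half_box I"
      unfolding upper_half_box_def by (auto intro!: exI[of _ "cmod z"] exI[of _ "sgn z"] simp: sgn_eq)
  qed
  also have "\<dots> \<in> sets borel" by measurable
  finally show ?thesis .
qed

lemma box_sets: "I \<in> nodes \<Longrightarrow> upper_half_box I \<in> sets area_measure"
  using borel_Int_disc_sets[OF box_borel[of I]] box_subset_disc[of I] by (simp add: Int_absorb2)

lemma box_near_pt:
  assumes I: "I \<in> nodes" and z: "z \<in> upper_half_box I"
  shows "cmod (z - pt I) \<le> 8 * arc_length I"
proof -
  obtain r x where rx: "z = of_real r * x" "x \<in> I" "cmod x = 1" "r < 1" "1 - arc_length I \<le> r"
    using z I by (rule boxE)
  have "z - x = of_real (r - 1) * x" by (simp add: rx algebra_simps)
  then have "cmod (z - x) = \<bar>r - 1\<bar>" using rx by (simp only: norm_mult norm_of_real mult_1_right)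
  then have "cmod (z - x) \<le> arc_length I" using rx by simp
  moreover have "cmod (x - pt I) \<le> 7 * arc_length I" using node_diameter[OF I rx(2) pt_in[OF I]] .
  ultimately show ?thesis using norm_triangle_ineq[of "z - x" "x - pt I"] by simp
qed

lemma emeasure_box_le:
  assumes I: "I \<in> nodes" shows "emeasure area_measure (upper_half_box I) \<le> ennreal (81 * (arc_length I)\<^sup>2)"
proof -
  have "upper_half_box I \<subseteq> ball (pt I) (9 * arc_length I) \<inter> unit_disc"
    using box_near_pt[OF I] box_subset_disc[OF I] arc_length_pos[OF I]
    by (force simp: dist_norm norm_minus_commute)
  then have "emeasure area_measure (upper_half_box I) \<le> emeasure area_measure (ball (pt I) (9 * arc_length I) \<inter> unit_disc)"
    by (rule emeasure_mono, intro borel_Int_disc_sets borel_open open_ball)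
  also have "\<dots> \<le> ennreal ((9 * arc_length I)\<^sup>2)" by (rule emeasure_area_ball)
  finally show ?thesis by (simp add: power_mult_distrib)
qed

lemma nn_integral_box_inverse_dist_le:
  assumes I: "I \<in> nodes"
  shows "(\<integral>\<^sup>+z. ennreal (1 / cmod (z - a)) * indicator (upper_half_box I) z \<partial>area_measure) \<le> ennreal (85 * arc_length I)"
proof -
  let ?l = "arc_length I"
  have l: "0 < ?l" by (rule arc_length_pos[OF I])
  have mb: "ball a ?l \<inter> unit_disc \<in> sets area_measure" by (rule borel_Int_disc_sets) simp
  have "(\<integral>\<^sup>+z. ennreal (1 / cmod (z - a)) * indicator (upper_half_box I) z \<partial>area_measure)
     \<le> (\<integral>\<^sup>+z. ennreal (1 / cmod (z - a)) * indicator (ball a ?l) z + ennreal (1 / ?l) * indicator (upper_half_box I) z \<partial>area_measure)"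
  proof (rule nn_integral_mono)
    fix z
    have "1 / cmod (z - a) \<le> 1 / ?l" if "z \<notin> ball a ?l"
    proof -
      have "?l \<le> cmod (z - a)" using that by (simp add: dist_norm norm_minus_commute)
      then show ?thesis using l by (intro divide_left_mono mult_pos_pos) auto
    qed
    then show "ennreal (1 / cmod (z - a)) * indicator (upper_half_box I) z \<le>
      ennreal (1 / cmod (z - a)) * indicator (ball a ?l) z + ennreal (1 / ?l) * indicator (upper_half_box I) z"
      by (cases "z \<in> ball a ?l") (auto simp: indicator_def intro: ennreal_leI)
  qed
  also have "\<dots> = (\<integral>\<^sup>+z. ennreal (1 / cmod (z - a)) * indicator (ball a ?l) z \<partial>area_measure)
      + (\<integral>\<^sup>+z. ennreal (1 / ?l) * indicator (upper_half_box I) z \<partial>area_measure)"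
  proof (rule nn_integral_add)
    have "(\<lambda>z. ennreal (1 / cmod (z - a)) * indicator (ball a ?l) z) \<in> borel_measurable borel"
      by (intro borel_measurable_times_ennreal borel_measurable_indicator measurable_compose[OF _ measurable_ennreal]
           borel_measurable_divide borel_measurable_const borel_measurable_norm borel_measurable_diff measurable_ident_sets) auto
    then show "(\<lambda>z. ennreal (1 / cmod (z - a)) * indicator (ball a ?l) z) \<in> borel_measurable area_measure"
      unfolding measurable_area_measure by (intro measurable_restrict_space1 measurable_completion) simp
  qed (intro borel_measurable_times_ennreal borel_measurable_indicator borel_measurable_const box_sets I)
  also have "\<dots> \<le> ennreal (4 * ?l) + ennreal (1 / ?l) * ennreal (81 * ?l\<^sup>2)"
    using nn_integral_inverse_dist_ball_le[OF l] emeasure_box_le[OF I]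
    by (intro add_mono) (auto simp: nn_integral_cmult_indicator[OF box_sets[OF I]] intro: mult_left_mono)
  also have "\<dots> = ennreal (85 * ?l)"
    using l by (simp add: ennreal_mult[symmetric] ennreal_plus[symmetric] power2_eq_square del: ennreal_plus)
  finally show ?thesis .
qed

text \<open>Only generations below \<open>n\<close> are needed away from the circle, so finitely many boxes suffice there;
  this allows sums over finite families in \<open>nn_integral_le_of_box_sums\<close>.\<close>

lemma boxes_cover:
  assumes "cmod z < 1 - 1 / 2 ^ n"
  shows "\<exists>k<n. \<exists>I\<in>D k. z \<in> upper_half_box I"
proof -
  define k where "k = (LEAST k. cmod z < 1 - 1 / 2 ^ Suc k)"
  obtain m where m: "n = Suc m" using assms by (cases n) auto
  have 1: "cmod z < 1 - 1 / 2 ^ Suc k"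
    unfolding k_def by (rule LeastI[of _ m]) (use assms m in simp)
  have "k \<le> m" unfolding k_def by (rule Least_le) (use assms m in simp)
  have 2: "1 - 1 / 2 ^ k \<le> cmod z"
  proof (cases k)
    case (Suc j)
    then have "\<not> cmod z < 1 - 1 / 2 ^ Suc j" using not_less_Least[of j "\<lambda>k. cmod z < 1 - 1 / 2 ^ Suc k"] by (simp add: k_def)
    then show ?thesis using Suc by simp
  qed simp
  define x where "x = (if z = 0 then 1 else sgn z)"
  have x: "z = of_real (cmod z) * x" "cmod x = 1" by (simp add: x_def sgn_eq) (simp add: x_def norm_sgn)
  obtain I where I: "I \<in> D k" "x \<in> I" using circle_covered[of x k] x by auto
  have "z \<in> upper_half_box I"
    unfolding upper_half_box_def using 1 2 x I arc_length_level[OF I(1)] by (auto simp: mult.commute)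
  moreover have "k < n" using \<open>k \<le> m\<close> m by simp
  ultimately show ?thesis using I(1) by blast
qed

lemma nn_integral_le_of_box_sums:
  assumes G: "G \<in> borel_measurable area_measure"
    and bound: "\<And>F. finite F \<Longrightarrow> F \<subseteq> nodes \<Longrightarrow>
      (\<Sum>I\<in>F. \<integral>\<^sup>+z. G z * indicator (upper_half_box I) z \<partial>area_measure) \<le> B"
  shows "(\<integral>\<^sup>+z. G z \<partial>area_measure) \<le> B"
proof -
  let ?A = "\<lambda>n. {z. cmod z < 1 - 1 / 2 ^ n} \<inter> unit_disc :: complex set"
  have mA: "?A n \<in> sets area_measure" for n
  proof -
    have "?A n = ball 0 (1 - 1 / 2 ^ n) \<inter> unit_disc" by auto
    then show ?thesis by (simp only:) (rule borel_Int_disc_sets, simp)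
  qed
  have inc: "1 - 1 / 2 ^ m \<le> 1 - (1 / 2 ^ n :: real)" if "m \<le> n" for m n :: nat
    using that by (simp add: field_simps)
  have "(\<integral>\<^sup>+z. G z \<partial>area_measure) = (\<integral>\<^sup>+z. (SUP n. G z * indicator (?A n) z) \<partial>area_measure)"
  proof (rule nn_integral_cong)
    fix z assume "z \<in> space area_measure"
    then have z: "cmod z < 1" by simp
    obtain n where "(1/2) ^ n < 1 - cmod z" using real_arch_pow_inv[of "1 - cmod z" "1/2"] z by auto
    then have n: "z \<in> ?A n" using z by (simp add: power_one_over)
    show "G z = (SUP n. G z * indicator (?A n) z)"
    proof (rule antisym)
      show "G z \<le> (SUP n. G z * indicator (?A n) z)"
        by (rule SUP_upper2[of n]) (use n in auto)
      show "(SUP n. G z * indicator (?A n) z) \<le> G z"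
        by (rule SUP_least) (auto simp: indicator_def)
    qed
  qed
  also have "\<dots> = (SUP n. \<integral>\<^sup>+z. G z * indicator (?A n) z \<partial>area_measure)"
  proof (rule nn_integral_monotone_convergence_SUP)
    show "incseq (\<lambda>n z. G z * indicator (?A n) z)"
    proof (intro incseq_SucI le_funI)
      fix n z show "G z * indicator (?A n) z \<le> G z * indicator (?A (Suc n)) z"
        using inc[of n "Suc n"] by (auto simp: indicator_def)
    qed
    show "(\<lambda>z. G z * indicator (?A n) z) \<in> borel_measurable area_measure" for n
      by (intro borel_measurable_times_ennreal G borel_measurable_indicator mA)
  qed
  also have "\<dots> \<le> B"
  proof (rule SUP_least)
    fix n
    define F where "F = (\<Union>k<n. D k)"
    have F: "finite F" "F \<subseteq> nodes" by (auto simp: F_def nodes_def)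
    have "(\<integral>\<^sup>+z. G z * indicator (?A n) z \<partial>area_measure) \<le> (\<integral>\<^sup>+z. (\<Sum>I\<in>F. G z * indicator (upper_half_box I) z) \<partial>area_measure)"
    proof (rule nn_integral_mono)
      fix z
      show "G z * indicator (?A n) z \<le> (\<Sum>I\<in>F. G z * indicator (upper_half_box I) z)"
      proof (cases "z \<in> ?A n")
        case True
        then obtain I where I: "I \<in> F" "z \<in> upper_half_box I" using boxes_cover[of z n] by (auto simp: F_def)
        have "G z * indicator (?A n) z = (\<Sum>I\<in>{I}. G z * indicator (upper_half_box I) z)" using True I by simp
        also have "\<dots> \<le> (\<Sum>I\<in>F. G z * indicator (upper_half_box I) z)"
          using I F by (intro sum_mono2) auto
        finally show ?thesis .
      qed simp
    qed
    also have "\<dots> = (\<Sum>I\<in>F. \<integral>\<^sup>+z. G z * indicator (upper_half_box I) z \<partial>area_measure)"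
      by (rule nn_integral_sum) (use F box_sets G in \<open>auto intro!: borel_measurable_times_ennreal borel_measurable_indicator\<close>)
    also have "\<dots> \<le> B" by (rule bound[OF F])
    finally show "(\<integral>\<^sup>+z. G z * indicator (?A n) z \<partial>area_measure) \<le> B" .
  qed
  finally show ?thesis .
qed

end

section \<open>A discrete Schur test\<close>

text \<open>The constants are explicit functions of the exponents, so that every estimate is visibly uniform
  in the dyadic system.\<close>

definition decay_const :: "real \<Rightarrow> real \<Rightarrow> real" where
  "decay_const s Q = 2 powr (1 + s) / (1 - 2 powr - Q) * (28 / (1 - 2 powr - s))"

lemma decay_const_nonneg: "0 < s \<Longrightarrow> 0 < Q \<Longrightarrow> 0 \<le> decay_const s Q"
  unfolding decay_const_def by (intro mult_nonneg_nonneg divide_nonneg_nonneg) (auto simp: powr_less_one less_imp_le)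

definition schur_const :: "real \<Rightarrow> real" where
  "schur_const p = decay_const (7/4) (1/4) *
     (2 powr (3*p/2) * (decay_const (p + 3/4) (5/4 - p) + decay_const (3/4 - p/2) (5/4 - p))) *
     (2 powr p / (1 - 2 powr - (p/2)) * 56)"

text \<open>The factors come from \<open>norm_atom'_le\<close> (squared), \<open>involution_factor_le\<close> and
  \<open>nn_integral_box_inverse_involution_le\<close>.\<close>

definition atomic_bound :: "real \<Rightarrow> real" where
  "atomic_bound p = 16000\<^sup>2 * 1600 * 251 * schur_const p"

context dyadic_levels
begin

definition node_dist :: "complex set \<Rightarrow> complex set \<Rightarrow> real" where
  "node_dist I J = arc_length I + arc_length J + cmod (pt I - pt J)"

lemma node_dist_pos: "I \<in> nodes \<Longrightarrow> J \<in> nodes \<Longrightarrow> 0 < node_dist I J"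
  unfolding node_dist_def by (intro add_pos_nonneg add_pos_pos arc_length_pos) auto

lemma node_dist_ge:
  assumes "I \<in> nodes" "J \<in> nodes"
  shows "arc_length I \<le> node_dist I J" "arc_length J \<le> node_dist I J" "cmod (pt I - pt J) \<le> node_dist I J" "cmod (pt J - pt I) \<le> node_dist I J"
  using arc_length_pos[OF assms(1)] arc_length_pos[OF assms(2)] by (auto simp: node_dist_def norm_minus_commute)

text \<open>\<open>sum_powr_near_le\<close> supplies the growth that \<open>sum_decay_le\<close> requires.\<close>

lemma near_decay:
  assumes s: "0 < s" and Q: "0 < Q" and F: "finite F" "F \<subseteq> nodes" and \<zeta>: "cmod \<zeta> = 1" and \<delta>: "0 < \<delta>"
    and d: "\<And>I. I \<in> F \<Longrightarrow> \<delta> \<le> d I \<and> arc_length I \<le> d I \<and> cmod (pt I - \<zeta>) \<le> d I"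
  shows "(\<Sum>I\<in>F. arc_length I powr (1 + s) * d I powr - (1 + s + Q)) \<le> decay_const s Q * \<delta> powr - Q"
proof -
  have "0 < 1 - 2 powr - s" using s by (simp add: powr_less_one)
  then have "(\<Sum>I\<in>F. arc_length I powr (1 + s) * d I powr - ((1 + s) + Q))
     \<le> 2 powr (1 + s) / (1 - 2 powr - Q) * (28 / (1 - 2 powr - s)) * \<delta> powr - Q"
  proof (intro sum_decay_le F \<delta> Q)
    fix R assume R: "\<delta> \<le> R"
    show "(\<Sum>i | i \<in> F \<and> d i \<le> R. arc_length i powr (1 + s)) \<le> 28 / (1 - 2 powr - s) * R powr (1 + s)"
    proof (rule sum_powr_near_le[OF s _ _ \<zeta>])
      fix I assume "I \<in> {i \<in> F. d i \<le> R}"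
      then show "arc_length I \<le> R \<and> cmod (pt I - \<zeta>) \<le> R" using d[of I] by force
    qed (use F \<delta> R in auto)
  qed (use s d in auto)
  then show ?thesis by (simp add: decay_const_def)
qed

text \<open>On the box of \<open>J\<close>, a sum of atoms with coefficients \<open>x\<close> has a derivative of size
  \<open>\<Sum>I. x I * l I powr 2 * node_dist I J powr - 3\<close>. The lemma is the Carleson estimate for these values,
  tested against the weight \<open>A powr (p/2) * na J powr - (3*p/2)\<close>, which is larger than the kernel
  \<open>(A / na J\<^sup>2) powr p\<close> of the Green function. The flatter weight is what makes the argument work up to
  \<open>p = 1\<close>: the Cauchy-Schwarz splitting below has room for exponents less than 1, whereas in the same argument
  \<open>na J powr - (2*p)\<close> would require one greater than \<open>p\<close>.

  The Cauchy-Schwarz inequality (\<open>row\<close>) bounds the square by a sum over \<open>I\<close> of \<open>(x I)\<^sup>2\<close>. After interchanging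
  the sums, \<open>col\<close> performs the summation over \<open>J\<close>: as \<open>na I \<le> node_dist I J + na J\<close>, one of the two
  distances is at least \<open>na I / 2\<close>, and in both cases the factor \<open>na I powr - (3*p/2)\<close> comes out. What remains is
  the weight summed against the Carleson sequence \<open>(x I)\<^sup>2 * l I powr p\<close>.\<close>

lemma discrete_schur:
  fixes x :: "complex set \<Rightarrow> real"
  assumes p: "0 < p" "p \<le> 1" and F: "finite F" "F \<subseteq> nodes" and G: "finite G" "G \<subseteq> nodes"
    and carl: "\<And>J. J \<in> nodes \<Longrightarrow> (\<Sum>I | I \<in> F \<and> I \<subseteq> J. (x I)\<^sup>2 * arc_length I powr p) \<le> arc_length J powr p"
    and \<zeta>: "cmod \<zeta> = 1" and A: "0 < A"
  defines "na \<equiv> \<lambda>J. arc_length J + A + cmod (pt J - \<zeta>)"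
  shows "(\<Sum>J\<in>G. arc_length J powr (2 + p) * (\<Sum>I\<in>F. x I * (arc_length I powr 2 * node_dist I J powr - 3))\<^sup>2 *
            (A powr (p/2) * na J powr - (3*p/2))) \<le> schur_const p"
proof -
  let ?l = arc_length
  define r where "r = 3 * p / 2"
  define C1 where "C1 = decay_const (7/4) (1/4)"
  define C2 where "C2 = decay_const (p + 3/4) (5/4 - p)"
  define C3 where "C3 = decay_const (3/4 - p/2) (5/4 - p)"
  have C: "0 \<le> C1" "0 \<le> C2" "0 \<le> C3"
    unfolding C1_def C2_def C3_def using p by (auto intro!: decay_const_nonneg)
  have na_pos: "0 < na J" if "J \<in> nodes" for J
    unfolding na_def using arc_length_pos[OF that] A by (intro add_pos_nonneg add_pos_pos) auto
  \<comment> \<open>The exponents split \<open>l I powr 2\<close> as \<open>11/8 + 5/8\<close>; then \<open>1 + 7/4 < 3\<close> makes the first factor summable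
    and leaves \<open>l J powr - (1/4)\<close>.\<close>
  have row: "(\<Sum>I\<in>F. x I * (?l I powr 2 * node_dist I J powr - 3))\<^sup>2 \<le>
      C1 * ?l J powr - (1/4) * (\<Sum>I\<in>F. (x I)\<^sup>2 * (?l I powr (5/4) * node_dist I J powr - 3))" if J: "J \<in> nodes" for J
  proof -
    have eq: "(\<Sum>I\<in>F. x I * (?l I powr 2 * node_dist I J powr - 3))
        = (\<Sum>I\<in>F. (?l I powr (11/8) * node_dist I J powr - (3/2)) * (x I * (?l I powr (5/8) * node_dist I J powr - (3/2))))"
    proof (intro sum.cong refl)
      fix I
      have "?l I powr 2 = ?l I powr (11/8) * ?l I powr (5/8)" "node_dist I J powr - 3 = node_dist I J powr - (3/2) * node_dist I J powr - (3/2)"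
        by (simp_all add: powr_add[symmetric])
      then show "x I * (?l I powr 2 * node_dist I J powr - 3) =
          ?l I powr (11/8) * node_dist I J powr - (3/2) * (x I * (?l I powr (5/8) * node_dist I J powr - (3/2)))"
        by (simp only: mult_ac)
    qed
    have "(\<Sum>I\<in>F. x I * (?l I powr 2 * node_dist I J powr - 3))\<^sup>2 \<le> (\<Sum>I\<in>F. (?l I powr (11/8) * node_dist I J powr - (3/2))\<^sup>2) * (\<Sum>I\<in>F. (x I * (?l I powr (5/8) * node_dist I J powr - (3/2)))\<^sup>2)"
      unfolding eq by (rule Cauchy_Schwarz_ineq_sum)
    also have "(\<Sum>I\<in>F. (?l I powr (11/8) * node_dist I J powr - (3/2))\<^sup>2) = (\<Sum>I\<in>F. ?l I powr (1 + 7/4) * node_dist I J powr - (1 + 7/4 + 1/4))"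
    proof (intro sum.cong refl)
      fix I
      have "(?l I powr (11/8))\<^sup>2 = ?l I powr (1 + 7/4)" "(node_dist I J powr - (3/2))\<^sup>2 = node_dist I J powr - (1 + 7/4 + 1/4)"
        by (simp_all add: power2_eq_square powr_add[symmetric])
      then show "(?l I powr (11/8) * node_dist I J powr - (3/2))\<^sup>2 = ?l I powr (1 + 7/4) * node_dist I J powr - (1 + 7/4 + 1/4)"
        by (simp only: power_mult_distrib)
    qed
    also have "(\<Sum>I\<in>F. (x I * (?l I powr (5/8) * node_dist I J powr - (3/2)))\<^sup>2) = (\<Sum>I\<in>F. (x I)\<^sup>2 * (?l I powr (5/4) * node_dist I J powr - 3))"
    proof (intro sum.cong refl)
      fix I
      have "(?l I powr (5/8))\<^sup>2 = ?l I powr (5/4)" "(node_dist I J powr - (3/2))\<^sup>2 = node_dist I J powr - 3"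
        by (simp_all add: power2_eq_square powr_add[symmetric])
      then show "(x I * (?l I powr (5/8) * node_dist I J powr - (3/2)))\<^sup>2 = (x I)\<^sup>2 * (?l I powr (5/4) * node_dist I J powr - 3)"
        by (simp only: power_mult_distrib)
    qed
    also have "(\<Sum>I\<in>F. ?l I powr (1 + 7/4) * node_dist I J powr - (1 + 7/4 + 1/4)) \<le> C1 * ?l J powr - (1/4)"
      unfolding C1_def
      by (rule near_decay[OF _ _ F norm_pt[OF J] arc_length_pos[OF J]]) (use J F node_dist_ge in auto)
    finally show ?thesis by (simp add: mult_right_mono sum_nonneg)
  qed
  have col: "(\<Sum>J\<in>G. ?l J powr (p + 7/4) * na J powr - r * node_dist I J powr - 3) \<le>
      2 powr r * (C2 + C3) * ?l I powr (p - 5/4) * na I powr - r" if I: "I \<in> nodes" for I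
  proof -
    define U where "U J = ?l J powr (1 + (p + 3/4)) * node_dist I J powr - (1 + (p + 3/4) + (5/4 - p))" for J
    define V where "V J = ?l J powr (1 + (3/4 - p/2)) * node_dist I J powr - (1 + (3/4 - p/2) + (5/4 - p))" for J
    have V0: "0 \<le> U J" "0 \<le> V J" for J by (simp_all add: U_def V_def)
    have pt: "?l J powr (p + 7/4) * na J powr - r * node_dist I J powr - 3 \<le>
      2 powr r * na I powr - r * (U J + V J)" if "J \<in> G" for J
    proof -
      have J: "J \<in> nodes" using that G by auto
      note pos = na_pos[OF I] na_pos[OF J] node_dist_pos[OF I J] arc_length_pos[OF J]
      have r0: "0 < r" using p by (simp add: r_def)
      have tri: "na I \<le> node_dist I J + na J"
        using arc_length_pos[OF J] norm_triangle_ineq[of "pt I - pt J" "pt J - \<zeta>"] by (simp add: na_def node_dist_def)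
      have half: "y powr - r \<le> 2 powr r * na I powr - r" if "na I / 2 \<le> y" for y
      proof -
        have "y powr - r \<le> (na I / 2) powr - r" using that pos r0 by (intro powr_mono2') auto
        also have "\<dots> = 2 powr r * na I powr - r" using pos by (simp add: powr_divide powr_minus field_simps)
        finally show ?thesis .
      qed
      show ?thesis
      proof (cases "na I / 2 \<le> na J")
        case True
        have "?l J powr (p + 7/4) * na J powr - r * node_dist I J powr - 3 \<le> ?l J powr (p + 7/4) * (2 powr r * na I powr - r) * node_dist I J powr - 3"
          by (intro mult_right_mono mult_left_mono half True) auto
        also have "\<dots> = 2 powr r * na I powr - r * U J"
          by (simp add: U_def algebra_simps)
        also have "\<dots> \<le> 2 powr r * na I powr - r * (U J + V J)"
          using V0 by (intro mult_left_mono) auto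
        finally show ?thesis .
      next
        case False
        then have h: "na I / 2 \<le> node_dist I J" using tri by linarith
        have "na J powr - r \<le> ?l J powr - r"
          using pos r0 A by (intro powr_mono2') (auto simp: na_def)
        then have "?l J powr (p + 7/4) * na J powr - r * node_dist I J powr - 3 \<le> ?l J powr (p + 7/4) * ?l J powr - r * node_dist I J powr - 3"
          by (intro mult_right_mono mult_left_mono) auto
        also have "\<dots> = node_dist I J powr - r * V J"
        proof -
          have "?l J powr (p + 7/4) * ?l J powr - r = ?l J powr (1 + (3/4 - p/2))"
            by (simp add: powr_add[symmetric] r_def)
          moreover have "node_dist I J powr - 3 = node_dist I J powr - r * node_dist I J powr - (1 + (3/4 - p/2) + (5/4 - p))"
            by (simp add: powr_add[symmetric] r_def)
          ultimately show ?thesis by (simp add: V_def)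
        qed
        also have "\<dots> \<le> 2 powr r * na I powr - r * V J"
          using V0 by (intro mult_right_mono half h) auto
        also have "\<dots> \<le> 2 powr r * na I powr - r * (U J + V J)"
          using V0 by (intro mult_left_mono) auto
        finally show ?thesis .
      qed
    qed
    have "(\<Sum>J\<in>G. ?l J powr (p + 7/4) * na J powr - r * node_dist I J powr - 3) \<le>
      (\<Sum>J\<in>G. 2 powr r * na I powr - r * (U J + V J))"
      by (intro sum_mono pt)
    also have "\<dots> = 2 powr r * na I powr - r * ((\<Sum>J\<in>G. U J) + (\<Sum>J\<in>G. V J))"
      by (simp only: sum_distrib_left[symmetric] sum.distrib)
    also have "\<dots> \<le> 2 powr r * na I powr - r * (C2 * ?l I powr - (5/4 - p) + C3 * ?l I powr - (5/4 - p))"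
      unfolding C2_def C3_def U_def V_def
    proof (intro mult_left_mono add_mono)
      have d: "?l I \<le> node_dist I J \<and> ?l J \<le> node_dist I J \<and> cmod (pt J - pt I) \<le> node_dist I J" if "J \<in> G" for J
        using node_dist_ge[OF I, of J] G that by auto
      show "(\<Sum>J\<in>G. ?l J powr (1 + (p + 3/4)) * node_dist I J powr - (1 + (p + 3/4) + (5/4 - p))) \<le> decay_const (p + 3/4) (5/4 - p) * ?l I powr - (5/4 - p)"
        by (rule near_decay[OF _ _ G norm_pt[OF I] arc_length_pos[OF I] d]) (use p in auto)
      show "(\<Sum>J\<in>G. ?l J powr (1 + (3/4 - p/2)) * node_dist I J powr - (1 + (3/4 - p/2) + (5/4 - p))) \<le> decay_const (3/4 - p/2) (5/4 - p) * ?l I powr - (5/4 - p)"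
        by (rule near_decay[OF _ _ G norm_pt[OF I] arc_length_pos[OF I] d]) (use p in auto)
    qed auto
    also have "\<dots> = 2 powr r * (C2 + C3) * ?l I powr (p - 5/4) * na I powr - r"
      by (simp add: algebra_simps)
    finally show ?thesis .
  qed
  have "(\<Sum>J\<in>G. ?l J powr (2 + p) * (\<Sum>I\<in>F. x I * (?l I powr 2 * node_dist I J powr - 3))\<^sup>2 * (A powr (p/2) * na J powr - r))
     \<le> (\<Sum>J\<in>G. ?l J powr (2 + p) * (C1 * ?l J powr - (1/4) * (\<Sum>I\<in>F. (x I)\<^sup>2 * (?l I powr (5/4) * node_dist I J powr - 3))) * (A powr (p/2) * na J powr - r))"
    using G by (intro sum_mono mult_right_mono mult_left_mono row) auto
  also have "\<dots> = (\<Sum>J\<in>G. \<Sum>I\<in>F. C1 * A powr (p/2) * (x I)\<^sup>2 * ?l I powr (5/4) * (?l J powr (p + 7/4) * na J powr - r * node_dist I J powr - 3))"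
  proof (intro sum.cong refl)
    fix J
    have e: "?l J powr (p + 7/4) = ?l J powr (2 + p) * ?l J powr - (1/4)"
      by (simp add: powr_add[symmetric] add.commute)
    show "?l J powr (2 + p) * (C1 * ?l J powr - (1/4) * (\<Sum>I\<in>F. (x I)\<^sup>2 * (?l I powr (5/4) * node_dist I J powr - 3))) * (A powr (p/2) * na J powr - r)
      = (\<Sum>I\<in>F. C1 * A powr (p/2) * (x I)\<^sup>2 * ?l I powr (5/4) * (?l J powr (p + 7/4) * na J powr - r * node_dist I J powr - 3))"
      unfolding e sum_distrib_left sum_distrib_right by (intro sum.cong refl) (simp only: mult_ac)
  qed
  also have "\<dots> = (\<Sum>I\<in>F. \<Sum>J\<in>G. C1 * A powr (p/2) * (x I)\<^sup>2 * ?l I powr (5/4) * (?l J powr (p + 7/4) * na J powr - r * node_dist I J powr - 3))"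
    by (rule sum.swap)
  also have "\<dots> = (\<Sum>I\<in>F. C1 * A powr (p/2) * (x I)\<^sup>2 * ?l I powr (5/4) * (\<Sum>J\<in>G. ?l J powr (p + 7/4) * na J powr - r * node_dist I J powr - 3))"
    by (simp only: sum_distrib_left)
  also have "\<dots> \<le> (\<Sum>I\<in>F. C1 * A powr (p/2) * (x I)\<^sup>2 * ?l I powr (5/4) * (2 powr r * (C2 + C3) * ?l I powr (p - 5/4) * na I powr - r))"
    using F C by (intro sum_mono mult_left_mono col) auto
  also have "\<dots> = C1 * (2 powr r * (C2 + C3)) * A powr (p/2) * (\<Sum>I\<in>F. (x I)\<^sup>2 * ?l I powr p * na I powr - (p + p/2))"
  proof -
    have "?l I powr p = ?l I powr (5/4) * ?l I powr (p - 5/4)" for I by (simp add: powr_add[symmetric])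
    moreover have "- r = - (p + p/2)" by (simp add: r_def)
    ultimately show ?thesis
      unfolding sum_distrib_left by (intro sum.cong refl) (simp only: mult_ac)
  qed
  also have "\<dots> \<le> C1 * (2 powr r * (C2 + C3)) * A powr (p/2) * (2 powr p / (1 - 2 powr - (p/2)) * 56 * A powr - (p/2))"
  proof (intro mult_left_mono sum_decay_le)
    fix R assume R: "A \<le> R"
    have "(\<Sum>i | i \<in> F \<and> na i \<le> R. (x i)\<^sup>2 * ?l i powr p) \<le> (\<Sum>i | i \<in> F \<and> ?l i \<le> R \<and> cmod (pt i - \<zeta>) \<le> R. (x i)\<^sup>2 * ?l i powr p)"
    proof (intro sum_mono2)
      show "{i \<in> F. na i \<le> R} \<subseteq> {i \<in> F. ?l i \<le> R \<and> cmod (pt i - \<zeta>) \<le> R}"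
      proof safe
        fix i assume i: "i \<in> F" "na i \<le> R"
        then have "0 < ?l i" using F arc_length_pos by auto
        then show "?l i \<le> R" "cmod (pt i - \<zeta>) \<le> R"
          using i(2) A norm_ge_zero[of "pt i - \<zeta>"] unfolding na_def by linarith+
      qed
    qed (use F in auto)
    also have "\<dots> \<le> 56 * R powr p"
      by (rule carleson_near_le[OF p F _ carl \<zeta>]) (use A R in auto)
    finally show "(\<Sum>i | i \<in> F \<and> na i \<le> R. (x i)\<^sup>2 * ?l i powr p) \<le> 56 * R powr p" .
  next
    fix i assume "i \<in> F"
    then have "0 < ?l i" using F arc_length_pos by auto
    then show "A \<le> na i" by (simp add: na_def)
  qed (use F p A C in auto)
  also have "\<dots> = schur_const p"
  proof -
    have "A powr (p/2) * A powr - (p/2) = 1" using A by (simp add: powr_add[symmetric])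
    then show ?thesis by (simp add: schur_const_def C1_def C2_def C3_def r_def)
  qed
  finally show ?thesis by (simp add: r_def)
qed

text \<open>The singularity of \<open>1 / \<bar>\<sigma>\<^sub>a\<bar>\<close> is harmless at the scale of a box, wherever \<open>a\<close> lies.\<close>

lemma nn_integral_box_inverse_involution_le:
  assumes J: "J \<in> nodes"
  shows "(\<integral>\<^sup>+z. ennreal (1 / cmod (disc_involution a z)) * indicator (upper_half_box J) z \<partial>area_measure) \<le> ennreal (251 * (arc_length J)\<^sup>2)"
proof -
  let ?l = "arc_length J"
  have l: "0 < ?l" by (rule arc_length_pos[OF J])
  let ?d = "\<lambda>z. ennreal (1 / cmod (z - a)) * indicator (upper_half_box J) z"
  have md: "?d \<in> borel_measurable area_measure"
  proof -
    have "?d \<in> borel_measurable borel"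
      by (intro borel_measurable_times_ennreal borel_measurable_indicator measurable_compose[OF _ measurable_ennreal]
           borel_measurable_divide borel_measurable_const borel_measurable_norm borel_measurable_diff measurable_ident_sets box_borel J) auto
    then show ?thesis
      unfolding measurable_area_measure by (intro measurable_restrict_space1 measurable_completion) simp
  qed
  have "(\<integral>\<^sup>+z. ennreal (1 / cmod (disc_involution a z)) * indicator (upper_half_box J) z \<partial>area_measure)
     \<le> (\<integral>\<^sup>+z. indicator (upper_half_box J) z + ennreal (2 * ?l) * ?d z \<partial>area_measure)"
  proof (rule nn_integral_mono)
    fix z
    show "ennreal (1 / cmod (disc_involution a z)) * indicator (upper_half_box J) z
      \<le> indicator (upper_half_box J) z + ennreal (2 * ?l) * ?d z"
    proof (cases "z \<in> upper_half_box J \<and> z \<noteq> a")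
      case True
      then obtain r where r: "cmod z = r" "r < 1" "1 - ?l \<le> r" using J by (auto elim!: boxE)
      have "1 / cmod (disc_involution a z) \<le> 1 + 2 * (1 - cmod z) / cmod (z - a)"
        using True r by (intro inverse_disc_involution_le) auto
      also have "\<dots> \<le> 1 + 2 * ?l / cmod (z - a)"
        using r by (intro add_left_mono divide_right_mono) auto
      finally have "ennreal (1 / cmod (disc_involution a z)) \<le> ennreal (1 + (2 * ?l) * (1 / cmod (z - a)))"
        by (intro ennreal_leI) simp
      also have "\<dots> = 1 + ennreal (2 * ?l) * ennreal (1 / cmod (z - a))"
        using l by (simp add: ennreal_plus ennreal_mult[symmetric])
      finally show ?thesis using True by simp
    qed (auto simp: disc_involution_def)
  qed
  also have "\<dots> = (\<integral>\<^sup>+z. indicator (upper_half_box J) z \<partial>area_measure) + (\<integral>\<^sup>+z. ennreal (2 * ?l) * ?d z \<partial>area_measure)"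
    by (rule nn_integral_add)
       (intro borel_measurable_times_ennreal borel_measurable_indicator borel_measurable_const box_sets J md)+
  also have "\<dots> = emeasure area_measure (upper_half_box J) + ennreal (2 * ?l) * (\<integral>\<^sup>+z. ?d z \<partial>area_measure)"
    by (simp only: nn_integral_indicator[OF box_sets[OF J]] nn_integral_cmult[OF md])
  also have "\<dots> \<le> ennreal (81 * ?l\<^sup>2) + ennreal (2 * ?l) * ennreal (85 * ?l)"
    by (intro add_mono mult_left_mono emeasure_box_le J nn_integral_box_inverse_dist_le) simp
  also have "\<dots> = ennreal (251 * ?l\<^sup>2)"
    using l by (simp add: ennreal_mult[symmetric] ennreal_plus[symmetric] power2_eq_square del: ennreal_plus)
  finally show ?thesis .
qed

text \<open>The exponent of the distance is lowered from \<open>2 * p\<close> to \<open>3 * p / 2\<close> with the help of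
  \<open>1 - t \<le> na\<close>, where \<open>na\<close> is the distance in the conclusion; this is the weight in \<open>discrete_schur\<close>.\<close>

lemma involution_factor_le:
  assumes p: "0 < p" "p \<le> 1" and J: "J \<in> nodes" and z: "z \<in> upper_half_box J"
    and a: "a = of_real t * \<zeta>" "cmod \<zeta> = 1" "0 \<le> t" "t < 1"
  shows "(1 - (cmod (disc_involution a z))\<^sup>2) powr p \<le>
    1600 * (arc_length J powr p * ((1 - t) powr (p/2) * (arc_length J + (1 - t) + cmod (pt J - \<zeta>)) powr - (3*p/2)))"
proof -
  let ?l = "arc_length J"
  define A where "A = 1 - t"
  define na where "na = ?l + A + cmod (pt J - \<zeta>)"
  obtain r x where rx: "z = of_real r * x" "x \<in> J" "cmod x = 1" "cmod z = r" "0 \<le> r" "r < 1" "1 - ?l \<le> r" "r < 1 - ?l / 2"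
    using z J by (rule boxE)
  define q where "q = cmod (1 - cnj a * z)"
  have q: "1 - t \<le> q" "1 - r \<le> q" "cmod (\<zeta> - x) \<le> 2 * q" "0 < q"
    using denominator_bounds[OF a(2) rx(3) a(3,4) rx(5,6)] by (simp_all add: q_def a rx(1))
  have l: "0 < ?l" by (rule arc_length_pos[OF J])
  have A: "0 < A" using a by (simp add: A_def)
  have na0: "0 < na" "A \<le> na" using l A by (auto simp: na_def intro: add_pos_nonneg)
  have "cmod (pt J - \<zeta>) \<le> 7 * ?l + 2 * q"
    using norm_triangle_ineq[of "pt J - x" "x - \<zeta>"] node_diameter[OF J pt_in[OF J] rx(2)] q(3)
    by (simp add: norm_minus_commute)
  then have na: "na \<le> 20 * q" using q rx by (simp add: na_def A_def)
  have ad: "a \<in> unit_disc" and zd: "z \<in> unit_disc" using a rx by (auto simp: norm_mult)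
  have at: "cmod a = t" using a by (simp add: norm_mult)
  have "1 - (cmod (disc_involution a z))\<^sup>2 = (1 - t\<^sup>2) * (1 - r\<^sup>2) / q\<^sup>2"
    using one_minus_disc_involution_sq[OF ad zd] by (simp add: at rx(4) q_def)
  also have "\<dots> \<le> (2 * A) * (2 * ?l) / (na / 20)\<^sup>2"
  proof (rule frac_le)
    have "1 - s\<^sup>2 = (1 - s) * (1 + s)" for s :: real by (simp add: power2_eq_square algebra_simps)
    then show "(1 - t\<^sup>2) * (1 - r\<^sup>2) \<le> (2 * A) * (2 * ?l)" "0 \<le> (2 * A) * (2 * ?l)"
    proof -
      have "1 - t\<^sup>2 \<le> 2 * A"
      proof -
        have "0 \<le> (1 - t)\<^sup>2" by simp
        then show ?thesis by (simp add: A_def power2_diff)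
      qed
      moreover have "1 - r\<^sup>2 \<le> 2 * ?l"
      proof -
        have "0 \<le> (1 - r)\<^sup>2" by simp
        then show ?thesis using rx by (simp add: power2_diff)
      qed
      moreover have "0 \<le> 1 - r\<^sup>2" using rx by (simp add: abs_square_le_1)
      ultimately show "(1 - t\<^sup>2) * (1 - r\<^sup>2) \<le> (2 * A) * (2 * ?l)" using A by (intro mult_mono) auto
      show "0 \<le> (2 * A) * (2 * ?l)" using A l by simp
    qed
    show "0 < (na / 20)\<^sup>2" using na0 by simp
    show "(na / 20)\<^sup>2 \<le> q\<^sup>2" using na na0 by (intro power_mono) auto
  qed
  also have "\<dots> = 1600 * (?l * (A / na\<^sup>2))" using na0 by (simp add: field_simps power2_eq_square)
  finally have le: "1 - (cmod (disc_involution a z))\<^sup>2 \<le> 1600 * (?l * (A / na\<^sup>2))" .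
  have "0 \<le> 1 - (cmod (disc_involution a z))\<^sup>2"
    using norm_disc_involution_less_1[OF ad zd] by (simp add: abs_square_le_1)
  then have "(1 - (cmod (disc_involution a z))\<^sup>2) powr p \<le> (1600 * (?l * (A / na\<^sup>2))) powr p"
    using le p by (intro powr_mono2) auto
  also have "\<dots> = 1600 powr p * (?l powr p * (A powr p * na powr - (2 * p)))"
  proof -
    have "(A / na\<^sup>2) powr p = A powr p * na powr - (2 * p)"
      using A na0 by (simp add: powr_divide powr_minus powr_powr field_simps flip: powr_numeral)
    moreover have "(1600 * (?l * X)) powr p = 1600 powr p * (?l powr p * X powr p)" for X
      using l by (simp only: powr_mult)
    ultimately show ?thesis by (simp only:)
  qed
  also have "\<dots> \<le> 1600 * (?l powr p * (A powr (p/2) * na powr - (3*p/2)))"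
  proof (rule mult_mono)
    have "(1600::real) powr p \<le> 1600 powr 1" using p by (intro powr_mono) auto
    then show "(1600::real) powr p \<le> 1600" by simp
    have "A powr p * na powr - (2 * p) = A powr (p/2) * (A powr (p/2) * na powr - (2 * p))"
      by (simp add: powr_add[symmetric] mult.assoc[symmetric])
    also have "\<dots> \<le> A powr (p/2) * (na powr (p/2) * na powr - (2 * p))"
      using A na0 p by (intro mult_left_mono mult_right_mono powr_mono2) auto
    also have "na powr (p/2) * na powr - (2 * p) = na powr - (3*p/2)"
      by (simp add: powr_add[symmetric])
    finally show "?l powr p * (A powr p * na powr - (2 * p)) \<le> ?l powr p * (A powr (p/2) * na powr - (3*p/2))"
      by (intro mult_left_mono) auto
  qed auto
  finally show ?thesis by (simp add: na_def A_def)
qed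

end

lemma borel_imp_measurable_area: "f \<in> borel_measurable borel \<Longrightarrow> f \<in> borel_measurable area_measure"
  unfolding measurable_area_measure by (intro measurable_restrict_space1 measurable_completion) simp

lemma green_measurable: "(\<lambda>z. green z a) \<in> borel_measurable area_measure"
proof (rule borel_imp_measurable_area)
  have [measurable]: "cnj \<in> borel_measurable borel" "(\<lambda>z::complex. z) \<in> borel_measurable borel"
    by (intro borel_measurable_continuous_onI continuous_intros)+
  show "(\<lambda>z. green z a) \<in> borel_measurable borel"
    unfolding green_def disc_involution_def by measurable
qed

lemma deriv_measurable:
  assumes "f holomorphic_on unit_disc" shows "deriv f \<in> borel_measurable area_measure"
  using holomorphic_deriv[OF assms] by (intro continuous_imp_measurable_area holomorphic_on_imp_continuous_on) auto

lemma Qp_integrand_measurable: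
  assumes "f holomorphic_on unit_disc"
  shows "(\<lambda>z. ennreal ((cmod (deriv f z))\<^sup>2 * green z a powr p)) \<in> borel_measurable area_measure"
proof -
  note [measurable] = green_measurable deriv_measurable[OF assms]
  show ?thesis by measurable
qed

text \<open>At \<open>a = 0\<close> the direction \<open>\<zeta>\<close> is arbitrary.\<close>

lemma unit_disc_polar:
  assumes "a \<in> unit_disc"
  obtains t \<zeta> where "a = of_real t * \<zeta>" "cmod \<zeta> = 1" "0 \<le> t" "t < 1" "t = cmod a"
proof (rule that[of "cmod a" "if a = 0 then 1 else sgn a"])
qed (use assms in \<open>auto simp: sgn_eq norm_divide\<close>)

section \<open>Sums of atoms in \<open>\<Q>\<^sub>p\<close>\<close>

context dyadic_levels
begin

text \<open>The pole lies at height \<open>l / 2\<close> rather than \<open>l\<close>, so that it is away from the origin for the whole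
  circle as well; with its pole at the origin the atom would be constant.\<close>

definition pole :: "complex set \<Rightarrow> complex" where
  "pole I = of_real (1 - arc_length I / 2) * pt I"

definition atom :: "complex set \<Rightarrow> complex \<Rightarrow> complex" where
  "atom I z = (of_real (arc_length I) / (1 - cnj (pole I) * z))\<^sup>2"

definition atom' :: "complex set \<Rightarrow> complex \<Rightarrow> complex" where
  "atom' I z = 2 * cnj (pole I) * of_real ((arc_length I)\<^sup>2) / (1 - cnj (pole I) * z) ^ 3"

lemma norm_pole: assumes "I \<in> nodes" shows "cmod (pole I) = 1 - arc_length I / 2" "1 / 2 \<le> cmod (pole I)" "cmod (pole I) < 1"
proof -
  have "0 \<le> 1 - arc_length I / 2" using arc_length_le_1[OF assms] by linarith
  then show e: "cmod (pole I) = 1 - arc_length I / 2"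
    unfolding pole_def norm_mult norm_pt[OF assms] norm_of_real by simp
  show "1 / 2 \<le> cmod (pole I)" "cmod (pole I) < 1"
    unfolding e using arc_length_le_1[OF assms] arc_length_pos[OF assms] by linarith+
qed

lemma atom_denominator_nonzero:
  assumes "I \<in> nodes" "z \<in> unit_disc" shows "1 - cnj (pole I) * z \<noteq> 0"
  using assms norm_pole[of I] by (intro one_minus_cnj_mult_nonzero) auto

lemma norm_one_minus_cnj_pole_le:
  assumes I: "I \<in> nodes" and z: "z \<in> unit_disc"
  shows "cmod (1 - cnj (pole I) * z) \<le> cmod (z - pt I) + arc_length I / 2"
proof -
  let ?l = "arc_length I"
  have l: "0 < ?l" by (rule arc_length_pos[OF I])
  have "cnj (pt I) * pt I = 1" using complex_norm_square[of "pt I"] norm_pt[OF I] by (simp add: mult.commute)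
  then have "1 - cnj (pole I) * z = cnj (pt I) * (pt I - z) + of_real (?l / 2) * (cnj (pt I) * z)"
    by (simp add: pole_def algebra_simps)
  then have "cmod (1 - cnj (pole I) * z) \<le> cmod (cnj (pt I) * (pt I - z)) + cmod (of_real (?l / 2) * (cnj (pt I) * z))"
    by (simp only: norm_triangle_ineq)
  also have "cmod (cnj (pt I) * (pt I - z)) = cmod (z - pt I)"
    using norm_pt[OF I] by (simp add: norm_mult norm_minus_commute)
  also have "cmod (of_real (?l / 2) * (cnj (pt I) * z)) = ?l / 2 * cmod z"
    using l norm_pt[OF I] by (simp add: norm_mult)
  also have "\<dots> \<le> ?l / 2 * 1" using l z by (intro mult_left_mono) auto
  finally show ?thesis by simp
qed

lemma atom_has_derivative:
  assumes "I \<in> nodes" "z \<in> unit_disc"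
  shows "(atom I has_field_derivative atom' I z) (at z)"
proof -
  note ne = atom_denominator_nonzero[OF assms]
  have "((\<lambda>z. (of_real (arc_length I) / (1 - cnj (pole I) * z))\<^sup>2) has_field_derivative atom' I z) (at z)"
    by (rule derivative_eq_intros refl ne)+
       (use ne in \<open>simp add: atom'_def field_simps power2_eq_square power3_eq_cube\<close>)
  then show ?thesis by (simp add: atom_def[abs_def])
qed

text \<open>Here 20 relates \<open>node_dist I J\<close> to \<open>\<bar>1 - cnj (pole I) * z\<bar>\<close>, and \<open>16000 = 2 * 20 ^ 3\<close>.\<close>

lemma norm_atom'_le:
  assumes I: "I \<in> nodes" and J: "J \<in> nodes" and z: "z \<in> upper_half_box J"
  shows "cmod (atom' I z) \<le> 16000 * (arc_length I powr 2 * node_dist I J powr - 3)"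
proof -
  obtain r x where rx: "z = of_real r * x" "x \<in> J" "cmod x = 1" "cmod z = r" "0 \<le> r" "r < 1" "1 - arc_length J \<le> r" "r < 1 - arc_length J / 2"
    using z J by (rule boxE)
  define q where "q = cmod (1 - cnj (pole I) * z)"
  have t: "0 \<le> 1 - arc_length I / 2" "1 - arc_length I / 2 < 1"
    using arc_length_pos[OF I] arc_length_le_1[OF I] by linarith+
  have q: "arc_length I / 2 \<le> q" "1 - r \<le> q" "cmod (pt I - x) \<le> 2 * q" "0 < q"
    using denominator_bounds[OF norm_pt[OF I] rx(3) t rx(5,6)] by (simp_all add: q_def pole_def rx(1))
  have "cmod (pt I - pt J) \<le> 2 * q + 7 * arc_length J"
    using norm_triangle_ineq[of "pt I - x" "x - pt J"] q(3) node_diameter[OF J rx(2) pt_in[OF J]] by simp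
  then have nd: "node_dist I J \<le> 20 * q" using q rx by (simp add: node_dist_def)
  have n0: "0 < node_dist I J" by (rule node_dist_pos[OF I J])
  have "cmod (atom' I z) = 2 * cmod (pole I) * (arc_length I)\<^sup>2 / q ^ 3"
    by (simp add: atom'_def norm_mult norm_divide norm_power q_def)
  also have "\<dots> \<le> 2 * 1 * (arc_length I)\<^sup>2 / (node_dist I J / 20) ^ 3"
    using norm_pole[OF I] n0 nd q by (intro frac_le mult_mono power_mono) auto
  also have "\<dots> = 16000 * ((arc_length I)\<^sup>2 / node_dist I J ^ 3)"
    using n0 by (simp add: field_simps power3_eq_cube)
  also have "(arc_length I)\<^sup>2 / node_dist I J ^ 3 = arc_length I powr 2 * node_dist I J powr - 3"
    using n0 arc_length_pos[OF I] by (simp add: powr_minus field_simps)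
  finally show ?thesis .
qed

lemma norm_atom'_ge:
  assumes I: "I \<in> nodes" and z: "z \<in> upper_half_box I"
  shows "1 / (729 * arc_length I) \<le> cmod (atom' I z)"
proof -
  let ?l = "arc_length I"
  have l: "0 < ?l" by (rule arc_length_pos[OF I])
  have z1: "z \<in> unit_disc" using box_subset_disc[OF I] z by auto
  have q: "cmod (1 - cnj (pole I) * z) \<le> 9 * ?l"
    using norm_one_minus_cnj_pole_le[OF I z1] box_near_pt[OF I z] l by linarith
  have q0: "0 < cmod (1 - cnj (pole I) * z)" using atom_denominator_nonzero[OF I z1] by simp
  have "1 / (729 * ?l) = 2 * (1/2) * ?l\<^sup>2 / (9 * ?l) ^ 3"
    using l by (simp add: field_simps power2_eq_square power3_eq_cube)
  also have "\<dots> \<le> 2 * cmod (pole I) * ?l\<^sup>2 / cmod (1 - cnj (pole I) * z) ^ 3"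
    using norm_pole[OF I] q q0 l by (intro frac_le mult_mono power_mono) auto
  also have "\<dots> = cmod (atom' I z)"
    by (simp add: atom'_def norm_mult norm_divide norm_power)
  finally show ?thesis .
qed

text \<open>The atoms are normalized to vanish at the origin, so that the norm in \<open>\<Q>\<^sub>p\<close> is the seminorm.\<close>

definition atomic_sum :: "complex set set \<Rightarrow> (complex set \<Rightarrow> real) \<Rightarrow> complex \<Rightarrow> complex" where
  "atomic_sum F x z = (\<Sum>I\<in>F. of_real (x I) * (atom I z - atom I 0))"

lemma atomic_sum_0: "atomic_sum F x 0 = 0"
  by (simp add: atomic_sum_def)

lemma atomic_sum_has_derivative:
  assumes "F \<subseteq> nodes" "z \<in> unit_disc"
  shows "(atomic_sum F x has_field_derivative (\<Sum>I\<in>F. of_real (x I) * atom' I z)) (at z)"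
proof -
  have "((\<lambda>z. \<Sum>I\<in>F. of_real (x I) * (atom I z - atom I 0)) has_field_derivative (\<Sum>I\<in>F. of_real (x I) * (atom' I z - 0))) (at z)"
    using assms by (intro DERIV_sum DERIV_cmult DERIV_diff atom_has_derivative DERIV_const) auto
  then show ?thesis by (simp add: atomic_sum_def[abs_def])
qed

lemma atomic_sum_holomorphic: "F \<subseteq> nodes \<Longrightarrow> atomic_sum F x holomorphic_on unit_disc"
  using atomic_sum_has_derivative[of F] by (subst holomorphic_on_open) (auto, blast)

lemma deriv_atomic_sum:
  "F \<subseteq> nodes \<Longrightarrow> z \<in> unit_disc \<Longrightarrow> deriv (atomic_sum F x) z = (\<Sum>I\<in>F. of_real (x I) * atom' I z)"
  by (intro DERIV_imp_deriv atomic_sum_has_derivative)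

text \<open>On each box, \<open>f'\<close> and the smooth part of the Green function are replaced by their upper bounds;
  the sum over the boxes is then the one in \<open>discrete_schur\<close>. Only the sizes of the coefficients enter, so the bound
  survives any change of signs.\<close>

lemma Qp_seminorm_atomic_sum_le:
  assumes p: "0 < p" "p \<le> 1" and F: "finite F" "F \<subseteq> nodes"
    and carl: "\<And>J. J \<in> nodes \<Longrightarrow> (\<Sum>I | I \<in> F \<and> I \<subseteq> J. (x I)\<^sup>2 * arc_length I powr p) \<le> arc_length J powr p"
  shows "Qp_seminorm_sq p (atomic_sum F x) \<le> ennreal (atomic_bound p)"
  unfolding Qp_seminorm_sq_def
proof (rule SUP_least)
  fix a assume "a \<in> unit_disc"
  then obtain t \<zeta> where a: "a = of_real t * \<zeta>" "cmod \<zeta> = 1" "0 \<le> t" "t < 1" by (rule unit_disc_polar)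
  let ?l = arc_length
  let ?u = "\<lambda>z. ennreal ((cmod (deriv (atomic_sum F x) z))\<^sup>2 * green z a powr p)"
  define na where "na J = ?l J + (1 - t) + cmod (pt J - \<zeta>)" for J
  define T where "T J = (\<Sum>I\<in>F. \<bar>x I\<bar> * (?l I powr 2 * node_dist I J powr - 3))" for J
  have T0: "0 \<le> T J" for J by (auto simp: T_def intro!: sum_nonneg)
  define B where "B J = (16000 * T J)\<^sup>2 * (1600 * (?l J powr p * ((1 - t) powr (p/2) * na J powr - (3*p/2))))" for J
  have B0: "0 \<le> B J" for J by (simp add: B_def)
  show "(\<integral>\<^sup>+z. ?u z \<partial>area_measure)
      \<le> ennreal (atomic_bound p)"
  proof (rule nn_integral_le_of_box_sums[OF Qp_integrand_measurable[OF atomic_sum_holomorphic[OF F(2)]]])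
    fix G assume G: "finite G" "G \<subseteq> nodes"
    have box: "(\<integral>\<^sup>+z. ?u z * indicator (upper_half_box J) z \<partial>area_measure)
       \<le> ennreal (B J * (251 * (?l J)\<^sup>2))" if J: "J \<in> nodes" for J
    proof -
      have "(\<integral>\<^sup>+z. ?u z * indicator (upper_half_box J) z \<partial>area_measure)
         \<le> (\<integral>\<^sup>+z. ennreal (B J) * (ennreal (1 / cmod (disc_involution a z)) * indicator (upper_half_box J) z) \<partial>area_measure)"
      proof (rule nn_integral_mono)
        fix z assume "z \<in> space area_measure"
        then have z1: "z \<in> unit_disc" by simp
        show "?u z * indicator (upper_half_box J) z
          \<le> ennreal (B J) * (ennreal (1 / cmod (disc_involution a z)) * indicator (upper_half_box J) z)"
        proof (cases "z \<in> upper_half_box J")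
          case True
          have "cmod (deriv (atomic_sum F x) z) \<le> (\<Sum>I\<in>F. cmod (of_real (x I) * atom' I z))"
            unfolding deriv_atomic_sum[OF F(2) z1] by (rule norm_sum)
          also have "\<dots> \<le> (\<Sum>I\<in>F. \<bar>x I\<bar> * (16000 * (?l I powr 2 * node_dist I J powr - 3)))"
            unfolding norm_mult norm_of_real
            using F by (intro sum_mono mult_left_mono norm_atom'_le J True) auto
          also have "\<dots> = 16000 * T J"
            unfolding T_def sum_distrib_left by (intro sum.cong refl) (simp only: mult_ac)
          finally have d: "(cmod (deriv (atomic_sum F x) z))\<^sup>2 \<le> (16000 * T J)\<^sup>2" by (intro power_mono) auto
          have "green z a powr p \<le> (1 - (cmod (disc_involution a z))\<^sup>2) powr p * (1 / cmod (disc_involution a z))"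
            by (rule green_powr_le[OF p \<open>a \<in> unit_disc\<close> z1])
          also have "\<dots> \<le> (1600 * (?l J powr p * ((1 - t) powr (p/2) * na J powr - (3*p/2)))) * (1 / cmod (disc_involution a z))"
            unfolding na_def by (intro mult_right_mono involution_factor_le p J True a) auto
          finally have "(cmod (deriv (atomic_sum F x) z))\<^sup>2 * green z a powr p
             \<le> (16000 * T J)\<^sup>2 * ((1600 * (?l J powr p * ((1 - t) powr (p/2) * na J powr - (3*p/2)))) * (1 / cmod (disc_involution a z)))"
            using d by (intro mult_mono) auto
          also have "\<dots> = B J * (1 / cmod (disc_involution a z))" by (simp only: B_def mult.assoc)
          finally show ?thesis using True B0 by (simp add: ennreal_mult[symmetric] ennreal_leI)
        qed simp
      qed
      also have "\<dots> = ennreal (B J) * (\<integral>\<^sup>+z. ennreal (1 / cmod (disc_involution a z)) * indicator (upper_half_box J) z \<partial>area_measure)"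
      proof (rule nn_integral_cmult)
        have [measurable]: "(\<lambda>z::complex. z) \<in> borel_measurable borel"
          by (intro borel_measurable_continuous_onI continuous_intros)
        have "(\<lambda>z. ennreal (1 / cmod (disc_involution a z))) \<in> borel_measurable borel"
          unfolding disc_involution_def by measurable
        then show "(\<lambda>z. ennreal (1 / cmod (disc_involution a z)) * indicator (upper_half_box J) z) \<in> borel_measurable area_measure"
          by (intro borel_imp_measurable_area borel_measurable_times_ennreal borel_measurable_indicator box_borel J)
      qed
      also have "\<dots> \<le> ennreal (B J) * ennreal (251 * (?l J)\<^sup>2)"
        by (intro mult_left_mono nn_integral_box_inverse_involution_le J) simp
      finally show ?thesis using B0 by (simp add: ennreal_mult[symmetric])
    qed
    have "(\<Sum>J\<in>G. \<integral>\<^sup>+z. ?u z * indicator (upper_half_box J) z \<partial>area_measure)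
       \<le> (\<Sum>J\<in>G. ennreal (B J * (251 * (?l J)\<^sup>2)))"
      using G by (intro sum_mono box) auto
    also have "\<dots> = ennreal (\<Sum>J\<in>G. B J * (251 * (?l J)\<^sup>2))"
      using B0 by (intro sum_ennreal) auto
    also have "(\<Sum>J\<in>G. B J * (251 * (?l J)\<^sup>2)) =
       16000\<^sup>2 * 1600 * 251 * (\<Sum>J\<in>G. ?l J powr (2 + p) * (T J)\<^sup>2 * ((1 - t) powr (p/2) * na J powr - (3*p/2)))"
      unfolding sum_distrib_left
    proof (intro sum.cong refl)
      fix J assume "J \<in> G"
      then have "0 < ?l J" using G arc_length_pos by auto
      then have "?l J powr (2 + p) = (?l J)\<^sup>2 * ?l J powr p" by (simp add: powr_add)
      then show "B J * (251 * (?l J)\<^sup>2) = 16000\<^sup>2 * 1600 * 251 * (?l J powr (2 + p) * (T J)\<^sup>2 * ((1 - t) powr (p/2) * na J powr - (3*p/2)))"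
        by (simp only: B_def power_mult_distrib mult_ac)
    qed
    also have "\<dots> \<le> atomic_bound p"
      unfolding T_def na_def atomic_bound_def
      by (intro mult_left_mono discrete_schur p F G a) (use carl a in auto)
    finally show "(\<Sum>J\<in>G. \<integral>\<^sup>+z. ?u z * indicator (upper_half_box J) z \<partial>area_measure)
       \<le> ennreal (atomic_bound p)" by (simp add: ennreal_leI)
  qed
qed

end

section \<open>Carleson sequences from functions in \<open>\<Q>\<^sub>p\<close>\<close>

lemma AE_area_neq: "AE z in area_measure. z \<noteq> a"
proof (rule AE_I[of _ _ "{a} \<inter> unit_disc"])
  show "{a} \<inter> unit_disc \<in> sets area_measure" by (rule borel_Int_disc_sets) simp
  have "emeasure area_measure ({a} \<inter> unit_disc) \<le> ennreal e" if e: "0 < e" for e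
  proof -
    have "emeasure area_measure ({a} \<inter> unit_disc) \<le> emeasure area_measure (ball a (sqrt e) \<inter> unit_disc)"
    proof (rule emeasure_mono)
      show "{a} \<inter> unit_disc \<subseteq> ball a (sqrt e) \<inter> unit_disc"
        by (rule Int_mono[OF _ order_refl]) (simp add: e)
      show "ball a (sqrt e) \<inter> unit_disc \<in> sets area_measure" by (intro borel_Int_disc_sets borel_open open_ball)
    qed
    also have "\<dots> \<le> ennreal ((sqrt e)\<^sup>2)" by (rule emeasure_area_ball)
    finally show ?thesis using e by simp
  qed
  then have "emeasure area_measure ({a} \<inter> unit_disc) \<le> 0"
    by (intro ennreal_le_epsilon[of 0]) (simp add: add_0)
  then show "emeasure area_measure ({a} \<inter> unit_disc) = 0" by simp
qed auto

text \<open>A factor 16 from the radius \<open>l / 4\<close> of the discs in the mean value property, \<open>129472 = 56 * 34\<^sup>2 * 2\<close>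
  from the overlap of these discs, and 1024 from \<open>green_pole_ge\<close>.\<close>

definition carleson_const :: real where "carleson_const = 16 * 129472 * 1024"

context dyadic_levels
begin

text \<open>The Green function with pole above \<open>J\<close> is at least a multiple of \<open>(1 - \<bar>z\<bar>) / l J\<close> on a neighbourhood of the
  Carleson box over \<open>J\<close>; the number \<open>31/2\<close> is large enough to include all discs in \<open>Qp_carleson_boxes\<close>.\<close>

lemma green_pole_ge:
  assumes J: "J \<in> nodes" and z: "z \<in> unit_disc" "cmod (z - pt J) \<le> 31/2 * arc_length J" "z \<noteq> pole J"
  shows "1 - cmod z \<le> 1024 * arc_length J * green z (pole J)"
proof -
  let ?l = "arc_length J"
  have l: "0 < ?l" by (rule arc_length_pos[OF J])
  have q: "cmod (1 - cnj (pole J) * z) \<le> 16 * ?l"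
    using norm_one_minus_cnj_pole_le[OF J z(1)] z(2) by linarith
  have q0: "0 < cmod (1 - cnj (pole J) * z)" using atom_denominator_nonzero[OF J z(1)] by simp
  have pd: "pole J \<in> unit_disc" using norm_pole[OF J] by simp
  have sq: "1 - s \<le> 1 - s\<^sup>2" if "0 \<le> s" "s \<le> 1" for s :: real
    using that by (simp add: power2_eq_square mult_left_le)
  have "(?l / 2) * (1 - cmod z) / (16 * ?l)\<^sup>2 \<le> (1 - (cmod (pole J))\<^sup>2) * (1 - (cmod z)\<^sup>2) / (cmod (1 - cnj (pole J) * z))\<^sup>2"
  proof (rule frac_le)
    have "?l / 2 \<le> 1 - (cmod (pole J))\<^sup>2" using sq[of "cmod (pole J)"] norm_pole[OF J] by simp
    moreover have "1 - cmod z \<le> 1 - (cmod z)\<^sup>2" using sq[of "cmod z"] z by simp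
    ultimately show "(?l / 2) * (1 - cmod z) \<le> (1 - (cmod (pole J))\<^sup>2) * (1 - (cmod z)\<^sup>2)"
      using l z by (intro mult_mono) auto
    moreover have "0 \<le> (?l / 2) * (1 - cmod z)" using l z by (intro mult_nonneg_nonneg) auto
    ultimately show "0 \<le> (1 - (cmod (pole J))\<^sup>2) * (1 - (cmod z)\<^sup>2)" by linarith
    show "0 < (cmod (1 - cnj (pole J) * z))\<^sup>2" using q0 by simp
    show "(cmod (1 - cnj (pole J) * z))\<^sup>2 \<le> (16 * ?l)\<^sup>2" using q by (intro power_mono) auto
  qed
  also have "\<dots> = 1 - (cmod (disc_involution (pole J) z))\<^sup>2"
    by (rule one_minus_disc_involution_sq[OF pd z(1), symmetric])
  also have "\<dots> \<le> 2 * green z (pole J)" using green_ge[OF pd z(1,3)] by simp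
  finally have "(?l / 2) * (1 - cmod z) / (16 * ?l)\<^sup>2 \<le> 2 * green z (pole J)" .
  moreover have "(?l / 2) * (1 - cmod z) / (16 * ?l)\<^sup>2 = (1 - cmod z) / (512 * ?l)"
    using l by (simp add: power2_eq_square)
  ultimately have "(1 - cmod z) / (512 * ?l) \<le> 2 * green z (pole J)" by (simp only:)
  then have "1 - cmod z \<le> 2 * green z (pole J) * (512 * ?l)" using l by (subst (asm) pos_divide_le_eq) simp_all
  then show ?thesis by (simp add: mult_ac)
qed

text \<open>Apply the mean value property on discs of radius \<open>l I / 4\<close> about the points \<open>w I\<close>. A point \<open>z\<close>
  lies only in discs belonging to arcs of length comparable to \<open>1 - \<bar>z\<bar>\<close> and close to \<open>z\<close>, so the sum of their
  \<open>l I powr p\<close> is a multiple of \<open>(1 - \<bar>z\<bar>) powr p\<close>; this in turn is dominated by \<open>l J powr p\<close> times the Green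
  function with pole above \<open>J\<close>.\<close>

lemma Qp_carleson_boxes:
  assumes p: "0 < p" "p \<le> 1" and f: "f holomorphic_on unit_disc"
    and F: "finite F" "F \<subseteq> nodes" and J: "J \<in> nodes"
    and w: "\<And>I. I \<in> F \<Longrightarrow> w I \<in> upper_half_box I"
  shows "(\<Sum>I | I \<in> F \<and> I \<subseteq> J. ennreal (arc_length I powr (p + 2) * (cmod (deriv f (w I)))\<^sup>2))
    \<le> ennreal (carleson_const * arc_length J powr p) * Qp_seminorm_sq p f"
proof -
  let ?l = arc_length
  define F' where "F' = {I. I \<in> F \<and> I \<subseteq> J}"
  have F': "finite F'" "F' \<subseteq> nodes" using F by (auto simp: F'_def)
  let ?B = "\<lambda>I. ball (w I) (?l I / 4)"
  have holo: "deriv f holomorphic_on unit_disc" by (intro holomorphic_deriv f) auto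
  note [measurable] = deriv_measurable[OF f]
  have mB: "(\<lambda>z. ennreal ((cmod (deriv f z))\<^sup>2) * indicator (?B I) z) \<in> borel_measurable area_measure" for I
  proof (rule borel_measurable_times_ennreal)
    show "(indicator (?B I) :: complex \<Rightarrow> ennreal) \<in> borel_measurable area_measure"
      by (intro borel_imp_measurable_area borel_measurable_indicator) simp
  qed measurable
  have one: "ennreal (?l I powr (p + 2) * (cmod (deriv f (w I)))\<^sup>2) \<le>
      ennreal (16 * ?l I powr p) * (\<integral>\<^sup>+z. ennreal ((cmod (deriv f z))\<^sup>2) * indicator (?B I) z \<partial>area_measure)"
    if "I \<in> F'" for I
  proof -
    have I: "I \<in> nodes" "I \<in> F" using that F' by (auto simp: F'_def)
    have l: "0 < ?l I" by (rule arc_length_pos[OF I(1)])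
    have wI: "cmod (w I) + ?l I / 4 < 1" using w[OF I(2)] I(1) l by (auto elim!: boxE)
    have "?l I powr (p + 2) = ?l I powr p * (?l I)\<^sup>2" using l by (simp add: powr_add)
    then have "?l I powr (p + 2) * (cmod (deriv f (w I)))\<^sup>2 = (16 * ?l I powr p) * ((cmod (deriv f (w I)))\<^sup>2 * (?l I / 4)\<^sup>2)"
      by (simp add: power_divide)
    then have "ennreal (?l I powr (p + 2) * (cmod (deriv f (w I)))\<^sup>2) = ennreal (16 * ?l I powr p) * ennreal ((cmod (deriv f (w I)))\<^sup>2 * (?l I / 4)\<^sup>2)"
      by (simp only: ennreal_mult[symmetric] zero_le_power2 mult_nonneg_nonneg powr_ge_zero zero_le_numeral)
    also have "\<dots> \<le> ennreal (16 * ?l I powr p) * (\<integral>\<^sup>+z. ennreal ((cmod (deriv f z))\<^sup>2) * indicator (?B I) z \<partial>area_measure)"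
      using l wI by (intro mult_left_mono norm_sq_le_area_integral holo) auto
    finally show ?thesis .
  qed
  have "(\<Sum>I\<in>F'. ennreal (?l I powr (p + 2) * (cmod (deriv f (w I)))\<^sup>2)) \<le>
     (\<Sum>I\<in>F'. ennreal (16 * ?l I powr p) * (\<integral>\<^sup>+z. ennreal ((cmod (deriv f z))\<^sup>2) * indicator (?B I) z \<partial>area_measure))"
    by (intro sum_mono one)
  also have "\<dots> = (\<Sum>I\<in>F'. \<integral>\<^sup>+z. ennreal (16 * ?l I powr p) * (ennreal ((cmod (deriv f z))\<^sup>2) * indicator (?B I) z) \<partial>area_measure)"
    by (intro sum.cong refl nn_integral_cmult[symmetric] mB)
  also have "\<dots> = (\<integral>\<^sup>+z. (\<Sum>I\<in>F'. ennreal (16 * ?l I powr p) * (ennreal ((cmod (deriv f z))\<^sup>2) * indicator (?B I) z)) \<partial>area_measure)"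
    by (rule nn_integral_sum[symmetric]) (intro borel_measurable_times_ennreal borel_measurable_const mB)
  also have "\<dots> \<le> (\<integral>\<^sup>+z. ennreal (carleson_const * ?l J powr p) * ennreal ((cmod (deriv f z))\<^sup>2 * green z (pole J) powr p) \<partial>area_measure)"
  proof (rule nn_integral_mono_AE, rule AE_mp[OF AE_area_neq[of "pole J"]], rule AE_I2, rule impI)
    fix z assume "z \<in> space area_measure" and za: "z \<noteq> pole J"
    then have z: "z \<in> unit_disc" by simp
    obtain t0 \<zeta> where \<zeta>: "z = of_real t0 * \<zeta>" "cmod \<zeta> = 1" "0 \<le> t0" "t0 < 1" "t0 = cmod z"
      using z by (rule unit_disc_polar)
    define t where "t = 1 - cmod z"
    have t: "0 < t" using z by (simp add: t_def)
    have z\<zeta>: "cmod (z - \<zeta>) = t"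
    proof -
      have "z - \<zeta> = of_real (t0 - 1) * \<zeta>" by (subst \<zeta>(1)) (simp add: algebra_simps)
      then have "cmod (z - \<zeta>) = \<bar>t0 - 1\<bar>" by (simp only: norm_mult norm_of_real \<zeta>(2) mult_1_right)
      then show ?thesis using \<zeta>(4,5) unfolding t_def by linarith
    qed
    define S where "S = {I \<in> F'. z \<in> ?B I}"
    have S: "finite S" "S \<subseteq> nodes" using F' by (auto simp: S_def)
    have geo: "?l I \<le> 4 * t" "4/5 * t \<le> ?l I" "cmod (pt I - \<zeta>) \<le> 34 * t" "cmod (z - pt J) \<le> 31/2 * ?l J" if "I \<in> S" for I
    proof -
      have I: "I \<in> nodes" "I \<in> F" "I \<subseteq> J" "cmod (w I - z) < ?l I / 4"
        using that F by (auto simp: S_def F'_def dist_norm)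
      have l: "0 < ?l I" "?l I \<le> ?l J" using arc_length_pos[OF I(1)] arc_length_mono[OF I(1) J I(3)] .
      obtain r where r: "cmod (w I) = r" "1 - ?l I \<le> r" "r < 1 - ?l I / 2" using w[OF I(2)] I(1) by (rule boxE)
      have n: "cmod z \<le> r + cmod (w I - z)" "r \<le> cmod z + cmod (w I - z)"
        using norm_triangle_ineq3[of "w I" z] r(1) by (auto simp: abs_le_iff)
      have "?l I / 4 \<le> 1 - cmod z" using n(1) r(3) I(4) by (simp add: field_simps)
      then show 1: "?l I \<le> 4 * t" unfolding t_def by simp
      have "1 - cmod z \<le> 5/4 * ?l I" using n(2) r(2) I(4) by (simp add: field_simps)
      then show "4/5 * t \<le> ?l I" unfolding t_def by simp
      have b: "cmod (w I - pt I) \<le> 8 * ?l I" by (rule box_near_pt[OF I(1) w[OF I(2)]])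
      have "cmod (pt I - \<zeta>) \<le> cmod (w I - pt I) + cmod (w I - z) + cmod (z - \<zeta>)"
        by (smt (verit) norm_minus_commute norm_triangle_sub norm_triangle_ineq add_diff_eq diff_add_cancel)
      then show "cmod (pt I - \<zeta>) \<le> 34 * t" using b I(4) 1 z\<zeta> by linarith
      have d: "cmod (pt I - pt J) \<le> 7 * ?l J" using node_diameter[OF J] pt_in[OF I(1)] I(3) pt_in[OF J] by blast
      have "cmod (z - pt J) \<le> cmod (w I - z) + cmod (w I - pt I) + cmod (pt I - pt J)"
        by (smt (verit) norm_minus_commute norm_triangle_sub norm_triangle_ineq add_diff_eq diff_add_cancel)
      then show "cmod (z - pt J) \<le> 31/2 * ?l J" using b I(4) d l by linarith
    qed
    have sum_le: "(\<Sum>I\<in>S. ?l I powr p) \<le> 129472 * t powr p"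
    proof -
      \<comment> \<open>All these arcs have length comparable to \<open>t\<close>, so \<open>p\<close> may be traded for the exponent 2, for
        which \<open>sum_powr_near_le\<close> is available.\<close>
      have "(\<Sum>I\<in>S. ?l I powr p) \<le> (\<Sum>I\<in>S. (4/5 * t) powr (p - 2) * ?l I powr (1 + 1))"
      proof (rule sum_mono)
        fix I assume I: "I \<in> S"
        have l: "0 < ?l I" using I S arc_length_pos by auto
        have "?l I powr p = ?l I powr (p - 2) * ?l I powr (1 + 1)" by (simp add: powr_add[symmetric])
        also have "\<dots> \<le> (4/5 * t) powr (p - 2) * ?l I powr (1 + 1)"
          using geo(2)[OF I] t p by (intro mult_right_mono powr_mono2') auto
        finally show "?l I powr p \<le> (4/5 * t) powr (p - 2) * ?l I powr (1 + 1)" .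
      qed
      also have "\<dots> = (4/5 * t) powr (p - 2) * (\<Sum>I\<in>S. ?l I powr (1 + 1))" by (simp only: sum_distrib_left)
      also have "\<dots> \<le> (4/5 * t) powr (p - 2) * (28 / (1 - 2 powr - 1) * (34 * t) powr (1 + 1))"
      proof (intro mult_left_mono sum_powr_near_le[OF _ S \<zeta>(2)])
        fix I assume I: "I \<in> S"
        show "?l I \<le> 34 * t \<and> cmod (pt I - \<zeta>) \<le> 34 * t" using geo[OF I] t by auto
      qed (use t in auto)
      also have "\<dots> = 56 * 1156 * ((4/5 * t) powr (p - 2) * t\<^sup>2)"
        using t by (simp add: powr_minus power_mult_distrib)
      also have "(4/5 * t) powr (p - 2) * t\<^sup>2 = (4/5) powr (p - 2) * t powr p"
      proof -
        have "(4/5 * t) powr (p - 2) = (4/5) powr (p - 2) * t powr (p - 2)"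
          by (rule powr_mult; use t in simp)
        moreover have "t powr p = t powr (p - 2) * t\<^sup>2" using t by (simp add: powr_diff)
        ultimately show ?thesis by (simp only: mult.assoc)
      qed
      also have "56 * 1156 * ((4/5) powr (p - 2) * t powr p) \<le> 56 * 1156 * (2 * t powr p)"
      proof (intro mult_left_mono mult_right_mono)
        have "(4/5::real) powr (p - 2) \<le> (4/5) powr (-2)" using p by (intro powr_mono') auto
        also have "\<dots> \<le> 2" by (simp add: powr_minus power2_eq_square)
        finally show "(4/5::real) powr (p - 2) \<le> 2" .
      qed auto
      finally show ?thesis by simp
    qed
    have key: "16 * (\<Sum>I\<in>S. ?l I powr p) \<le> carleson_const * ?l J powr p * green z (pole J) powr p"
    proof (cases "S = {}")
      case True then show ?thesis by (simp add: carleson_const_def)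
    next
      case False
      then have zJ: "cmod (z - pt J) \<le> 31/2 * ?l J" using geo(4) by auto
      have lJ: "0 < ?l J" by (rule arc_length_pos[OF J])
      have g0: "0 \<le> green z (pole J)" using norm_pole[OF J] z by (intro green_nonneg) auto
      have "t powr p \<le> (1024 * ?l J * green z (pole J)) powr p"
        using green_pole_ge[OF J z zJ za] t p by (intro powr_mono2) (auto simp: t_def)
      also have "\<dots> = 1024 powr p * (?l J powr p * green z (pole J) powr p)"
        using lJ g0 by (simp add: powr_mult)
      also have "\<dots> \<le> 1024 powr 1 * (?l J powr p * green z (pole J) powr p)"
        using p by (intro mult_right_mono powr_mono) auto
      finally have "t powr p \<le> 1024 * (?l J powr p * green z (pole J) powr p)" by simp
      with sum_le show ?thesis by (simp add: carleson_const_def)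
    qed
    have "(\<Sum>I\<in>F'. ennreal (16 * ?l I powr p) * (ennreal ((cmod (deriv f z))\<^sup>2) * indicator (?B I) z))
        = (\<Sum>I\<in>S. ennreal (16 * ?l I powr p * (cmod (deriv f z))\<^sup>2))"
      unfolding S_def using F'(1)
      by (subst sum.inter_filter) (auto intro!: sum.cong simp: ennreal_mult)
    also have "\<dots> = ennreal (\<Sum>I\<in>S. 16 * ?l I powr p * (cmod (deriv f z))\<^sup>2)" by (intro sum_ennreal) auto
    also have "(\<Sum>I\<in>S. 16 * ?l I powr p * (cmod (deriv f z))\<^sup>2) = 16 * (\<Sum>I\<in>S. ?l I powr p) * (cmod (deriv f z))\<^sup>2"
      by (simp add: sum_distrib_left sum_distrib_right)
    also have "ennreal \<dots> \<le> ennreal (carleson_const * ?l J powr p * green z (pole J) powr p * (cmod (deriv f z))\<^sup>2)"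
      by (intro ennreal_leI mult_right_mono key) auto
    also have "\<dots> = ennreal (carleson_const * ?l J powr p) * ennreal ((cmod (deriv f z))\<^sup>2 * green z (pole J) powr p)"
      by (simp add: ennreal_mult[symmetric] carleson_const_def mult_ac)
    finally show "(\<Sum>I\<in>F'. ennreal (16 * ?l I powr p) * (ennreal ((cmod (deriv f z))\<^sup>2) * indicator (?B I) z))
       \<le> ennreal (carleson_const * ?l J powr p) * ennreal ((cmod (deriv f z))\<^sup>2 * green z (pole J) powr p)" .
  qed
  also have "\<dots> = ennreal (carleson_const * ?l J powr p) * (\<integral>\<^sup>+z. ennreal ((cmod (deriv f z))\<^sup>2 * green z (pole J) powr p) \<partial>area_measure)"
    by (rule nn_integral_cmult[OF Qp_integrand_measurable[OF f]])
  also have "\<dots> \<le> ennreal (carleson_const * ?l J powr p) * Qp_seminorm_sq p f"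
    unfolding Qp_seminorm_sq_def using norm_pole[OF J] by (intro mult_left_mono SUP_upper) auto
  finally show ?thesis by (simp add: F'_def)
qed

text \<open>A near maximum suffices and, unlike the supremum, is attained in the box.\<close>

lemma box_near_max:
  assumes f: "f holomorphic_on unit_disc" and I: "I \<in> nodes"
  shows "\<exists>w\<in>upper_half_box I. \<forall>z\<in>upper_half_box I. (cmod (deriv f z))\<^sup>2 \<le> 2 * (cmod (deriv f w))\<^sup>2"
proof -
  let ?g = "\<lambda>z. (cmod (deriv f z))\<^sup>2"
  have l: "0 < arc_length I" "arc_length I \<le> 1" using arc_length_pos[OF I] arc_length_le_1[OF I] .
  have "of_real (1 - arc_length I) * pt I \<in> upper_half_box I"
    unfolding upper_half_box_def
    by (intro CollectI exI[of _ "1 - arc_length I"] exI[of _ "pt I"] conjI refl) (use pt_in[OF I] l in auto)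
  then have ne: "upper_half_box I \<noteq> {}" by blast
  have sub: "upper_half_box I \<subseteq> cball 0 (1 - arc_length I / 2)" using I by (auto elim!: boxE)
  have "cball 0 (1 - arc_length I / 2) \<subseteq> unit_disc" using l by auto
  then have "continuous_on (cball 0 (1 - arc_length I / 2)) ?g"
    by (intro continuous_intros continuous_on_subset[OF holomorphic_on_imp_continuous_on[OF holomorphic_deriv[OF f]]]) auto
  then have "bounded (?g ` cball 0 (1 - arc_length I / 2))"
    by (intro compact_imp_bounded compact_continuous_image) auto
  then have bd: "bdd_above (?g ` upper_half_box I)"
    using sub by (meson bdd_above_mono bounded_imp_bdd_above image_mono)
  define s where "s = (SUP z\<in>upper_half_box I. ?g z)"
  have up: "?g z \<le> s" if "z \<in> upper_half_box I" for z unfolding s_def by (rule cSUP_upper[OF that bd])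
  show ?thesis
  proof (cases "s \<le> 0")
    case True
    obtain w where "w \<in> upper_half_box I" using ne by blast
    moreover have "?g z \<le> 2 * ?g w" if "z \<in> upper_half_box I" for z
      using up[OF that] True zero_le_power2[of "cmod (deriv f w)"] by linarith
    ultimately show ?thesis by blast
  next
    case False
    then have "s / 2 < s" by simp
    then obtain w where w: "w \<in> upper_half_box I" "s / 2 < ?g w"
      using less_cSUP_iff[OF ne bd, of "s / 2", folded s_def] by blast
    have "?g z \<le> 2 * ?g w" if "z \<in> upper_half_box I" for z
      using up[OF that] w(2) by linarith
    then show ?thesis using w(1) by blast
  qed
qed

end

section \<open>The standard dyadic system\<close>

definition standard_arc :: "nat \<Rightarrow> nat \<Rightarrow> complex set" where
  "standard_arc k j = (\<lambda>t. cis (2 * pi * t)) ` {real j / 2 ^ k..<real j / 2 ^ k + 1 / 2 ^ k}"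

lemma cis_turn_inj:
  assumes "cis (2 * pi * s) = cis (2 * pi * t)" "0 \<le> s" "s < 1" "0 \<le> t" "t < 1"
  shows "s = t"
proof -
  from assms(1) obtain m :: int where m: "s = t + m" unfolding cis_turn_eq_iff by blast
  then have "-1 < real_of_int m" "real_of_int m < 1" using assms by linarith+
  then have "m = 0" by linarith
  then show ?thesis using m by simp
qed

lemma mem_standard_arc_iff:
  assumes "0 \<le> \<tau>" "\<tau> < 1" "j < 2 ^ k"
  shows "cis (2 * pi * \<tau>) \<in> standard_arc k j \<longleftrightarrow> real j \<le> \<tau> * 2 ^ k \<and> \<tau> * 2 ^ k < real j + 1"
proof
  assume "cis (2 * pi * \<tau>) \<in> standard_arc k j"
  then obtain t where t: "cis (2 * pi * \<tau>) = cis (2 * pi * t)" "real j / 2 ^ k \<le> t" "t < real j / 2 ^ k + 1 / 2 ^ k"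
    by (auto simp: standard_arc_def)
  have "real j + 1 \<le> 2 ^ k" using assms(3) by (metis Suc_leI of_nat_Suc add.commute of_nat_le_iff of_nat_power of_nat_numeral)
  then have "real j / 2 ^ k + 1 / 2 ^ k \<le> 1" by (simp add: field_simps)
  moreover have "0 \<le> real j / 2 ^ k" by simp
  ultimately have "\<tau> = t" using t assms by (intro cis_turn_inj) linarith+
  then show "real j \<le> \<tau> * 2 ^ k \<and> \<tau> * 2 ^ k < real j + 1" using t by (simp add: field_simps)
next
  assume "real j \<le> \<tau> * 2 ^ k \<and> \<tau> * 2 ^ k < real j + 1"
  then show "cis (2 * pi * \<tau>) \<in> standard_arc k j"
    unfolding standard_arc_def by (intro imageI) (simp add: field_simps)
qed

lemma standard_arc_length: "arc_length (standard_arc k j) = 1 / 2 ^ k"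
  by (rule arc_length_half_open[of _ _ "real j / 2 ^ k"]) (auto simp: standard_arc_def)

lemma standard_arc_nonempty: "standard_arc k j \<noteq> {}"
  by (auto simp: standard_arc_def)

lemma standard_arc_meet:
  assumes "i < 2 ^ k" "j < 2 ^ k" "standard_arc k i \<inter> standard_arc k j \<noteq> {}"
  shows "i = j"
proof -
  obtain z where z: "z \<in> standard_arc k i" "z \<in> standard_arc k j" using assms by blast
  then have "z \<in> unit_circle" by (auto simp: standard_arc_def)
  then obtain \<tau> where \<tau>: "0 \<le> \<tau>" "\<tau> < 1" "z = cis (2 * pi * \<tau>)" by (rule unit_circle_turn)
  have "real i < real j + 1" "real j < real i + 1"
    using z mem_standard_arc_iff[OF \<tau>(1,2) assms(1)] mem_standard_arc_iff[OF \<tau>(1,2) assms(2)] by (auto simp: \<tau>(3))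
  then show ?thesis by linarith
qed

lemma standard_arcs_cover: "z \<in> unit_circle \<Longrightarrow> \<exists>j<2 ^ k. z \<in> standard_arc k j"
proof -
  assume "z \<in> unit_circle"
  then obtain \<tau> where \<tau>: "0 \<le> \<tau>" "\<tau> < 1" "z = cis (2 * pi * \<tau>)" by (rule unit_circle_turn)
  define j where "j = nat \<lfloor>\<tau> * 2 ^ k\<rfloor>"
  have j: "real j \<le> \<tau> * 2 ^ k" "\<tau> * 2 ^ k < real j + 1"
    using \<tau> by (simp_all add: j_def)
  have "\<tau> * 2 ^ k < 2 ^ k" using \<tau> by simp
  then have "real j < 2 ^ k" using j(1) by linarith
  then have "real j < real (2 ^ k)" by simp
  then have jk: "j < 2 ^ k" by (simp only: of_nat_less_iff)
  show ?thesis using mem_standard_arc_iff[OF \<tau>(1,2) jk] j jk \<tau>(3) by blast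
qed

lemma standard_arc_subset_circle: "standard_arc k j \<subseteq> unit_circle"
  by (auto simp: standard_arc_def)

lemma dyadic_levels_standard: "dyadic_levels (\<lambda>k. standard_arc k ` {..<2 ^ k})"
proof
  show "standard_arc 0 ` {..<2 ^ 0} = {unit_circle}"
    using standard_arcs_cover[of _ 0] standard_arc_subset_circle[of 0 0] by (auto simp: lessThan_Suc)
  fix k
  show "partition_on unit_circle (standard_arc k ` {..<2 ^ k})"
  proof (rule partition_onI)
    show "\<Union> (standard_arc k ` {..<2 ^ k}) = unit_circle"
      using standard_arcs_cover[of _ k] standard_arc_subset_circle[of k] by fastforce
    show "{} \<notin> standard_arc k ` {..<2 ^ k}"
      using standard_arc_nonempty[of k] by auto
    show "disjnt p q" if "p \<in> standard_arc k ` {..<2 ^ k}" "q \<in> standard_arc k ` {..<2 ^ k}" "p \<noteq> q" for p q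
      using that standard_arc_meet[of _ k] by (auto simp: disjnt_def)
  qed
  have "inj_on (standard_arc k) {..<2 ^ k}"
  proof (rule inj_onI)
    fix i j assume "i \<in> {..<2 ^ k :: nat}" "j \<in> {..<2 ^ k :: nat}" "standard_arc k i = standard_arc k j"
    then show "i = j" using standard_arc_meet[of i k j] standard_arc_nonempty[of k j] by simp
  qed
  then show "card (standard_arc k ` {..<2 ^ k}) = 2 ^ k" by (simp add: card_image)
  show "half_open_arc I" if I: "I \<in> standard_arc k ` {..<2 ^ k}" for I
  proof -
    obtain j where j: "I = standard_arc k j" using I by auto
    show ?thesis unfolding half_open_arc_def j
      by (rule exI[of _ "real j / 2 ^ k"], rule exI[of _ "1 / 2 ^ k"]) (auto simp: standard_arc_def)
  qed
  show "arc_length I = 1 / 2 ^ k" if "I \<in> standard_arc k ` {..<2 ^ k}" for I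
    using that standard_arc_length by auto
  show "\<exists>I\<in>standard_arc k ` {..<2 ^ k}. J \<subseteq> I" if J: "J \<in> standard_arc (Suc k) ` {..<2 ^ Suc k}" for J
  proof -
    obtain j where j: "j < 2 ^ Suc k" "J = standard_arc (Suc k) j" using J by auto
    have jk: "j div 2 < 2 ^ k" using j by simp
    have n: "2 * (j div 2) \<le> j" "j + 1 \<le> 2 * (j div 2 + 1)" by presburger+
    have jj: "2 * real (j div 2) \<le> real j" "real j + 1 \<le> 2 * (real (j div 2) + 1)"
      using of_nat_mono[OF n(1), where 'a=real] of_nat_mono[OF n(2), where 'a=real]
      by (simp_all only: of_nat_mult of_nat_add of_nat_numeral of_nat_1)
    have "J \<subseteq> standard_arc k (j div 2)"
      unfolding j(2) standard_arc_def
    proof (rule image_mono, rule subsetI)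
      fix t assume "t \<in> {real j / 2 ^ Suc k..<real j / 2 ^ Suc k + 1 / 2 ^ Suc k}"
      then have "real j \<le> t * 2 ^ Suc k" "t * 2 ^ Suc k < real j + 1" by (simp_all add: field_simps)
      then have "real (j div 2) \<le> t * 2 ^ k" "t * 2 ^ k < real (j div 2) + 1" using jj by simp_all
      then show "t \<in> {real (j div 2) / 2 ^ k..<real (j div 2) / 2 ^ k + 1 / 2 ^ k}"
        by (simp add: field_simps)
    qed
    then show ?thesis using jk by blast
  qed
qed

lemma dyadic_systemE:
  assumes "dyadic_system \<D>"
  obtains D where "dyadic_levels D" "\<D> = dyadic_levels.nodes D"
proof -
  from assms obtain D where D: "\<D> = (\<Union>k. D k)" and D0: "D 0 = {unit_circle}"
    and lev: "\<forall>k. partition_on unit_circle (D k) \<and> card (D k) = 2 ^ k \<and>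
             (\<forall>I\<in>D k. half_open_arc I \<and> arc_length I = 1 / 2 ^ k)"
    and nest: "\<forall>k. \<forall>J\<in>D (Suc k). \<exists>I\<in>D k. J \<subseteq> I"
    unfolding dyadic_system_def by (elim exE conjE)
  have "dyadic_levels D"
  proof
    show "D 0 = {unit_circle}" by (rule D0)
    show "partition_on unit_circle (D k)" "card (D k) = 2 ^ k" for k using lev by simp_all
    show "half_open_arc I" "arc_length I = 1 / 2 ^ k" if "I \<in> D k" for I k using lev that by simp_all
    show "\<exists>I\<in>D k. J \<subseteq> I" if "J \<in> D (Suc k)" for J k using nest that by simp
  qed
  then show ?thesis using D by (intro that[of D]) (simp_all add: dyadic_levels.nodes_def)
qed

lemma (in dyadic_levels) dyadic_system_nodes: "dyadic_system nodes"
  unfolding dyadic_system_def nodes_def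
  by (intro exI[of _ D] conjI allI ballI refl)
     (rule level_0 partition card_level | erule arc arc_length_level nested)+

section \<open>Tail estimates from the gauge\<close>

context dyadic_levels
begin

text \<open>The easy half of the duality: if \<open>(\<Sum>J \<supseteq> I. c J) \<ge> h I\<close>, then \<open>\<Sum>I. m I * h I\<close> is at most
  \<open>\<Sum>J. c J * (\<Sum>I \<subseteq> J. m I)\<close>, and the inner sums are bounded by \<open>Qp_carleson_boxes\<close>.\<close>

lemma derivative_integral_le_of_gauge_less:
  assumes p: "0 < p" "p \<le> 1" and f: "f holomorphic_on unit_disc"
    and V: "(\<lambda>z. ennreal (V z)) \<in> borel_measurable area_measure"
    and gauge: "dyadic_gauge p nodes (box_average p V) < e"
  shows "(\<integral>\<^sup>+z. ennreal ((cmod (deriv f z))\<^sup>2) * ennreal (V z) \<partial>area_measure)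
    \<le> ennreal (2 * carleson_const) * Qp_seminorm_sq p f * e"
proof -
  let ?l = arc_length
  define S where "S = Qp_seminorm_sq p f"
  from gauge obtain c :: "complex set \<Rightarrow> real" where c: "\<And>J. J \<in> nodes \<Longrightarrow> 0 \<le> c J"
    "\<And>I. I \<in> nodes \<Longrightarrow> box_average p V I \<le> (\<Sum>\<^sub>\<infinity>J\<in>{J \<in> nodes. I \<subseteq> J}. ennreal (c J))"
    "(\<Sum>\<^sub>\<infinity>J\<in>nodes. ennreal (c J * ?l J powr p)) < e"
    unfolding dyadic_gauge_def Inf_less_iff by blast
  from box_near_max[OF f] obtain w where w: "\<And>I. I \<in> nodes \<Longrightarrow> w I \<in> upper_half_box I"
    "\<And>I z. I \<in> nodes \<Longrightarrow> z \<in> upper_half_box I \<Longrightarrow> (cmod (deriv f z))\<^sup>2 \<le> 2 * (cmod (deriv f (w I)))\<^sup>2"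
    by metis
  define m where "m I = ennreal (?l I powr (p + 2) * (cmod (deriv f (w I)))\<^sup>2)" for I
  note [measurable] = deriv_measurable[OF f] V
  have "(\<integral>\<^sup>+z. ennreal ((cmod (deriv f z))\<^sup>2) * ennreal (V z) \<partial>area_measure) \<le> 2 * ennreal carleson_const * S * e"
  proof (rule nn_integral_le_of_box_sums)
    show "(\<lambda>z. ennreal ((cmod (deriv f z))\<^sup>2) * ennreal (V z)) \<in> borel_measurable area_measure" by measurable
    fix F assume F: "finite F" "F \<subseteq> nodes"
    define A where "A = (\<Union>I\<in>F. {J \<in> nodes. I \<subseteq> J})"
    have A: "finite A" "A \<subseteq> nodes" using F finite_ancestors by (auto simp: A_def)
    have one: "(\<integral>\<^sup>+z. ennreal ((cmod (deriv f z))\<^sup>2) * ennreal (V z) * indicator (upper_half_box I) z \<partial>area_measure)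
        \<le> 2 * (m I * (\<Sum>J\<in>{J \<in> A. I \<subseteq> J}. ennreal (c J)))" if "I \<in> F" for I
    proof -
      have I: "I \<in> nodes" using that F by auto
      have l: "0 < ?l I powr (p + 2)" using arc_length_pos[OF I] by simp
      note [measurable] = box_sets[OF I]
      have "(\<integral>\<^sup>+z. ennreal ((cmod (deriv f z))\<^sup>2) * ennreal (V z) * indicator (upper_half_box I) z \<partial>area_measure)
        \<le> (\<integral>\<^sup>+z. ennreal (2 * (cmod (deriv f (w I)))\<^sup>2) * (ennreal (V z) * indicator (upper_half_box I) z) \<partial>area_measure)"
      proof (rule nn_integral_mono)
        fix z
        show "ennreal ((cmod (deriv f z))\<^sup>2) * ennreal (V z) * indicator (upper_half_box I) z
          \<le> ennreal (2 * (cmod (deriv f (w I)))\<^sup>2) * (ennreal (V z) * indicator (upper_half_box I) z)"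
          using w(2)[OF I, of z] by (cases "z \<in> upper_half_box I") (auto intro!: mult_right_mono ennreal_leI)
      qed
      also have "\<dots> = ennreal (2 * (cmod (deriv f (w I)))\<^sup>2) * (\<integral>\<^sup>+z. ennreal (V z) * indicator (upper_half_box I) z \<partial>area_measure)"
        by (rule nn_integral_cmult) measurable
      also have "(\<integral>\<^sup>+z. ennreal (V z) * indicator (upper_half_box I) z \<partial>area_measure) = ennreal (?l I powr (p + 2)) * box_average p V I"
        unfolding box_average_def using l
        by (subst ennreal_times_divide, subst mult.commute, subst ennreal_mult_divide_eq) auto
      also have "ennreal (2 * (cmod (deriv f (w I)))\<^sup>2) * (ennreal (?l I powr (p + 2)) * box_average p V I) = 2 * (m I * box_average p V I)"
        using l by (simp add: m_def ennreal_mult mult_ac)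
      also have "\<dots> \<le> 2 * (m I * (\<Sum>J\<in>{J \<in> A. I \<subseteq> J}. ennreal (c J)))"
      proof (intro mult_left_mono)
        have "{J \<in> nodes. I \<subseteq> J} = {J \<in> A. I \<subseteq> J}" using that A by (auto simp: A_def)
        then show "box_average p V I \<le> (\<Sum>J\<in>{J \<in> A. I \<subseteq> J}. ennreal (c J))"
          using c(2)[OF I] finite_ancestors[OF I] by simp
      qed auto
      finally show ?thesis .
    qed
    have "(\<Sum>I\<in>F. \<integral>\<^sup>+z. ennreal ((cmod (deriv f z))\<^sup>2) * ennreal (V z) * indicator (upper_half_box I) z \<partial>area_measure)
        \<le> (\<Sum>I\<in>F. 2 * (m I * (\<Sum>J\<in>{J \<in> A. I \<subseteq> J}. ennreal (c J))))"
      by (intro sum_mono one)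
    also have "\<dots> = 2 * (\<Sum>I\<in>F. \<Sum>J\<in>A. if I \<subseteq> J then m I * ennreal (c J) else 0)"
      using A(1) by (simp only: sum_distrib_left[symmetric] sum.inter_filter) (simp add: sum_distrib_left if_distrib cong: if_cong)
    also have "(\<Sum>I\<in>F. \<Sum>J\<in>A. if I \<subseteq> J then m I * ennreal (c J) else 0) = (\<Sum>J\<in>A. \<Sum>I\<in>F. if I \<subseteq> J then m I * ennreal (c J) else 0)"
      by (rule sum.swap)
    also have "\<dots> = (\<Sum>J\<in>A. ennreal (c J) * (\<Sum>I | I \<in> F \<and> I \<subseteq> J. m I))"
      using F(1) by (auto intro!: sum.cong simp: sum.inter_filter sum_distrib_left mult.commute)
    also have "\<dots> \<le> (\<Sum>J\<in>A. ennreal (c J) * (ennreal (carleson_const * ?l J powr p) * S))"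
      unfolding S_def m_def using A w(1) F by (intro sum_mono mult_left_mono Qp_carleson_boxes p f) auto
    also have "\<dots> = (\<Sum>J\<in>A. ennreal carleson_const * S * ennreal (c J * ?l J powr p))"
      using A c(1) by (intro sum.cong refl) (auto simp: ennreal_mult carleson_const_def mult_ac)
    also have "\<dots> = ennreal carleson_const * S * (\<Sum>J\<in>A. ennreal (c J * ?l J powr p))"
      by (simp only: sum_distrib_left)
    also have "\<dots> \<le> ennreal carleson_const * S * e"
    proof (rule mult_left_mono)
      have "(\<Sum>J\<in>A. ennreal (c J * ?l J powr p)) = (\<Sum>\<^sub>\<infinity>J\<in>A. ennreal (c J * ?l J powr p))"
        using A by simp
      also have "\<dots> \<le> (\<Sum>\<^sub>\<infinity>J\<in>nodes. ennreal (c J * ?l J powr p))"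
        by (rule infsum_mono_neutral) (use A in \<open>auto intro: nonneg_summable_on_complete\<close>)
      also have "\<dots> \<le> e" using c(3) by simp
      finally show "(\<Sum>J\<in>A. ennreal (c J * ?l J powr p)) \<le> e" .
    qed simp
    finally show "(\<Sum>I\<in>F. \<integral>\<^sup>+z. ennreal ((cmod (deriv f z))\<^sup>2) * ennreal (V z) * indicator (upper_half_box I) z \<partial>area_measure)
        \<le> 2 * ennreal carleson_const * S * e" by (simp add: mult.assoc mult_left_mono)
  qed
  then show ?thesis by (simp add: S_def carleson_const_def ennreal_mult)
qed

end

lemma dyadic_gauge_cong:
  assumes "\<And>I. I \<in> \<D> \<Longrightarrow> h I = h' I" shows "dyadic_gauge p \<D> h = dyadic_gauge p \<D> h'"
  unfolding dyadic_gauge_def using assms by simp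

text \<open>The member \<open>a = 0\<close> of the supremum that defines the seminorm bounds \<open>f'\<close> on compact sets,
  because \<open>green w 0 \<ge> (1 - \<bar>w\<bar>) / 2\<close>.\<close>

lemma Qp_derivative_bound:
  assumes p: "0 < p" and f: "f holomorphic_on unit_disc" and R: "0 \<le> R" "R < 1" and z: "cmod z \<le> R"
  shows "ennreal ((cmod (deriv f z))\<^sup>2) \<le> ennreal (1 / (((1 - R) / 2)\<^sup>2 * ((1 - R) / 4) powr p)) * Qp_seminorm_sq p f"
proof -
  define \<delta> where "\<delta> = (1 - R) / 2"
  have \<delta>: "0 < \<delta>" "cmod z + \<delta> < 1" using R z by (auto simp: \<delta>_def field_simps)
  have z0: "(0::complex) \<in> unit_disc" by simp
  have "ennreal ((cmod (deriv f z))\<^sup>2 * \<delta>\<^sup>2) \<le> (\<integral>\<^sup>+w. ennreal ((cmod (deriv f w))\<^sup>2) * indicator (ball z \<delta>) w \<partial>area_measure)"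
    by (intro norm_sq_le_area_integral holomorphic_deriv f \<delta>) auto
  also have "\<dots> \<le> (\<integral>\<^sup>+w. ennreal (1 / (\<delta> / 2) powr p) * ennreal ((cmod (deriv f w))\<^sup>2 * green w 0 powr p) \<partial>area_measure)"
  proof (rule nn_integral_mono_AE, rule AE_mp[OF AE_area_neq[of 0]], rule AE_I2, rule impI)
    fix w assume "w \<in> space area_measure" "w \<noteq> 0"
    then have w: "w \<in> unit_disc" by simp
    show "ennreal ((cmod (deriv f w))\<^sup>2) * indicator (ball z \<delta>) w \<le> ennreal (1 / (\<delta> / 2) powr p) * ennreal ((cmod (deriv f w))\<^sup>2 * green w 0 powr p)"
    proof (cases "w \<in> ball z \<delta>")
      case True
      have "cmod w < R + \<delta>" using True z norm_triangle_ineq[of z "w - z"] by (simp add: dist_norm norm_minus_commute)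
      then have "\<delta> \<le> 1 - cmod w" by (simp add: \<delta>_def field_simps)
      also have "\<dots> \<le> 1 - (cmod w)\<^sup>2" using w by (simp add: power2_eq_square mult_left_le)
      also have "\<dots> \<le> 2 * green w 0" using green_ge[OF z0 w \<open>w \<noteq> 0\<close>] by (simp add: disc_involution_def)
      finally have "(\<delta> / 2) powr p \<le> green w 0 powr p" using \<delta> p by (intro powr_mono2) auto
      then have "1 \<le> 1 / (\<delta> / 2) powr p * green w 0 powr p" using \<delta> by simp
      then have "(cmod (deriv f w))\<^sup>2 * 1 \<le> (cmod (deriv f w))\<^sup>2 * (1 / (\<delta> / 2) powr p * green w 0 powr p)"
        by (intro mult_left_mono) auto
      then have "ennreal ((cmod (deriv f w))\<^sup>2) \<le> ennreal (1 / (\<delta> / 2) powr p * ((cmod (deriv f w))\<^sup>2 * green w 0 powr p))"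
        by (intro ennreal_leI) (simp only: mult_ac mult_1_right)
      also have "\<dots> = ennreal (1 / (\<delta> / 2) powr p) * ennreal ((cmod (deriv f w))\<^sup>2 * green w 0 powr p)"
        by (rule ennreal_mult) auto
      finally show ?thesis using True by simp
    qed simp
  qed
  also have "\<dots> = ennreal (1 / (\<delta> / 2) powr p) * (\<integral>\<^sup>+w. ennreal ((cmod (deriv f w))\<^sup>2 * green w 0 powr p) \<partial>area_measure)"
    by (rule nn_integral_cmult[OF Qp_integrand_measurable[OF f]])
  also have "\<dots> \<le> ennreal (1 / (\<delta> / 2) powr p) * Qp_seminorm_sq p f"
    unfolding Qp_seminorm_sq_def by (intro mult_left_mono SUP_upper) auto
  finally have "ennreal (1 / \<delta>\<^sup>2) * ennreal ((cmod (deriv f z))\<^sup>2 * \<delta>\<^sup>2) \<le> ennreal (1 / \<delta>\<^sup>2) * (ennreal (1 / (\<delta> / 2) powr p) * Qp_seminorm_sq p f)"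
    by (intro mult_left_mono) auto
  moreover have "ennreal (1 / \<delta>\<^sup>2) * ennreal ((cmod (deriv f z))\<^sup>2 * \<delta>\<^sup>2) = ennreal ((cmod (deriv f z))\<^sup>2)"
    using \<delta> by (subst ennreal_mult[symmetric]) auto
  moreover have "ennreal (1 / \<delta>\<^sup>2) * (ennreal (1 / (\<delta> / 2) powr p) * Qp_seminorm_sq p f) = ennreal (1 / (\<delta>\<^sup>2 * (\<delta> / 2) powr p)) * Qp_seminorm_sq p f"
    by (simp add: mult.assoc[symmetric] ennreal_mult[symmetric])
  ultimately show ?thesis by (simp add: \<delta>_def)
qed

section \<open>Choice of signs\<close>

text \<open>By the parallelogram law, one of \<open>g + u\<close> and \<open>g - u\<close> has a square integral at least the sum of those of
  \<open>g\<close> and \<open>u\<close>; the signs are chosen one after the other.\<close>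

lemma exists_signs:
  fixes u :: "'i \<Rightarrow> complex \<Rightarrow> complex"
  assumes F: "finite F" and u: "\<And>i. i \<in> F \<Longrightarrow> u i \<in> borel_measurable M" and V: "V \<in> borel_measurable M"
  shows "\<exists>\<epsilon> :: 'i \<Rightarrow> real. (\<forall>i. \<epsilon> i = 1 \<or> \<epsilon> i = -1) \<and>
    (\<Sum>i\<in>F. \<integral>\<^sup>+z. ennreal ((cmod (u i z))\<^sup>2) * V z \<partial>M) \<le>
    (\<integral>\<^sup>+z. ennreal ((cmod (\<Sum>i\<in>F. of_real (\<epsilon> i) * u i z))\<^sup>2) * V z \<partial>M)"
  using F u
proof (induction F rule: finite_induct)
  case empty
  show ?case by (intro exI[of _ "\<lambda>_. 1"]) auto
next
  case (insert j F)
  then obtain \<epsilon> :: "'i \<Rightarrow> real" where \<epsilon>: "\<And>i. \<epsilon> i = 1 \<or> \<epsilon> i = -1"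
    "(\<Sum>i\<in>F. \<integral>\<^sup>+z. ennreal ((cmod (u i z))\<^sup>2) * V z \<partial>M) \<le>
     (\<integral>\<^sup>+z. ennreal ((cmod (\<Sum>i\<in>F. of_real (\<epsilon> i) * u i z))\<^sup>2) * V z \<partial>M)" by auto
  define g where "g z = (\<Sum>i\<in>F. of_real (\<epsilon> i) * u i z)" for z
  have [measurable]: "u j \<in> borel_measurable M" "V \<in> borel_measurable M" "g \<in> borel_measurable M"
    unfolding g_def[abs_def] using insert.prems V by (auto intro!: borel_measurable_sum borel_measurable_times)
  let ?N = "\<lambda>h. \<integral>\<^sup>+z. ennreal ((cmod (h z))\<^sup>2) * V z \<partial>M"
  have par: "(cmod (a + b))\<^sup>2 + (cmod (a - b))\<^sup>2 = 2 * (cmod a)\<^sup>2 + 2 * (cmod b)\<^sup>2" for a b :: complex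
    unfolding cmod_power2 by (simp add: power2_eq_square algebra_simps)
  have "?N (\<lambda>z. g z + u j z) + ?N (\<lambda>z. g z - u j z)
     = (\<integral>\<^sup>+z. ennreal ((cmod (g z + u j z))\<^sup>2) * V z + ennreal ((cmod (g z - u j z))\<^sup>2) * V z \<partial>M)"
    by (rule nn_integral_add[symmetric]) measurable
  also have "\<dots> = (\<integral>\<^sup>+z. 2 * (ennreal ((cmod (g z))\<^sup>2) * V z + ennreal ((cmod (u j z))\<^sup>2) * V z) \<partial>M)"
  proof (intro nn_integral_cong)
    fix z
    have "ennreal ((cmod (g z + u j z))\<^sup>2) + ennreal ((cmod (g z - u j z))\<^sup>2) = 2 * (ennreal ((cmod (g z))\<^sup>2) + ennreal ((cmod (u j z))\<^sup>2))"
      by (simp add: ennreal_plus[symmetric] par ennreal_mult distrib_left del: ennreal_plus)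
         (simp add: ennreal_mult)
    then show "ennreal ((cmod (g z + u j z))\<^sup>2) * V z + ennreal ((cmod (g z - u j z))\<^sup>2) * V z =
       2 * (ennreal ((cmod (g z))\<^sup>2) * V z + ennreal ((cmod (u j z))\<^sup>2) * V z)"
      by (metis distrib_right mult.assoc)
  qed
  also have "\<dots> = 2 * (?N g + ?N (u j))"
    by (simp add: nn_integral_cmult nn_integral_add)
  finally have sum2: "2 * (?N g + ?N (u j)) = ?N (\<lambda>z. g z + u j z) + ?N (\<lambda>z. g z - u j z)" by simp
  obtain s :: real where s: "s = 1 \<or> s = -1" "?N g + ?N (u j) \<le> ?N (\<lambda>z. g z + of_real s * u j z)"
  proof (cases "?N (\<lambda>z. g z + u j z) \<le> ?N (\<lambda>z. g z - u j z)")
    case True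
    then have "2 * (?N g + ?N (u j)) \<le> 2 * ?N (\<lambda>z. g z - u j z)"
      unfolding sum2 by (simp add: mult_2 add_right_mono)
    then have "?N g + ?N (u j) \<le> ?N (\<lambda>z. g z - u j z)"
      by (subst (asm) ennreal_mult_le_mult_iff) auto
    then show ?thesis by (intro that[of "-1"]) auto
  next
    case False
    then have "2 * (?N g + ?N (u j)) \<le> 2 * ?N (\<lambda>z. g z + u j z)"
      unfolding sum2 by (simp add: mult_2 add_left_mono)
    then have "?N g + ?N (u j) \<le> ?N (\<lambda>z. g z + u j z)"
      by (subst (asm) ennreal_mult_le_mult_iff) auto
    then show ?thesis by (intro that[of 1]) auto
  qed
  define \<epsilon>' where "\<epsilon>' = \<epsilon>(j := s)"
  have "(\<Sum>i\<in>insert j F. of_real (\<epsilon>' i) * u i z) = g z + of_real s * u j z" for z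
  proof -
    have "(\<Sum>i\<in>F. of_real (\<epsilon>' i) * u i z) = g z"
      unfolding g_def using insert.hyps by (intro sum.cong refl) (auto simp: \<epsilon>'_def)
    then show ?thesis using insert.hyps by (simp add: \<epsilon>'_def add.commute)
  qed
  moreover have "(\<Sum>i\<in>insert j F. ?N (u i)) \<le> ?N g + ?N (u j)"
    using insert.hyps \<epsilon>(2) by (simp add: g_def[symmetric] add.commute add_left_mono)
  ultimately have "(\<Sum>i\<in>insert j F. ?N (u i)) \<le> ?N (\<lambda>z. \<Sum>i\<in>insert j F. of_real (\<epsilon>' i) * u i z)"
    using s(2) by (simp only:)
  moreover have "\<forall>i. \<epsilon>' i = 1 \<or> \<epsilon>' i = -1" using \<epsilon>(1) s(1) by (auto simp: \<epsilon>'_def)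
  ultimately show ?case by blast
qed

section \<open>Weighted square integrals\<close>

lemma tendsto_0_ennrealI:
  fixes X :: "'a \<Rightarrow> ennreal"
  assumes "\<And>\<eta>::real. 0 < \<eta> \<Longrightarrow> eventually (\<lambda>k. X k \<le> ennreal \<eta>) F"
  shows "(X \<longlongrightarrow> 0) F"
proof (rule order_tendstoI)
  fix a :: ennreal assume "0 < a"
  then obtain y where y: "0 < y" "y < a" using dense by blast
  then have "y < top" by (meson less_le_trans top_greatest)
  then have "ennreal (enn2real y) = y" by simp
  moreover have "0 < enn2real y" using y \<open>y < top\<close> by (simp add: enn2real_positive_iff)
  ultimately show "eventually (\<lambda>k. X k < a) F"
    using eventually_mono[OF assms[of "enn2real y"]] y by (metis order_le_less_trans)
qed simp

definition sq_integral :: "(complex \<Rightarrow> real) \<Rightarrow> (complex \<Rightarrow> complex) \<Rightarrow> ennreal" where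
  "sq_integral V g = (\<integral>\<^sup>+z. ennreal ((cmod (g z))\<^sup>2) * ennreal (V z) \<partial>area_measure)"

lemma sq_integral_mono:
  assumes "\<And>z. z \<in> unit_disc \<Longrightarrow> V z \<le> V' z"
  shows "sq_integral V g \<le> sq_integral V' g"
  unfolding sq_integral_def using assms by (intro nn_integral_mono mult_left_mono ennreal_leI) auto

lemma sq_integral_cong:
  assumes "\<And>z. z \<in> unit_disc \<Longrightarrow> g z = g' z"
  shows "sq_integral V g = sq_integral V g'"
  unfolding sq_integral_def using assms by (intro nn_integral_cong) simp

lemma norm_diff_sq_le: "(cmod (a - b))\<^sup>2 \<le> 2 * (cmod a)\<^sup>2 + 2 * (cmod b)\<^sup>2"
proof -
  have "(cmod (a - b))\<^sup>2 \<le> (cmod a + cmod b)\<^sup>2" by (intro power_mono norm_triangle_ineq4) auto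
  also have "\<dots> \<le> 2 * (cmod a)\<^sup>2 + 2 * (cmod b)\<^sup>2"
    using zero_le_power2[of "cmod a - cmod b"] by (simp add: power2_eq_square algebra_simps)
  finally show ?thesis .
qed

lemma sq_integral_diff_le:
  assumes [measurable]: "f \<in> borel_measurable area_measure" "g \<in> borel_measurable area_measure"
    "V \<in> borel_measurable area_measure"
  shows "sq_integral V (\<lambda>z. f z - g z) \<le> 2 * sq_integral V f + 2 * sq_integral V g"
proof -
  have "sq_integral V (\<lambda>z. f z - g z) \<le>
      (\<integral>\<^sup>+z. 2 * (ennreal ((cmod (f z))\<^sup>2) * ennreal (V z)) + 2 * (ennreal ((cmod (g z))\<^sup>2) * ennreal (V z)) \<partial>area_measure)"
    unfolding sq_integral_def
  proof (rule nn_integral_mono)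
    fix z
    have "ennreal ((cmod (f z - g z))\<^sup>2) \<le> ennreal (2 * (cmod (f z))\<^sup>2 + 2 * (cmod (g z))\<^sup>2)"
      by (intro ennreal_leI norm_diff_sq_le)
    also have "\<dots> = 2 * ennreal ((cmod (f z))\<^sup>2) + 2 * ennreal ((cmod (g z))\<^sup>2)"
      by (simp add: ennreal_plus ennreal_mult)
    finally have "ennreal ((cmod (f z - g z))\<^sup>2) * ennreal (V z) \<le> (2 * ennreal ((cmod (f z))\<^sup>2) + 2 * ennreal ((cmod (g z))\<^sup>2)) * ennreal (V z)"
      by (rule mult_right_mono) simp
    then show "ennreal ((cmod (f z - g z))\<^sup>2) * ennreal (V z) \<le> 2 * (ennreal ((cmod (f z))\<^sup>2) * ennreal (V z)) + 2 * (ennreal ((cmod (g z))\<^sup>2) * ennreal (V z))"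
      by (simp only: distrib_right mult.assoc)
  qed
  also have "\<dots> = 2 * sq_integral V f + 2 * sq_integral V g"
    unfolding sq_integral_def by (subst nn_integral_add) (simp_all add: nn_integral_cmult)
  finally show ?thesis .
qed

lemma truncated_weight_measurable:
  assumes "V \<in> borel_measurable area_measure"
  shows "truncated_weight \<rho> V \<in> borel_measurable area_measure"
proof -
  have "{z::complex. cmod z > \<rho>} \<in> sets borel" by measurable
  then have "(indicator {z. cmod z > \<rho>} :: complex \<Rightarrow> real) \<in> borel_measurable area_measure"
    by (intro borel_imp_measurable_area borel_measurable_indicator)
  then show ?thesis unfolding truncated_weight_def[abs_def] using assms by (rule borel_measurable_times[rotated])
qed

lemma tilde_weight_measurable:
  assumes "W \<in> borel_measurable area_measure"
  shows "tilde_weight W \<in> borel_measurable area_measure"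
proof -
  have "(\<lambda>z. (1 - cmod z)\<^sup>2) \<in> borel_measurable area_measure"
    by (intro continuous_imp_measurable_area continuous_intros)
  then show ?thesis unfolding tilde_weight_def[abs_def] using assms by (rule borel_measurable_times)
qed

lemma sq_integral_truncated_tendsto_0:
  assumes V: "V \<in> borel_measurable area_measure" and g: "g \<in> borel_measurable area_measure"
    and fin: "sq_integral V g < \<infinity>" and V0: "\<And>z. z \<in> unit_disc \<Longrightarrow> 0 \<le> V z"
    and \<rho>: "\<rho> \<longlonglongrightarrow> 1"
  shows "(\<lambda>n. sq_integral (truncated_weight (\<rho> n) V) g) \<longlonglongrightarrow> 0"
proof -
  note [measurable] = V g truncated_weight_measurable[OF V]
  have "(\<lambda>n. \<integral>\<^sup>+z. ennreal ((cmod (g z))\<^sup>2) * ennreal (truncated_weight (\<rho> n) V z) \<partial>area_measure)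
      \<longlonglongrightarrow> (\<integral>\<^sup>+z. 0 \<partial>area_measure)"
  proof (rule nn_integral_dominated_convergence[where w="\<lambda>z. ennreal ((cmod (g z))\<^sup>2) * ennreal (V z)"])
    show "AE z in area_measure. ennreal ((cmod (g z))\<^sup>2) * ennreal (truncated_weight (\<rho> j) V z) \<le> ennreal ((cmod (g z))\<^sup>2) * ennreal (V z)" for j
      by (intro AE_I2 mult_left_mono ennreal_leI) (auto simp: truncated_weight_def indicator_def V0)
    show "(\<integral>\<^sup>+z. ennreal ((cmod (g z))\<^sup>2) * ennreal (V z) \<partial>area_measure) < \<infinity>"
      using fin by (simp add: sq_integral_def)
    show "AE z in area_measure. (\<lambda>i. ennreal ((cmod (g z))\<^sup>2) * ennreal (truncated_weight (\<rho> i) V z)) \<longlonglongrightarrow> 0"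
    proof (intro AE_I2)
      fix z assume "z \<in> space area_measure"
      then have "cmod z < 1" by simp
      then have "eventually (\<lambda>n. cmod z < \<rho> n) sequentially" using \<rho> by (rule order_tendstoD(1)[rotated])
      then show "(\<lambda>i. ennreal ((cmod (g z))\<^sup>2) * ennreal (truncated_weight (\<rho> i) V z)) \<longlonglongrightarrow> 0"
      proof (rule tendsto_eventually[OF eventually_mono])
        show "ennreal ((cmod (g z))\<^sup>2) * ennreal (truncated_weight (\<rho> i) V z) = 0" if "cmod z < \<rho> i" for i
          using that by (simp add: truncated_weight_def)
      qed
    qed
  qed measurable
  then show ?thesis by (simp add: sq_integral_def)
qed

lemma nn_integral_weighted_area:
  assumes W: "W \<in> borel_measurable area_measure" and g: "g \<in> borel_measurable area_measure"
  shows "(\<integral>\<^sup>+z. ennreal ((cmod (g z))\<^sup>2) \<partial>weighted_area W) = sq_integral W g"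
proof -
  note [measurable] = W g
  show ?thesis unfolding weighted_area_def sq_integral_def
    by (subst nn_integral_density) (auto simp: mult.commute)
qed

lemma L2_space_iff:
  assumes W: "W \<in> borel_measurable area_measure"
  shows "g \<in> L2_space (weighted_area W) \<longleftrightarrow> g \<in> borel_measurable area_measure \<and> sq_integral W g < \<infinity>"
proof -
  have "g \<in> borel_measurable (weighted_area W) \<longleftrightarrow> g \<in> borel_measurable area_measure"
    by (simp add: weighted_area_def)
  then show ?thesis using nn_integral_weighted_area[OF W, of g] by (auto simp: L2_space_def)
qed

lemma L2_norm_weighted_area:
  assumes "W \<in> borel_measurable area_measure" "g \<in> borel_measurable area_measure"
  shows "L2_norm (weighted_area W) g = sqrt (enn2real (sq_integral W g))"
  using nn_integral_weighted_area[OF assms] by (simp add: L2_norm_def)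

lemma holomorphic_measurable: "f holomorphic_on unit_disc \<Longrightarrow> f \<in> borel_measurable area_measure"
  by (intro continuous_imp_measurable_area holomorphic_on_imp_continuous_on)

text \<open>The case \<open>n = 1\<close>, \<open>q = 2\<close> of the Littlewood-Paley condition. Applied to the constant
  function 1, it shows that the weight is integrable.\<close>

lemma Littlewood_Paley_first_derivative:
  assumes "Littlewood_Paley_weight W"
  obtains K :: real where "0 < K" "W \<in> borel_measurable area_measure" "\<And>z. z \<in> unit_disc \<Longrightarrow> 0 \<le> W z"
    "(\<integral>\<^sup>+z. ennreal (W z) \<partial>area_measure) < \<infinity>"
    "\<And>f. f holomorphic_on unit_disc \<Longrightarrow> sq_integral (tilde_weight W) (deriv f) \<le> ennreal K * sq_integral W f"
    "\<And>f. f holomorphic_on unit_disc \<Longrightarrow>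
       sq_integral W f \<le> ennreal K * (sq_integral (tilde_weight W) (deriv f) + ennreal ((cmod (f 0))\<^sup>2))"
proof -
  have W: "W \<in> borel_measurable area_measure" "\<And>z. z \<in> unit_disc \<Longrightarrow> 0 \<le> W z"
    using assms by (auto simp: Littlewood_Paley_weight_def weight_def)
  have "\<exists>c>0. \<exists>C>0. \<forall>f. f holomorphic_on unit_disc \<longrightarrow>
        ennreal c * LP_rhs W 1 2 f \<le> LP_lhs W 2 f \<and> LP_lhs W 2 f \<le> ennreal C * LP_rhs W 1 2 f"
    using assms unfolding Littlewood_Paley_weight_def by (metis order_refl zero_less_numeral)
  then obtain c C :: real where cC: "0 < c" "0 < C"
    "\<And>f. f holomorphic_on unit_disc \<Longrightarrow> ennreal c * LP_rhs W 1 2 f \<le> LP_lhs W 2 f"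
    "\<And>f. f holomorphic_on unit_disc \<Longrightarrow> LP_lhs W 2 f \<le> ennreal C * LP_rhs W 1 2 f" by blast
  have lhs: "LP_lhs W 2 f = sq_integral W f" for f
    unfolding LP_lhs_def sq_integral_def using W(2)
    by (intro nn_integral_cong) (auto simp: ennreal_mult)
  have rhs: "LP_rhs W 1 2 f = sq_integral (tilde_weight W) (deriv f) + ennreal ((cmod (f 0))\<^sup>2)" for f
  proof -
    have "(\<integral>\<^sup>+z. ennreal (cmod ((deriv ^^ 1) f z) powr 2 * (1 - cmod z) powr (real 1 * 2) * W z) \<partial>area_measure)
       = sq_integral (tilde_weight W) (deriv f)"
      unfolding sq_integral_def using W(2)
      by (intro nn_integral_cong) (auto simp: ennreal_mult tilde_weight_def mult.assoc)
    then show ?thesis by (simp add: LP_rhs_def)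
  qed
  define K where "K = max (1 / c) C"
  have K: "0 < K" "1 / c \<le> K" "C \<le> K" using cC by (auto simp: K_def)
  have low: "sq_integral (tilde_weight W) (deriv f) \<le> ennreal K * sq_integral W f" if f: "f holomorphic_on unit_disc" for f
  proof -
    have "LP_rhs W 1 2 f = ennreal (1 / c) * (ennreal c * LP_rhs W 1 2 f)"
      using cC(1) by (simp add: mult.assoc[symmetric] ennreal_mult[symmetric])
    also have "\<dots> \<le> ennreal K * LP_lhs W 2 f"
      using cC(3)[OF f] K by (intro mult_mono ennreal_leI) auto
    finally have "sq_integral (tilde_weight W) (deriv f) + ennreal ((cmod (f 0))\<^sup>2) \<le> ennreal K * sq_integral W f"
      by (simp only: lhs rhs)
    then show ?thesis by (rule order_trans[rotated]) simp
  qed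
  have up: "sq_integral W f \<le> ennreal K * (sq_integral (tilde_weight W) (deriv f) + ennreal ((cmod (f 0))\<^sup>2))"
    if f: "f holomorphic_on unit_disc" for f
  proof -
    have "LP_lhs W 2 f \<le> ennreal K * LP_rhs W 1 2 f"
      using cC(4)[OF f] K by (intro order_trans[OF cC(4)[OF f]] mult_right_mono ennreal_leI) auto
    then show ?thesis by (simp only: lhs rhs)
  qed
  have "sq_integral W (\<lambda>_. 1) \<le> ennreal K * (sq_integral (tilde_weight W) (deriv (\<lambda>_. 1)) + ennreal ((cmod 1)\<^sup>2))"
    by (rule up) (rule holomorphic_on_const)
  also have "sq_integral (tilde_weight W) (deriv (\<lambda>_. 1)) = 0" by (simp add: sq_integral_def)
  finally have "sq_integral W (\<lambda>_. 1) < \<infinity>" by (rule order_le_less_trans) simp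
  then have "(\<integral>\<^sup>+z. ennreal (W z) \<partial>area_measure) < \<infinity>" by (simp add: sq_integral_def)
  with K(1) W low up show ?thesis by (intro that)
qed

lemma Qp_norm_le_imp:
  assumes f: "f \<in> Qp_space p" and B: "Qp_norm p f \<le> B"
  shows "cmod (f 0) \<le> B" "Qp_seminorm_sq p f \<le> ennreal (B\<^sup>2)" "0 \<le> B"
proof -
  have s0: "0 \<le> sqrt (enn2real (Qp_seminorm_sq p f))" by simp
  show c: "cmod (f 0) \<le> B" using B s0 unfolding Qp_norm_def by linarith
  show B0: "0 \<le> B" using c norm_ge_zero order_trans by blast
  have "sqrt (enn2real (Qp_seminorm_sq p f)) \<le> B" using B norm_ge_zero[of "f 0"] unfolding Qp_norm_def by linarith
  then have "enn2real (Qp_seminorm_sq p f) \<le> B\<^sup>2" by (rule sqrt_le_D)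
  then have "ennreal (enn2real (Qp_seminorm_sq p f)) \<le> ennreal (B\<^sup>2)" by (rule ennreal_leI)
  moreover have "ennreal (enn2real (Qp_seminorm_sq p f)) = Qp_seminorm_sq p f" using f by (simp add: Qp_space_def)
  ultimately show "Qp_seminorm_sq p f \<le> ennreal (B\<^sup>2)" by (simp only:)
qed

lemma deriv_diff_on_disc:
  assumes "f holomorphic_on unit_disc" "g holomorphic_on unit_disc" "z \<in> unit_disc"
  shows "deriv (\<lambda>z. f z - g z) z = deriv f z - deriv g z"
  using assms by (intro deriv_diff) (auto intro: holomorphic_on_imp_differentiable_at)

lemma Qp_seminorm_diff_le:
  assumes f: "f holomorphic_on unit_disc" and g: "g holomorphic_on unit_disc"
  shows "Qp_seminorm_sq p (\<lambda>z. f z - g z) \<le> 2 * Qp_seminorm_sq p f + 2 * Qp_seminorm_sq p g"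
  unfolding Qp_seminorm_sq_def[of p "\<lambda>z. f z - g z"]
proof (rule SUP_least)
  fix a assume a: "a \<in> unit_disc"
  have e: "(\<integral>\<^sup>+z. ennreal ((cmod (deriv h z))\<^sup>2 * green z a powr p) \<partial>area_measure) = sq_integral (\<lambda>z. green z a powr p) (deriv h)" for h
    unfolding sq_integral_def by (intro nn_integral_cong) (auto simp: ennreal_mult)
  have le: "sq_integral (\<lambda>z. green z a powr p) (deriv h) \<le> Qp_seminorm_sq p h" for h
    unfolding e[symmetric] Qp_seminorm_sq_def using a by (rule SUP_upper)
  have m: "(\<lambda>z. green z a powr p) \<in> borel_measurable area_measure"
    using green_measurable by measurable
  have "sq_integral (\<lambda>z. green z a powr p) (deriv (\<lambda>z. f z - g z)) = sq_integral (\<lambda>z. green z a powr p) (\<lambda>z. deriv f z - deriv g z)"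
    by (intro sq_integral_cong deriv_diff_on_disc f g)
  also have "\<dots> \<le> 2 * sq_integral (\<lambda>z. green z a powr p) (deriv f) + 2 * sq_integral (\<lambda>z. green z a powr p) (deriv g)"
    by (intro sq_integral_diff_le deriv_measurable f g m)
  also have "\<dots> \<le> 2 * Qp_seminorm_sq p f + 2 * Qp_seminorm_sq p g"
    by (intro add_mono mult_left_mono le) auto
  finally show "(\<integral>\<^sup>+z. ennreal ((cmod (deriv (\<lambda>z. f z - g z) z))\<^sup>2 * green z a powr p) \<partial>area_measure)
     \<le> 2 * Qp_seminorm_sq p f + 2 * Qp_seminorm_sq p g" by (simp only: e)
qed

context dyadic_levels
begin

lemma atom'_measurable: "I \<in> nodes \<Longrightarrow> atom' I \<in> borel_measurable area_measure"
  unfolding atom'_def[abs_def]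
  by (intro continuous_imp_measurable_area continuous_intros ballI)
     (simp only: power_eq_0_iff atom_denominator_nonzero simp_thms)

text \<open>By duality it suffices to test against a finite Carleson sequence \<open>\<mu>\<close>. With coefficients
  \<open>x I = sqrt (\<mu> I / l I powr p)\<close> and the signs of \<open>exists_signs\<close>, the sum of atoms is a function in a fixed ball of
  \<open>\<Q>\<^sub>p\<close>, and on the box of \<open>I\<close> the lower bound \<open>norm_atom'_ge\<close> makes its \<open>I\<close>-th term contribute at least
  \<open>h I * \<mu> I / 729\<^sup>2\<close>.\<close>

lemma gauge_le_of_Qp_bound:
  assumes p: "0 < p" "p \<le> 1" and V: "V \<in> borel_measurable area_measure"
    and fin: "(\<integral>\<^sup>+z. ennreal (V z) \<partial>area_measure) < \<infinity>" and \<eta>: "0 \<le> \<eta>"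
    and bound: "\<And>f. f \<in> Qp_space p \<Longrightarrow> Qp_norm p f \<le> sqrt (atomic_bound p) \<Longrightarrow>
      sq_integral V (deriv f) \<le> ennreal \<eta>"
  shows "dyadic_gauge p nodes (box_average p V) \<le> ennreal (729\<^sup>2 * \<eta>)"
proof -
  let ?l = arc_length
  note [measurable] = V
  define N where "N I = (\<integral>\<^sup>+z. ennreal (V z) * indicator (upper_half_box I) z \<partial>area_measure)" for I
  have Nfin: "N I < top" for I
  proof -
    have "N I \<le> (\<integral>\<^sup>+z. ennreal (V z) \<partial>area_measure)"
      unfolding N_def by (intro nn_integral_mono) (auto simp: indicator_def)
    then show ?thesis using fin by (simp add: order_le_less_trans)
  qed
  define h where "h I = enn2real (N I) / ?l I powr (p + 2)" for I
  have h0: "0 \<le> h I" for I by (simp add: h_def)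
  have hbox: "box_average p V I = ennreal (h I)" if I: "I \<in> nodes" for I
  proof -
    have "box_average p V I = ennreal (enn2real (N I)) / ennreal (?l I powr (p + 2))"
      using Nfin[of I] by (simp add: box_average_def N_def)
    also have "\<dots> = ennreal (h I)"
      unfolding h_def using arc_length_pos[OF I] by (intro divide_ennreal) auto
    finally show ?thesis .
  qed
  have "dyadic_gauge p nodes (\<lambda>I. ennreal (h I)) \<le> ennreal (729\<^sup>2 * \<eta>)"
  proof (rule gauge_le_of_dual_bound[OF p(1) h0])
    fix F and \<mu> :: "complex set \<Rightarrow> real"
    assume F: "finite F" "F \<subseteq> nodes" and \<mu>: "\<And>I. 0 \<le> \<mu> I"
      and carl: "\<And>J. J \<in> nodes \<Longrightarrow> (\<Sum>I | I \<in> F \<and> I \<subseteq> J. \<mu> I) \<le> ?l J powr p"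
    define x where "x I = sqrt (\<mu> I / ?l I powr p)" for I
    have x2: "(x I)\<^sup>2 * ?l I powr p = \<mu> I" if "I \<in> nodes" for I
      using \<mu>[of I] arc_length_pos[OF that] by (simp add: x_def)
    define u where "u I z = of_real (x I) * atom' I z" for I z
    have um: "u I \<in> borel_measurable area_measure" if "I \<in> F" for I
      unfolding u_def[abs_def] using atom'_measurable[of I] that F by (intro borel_measurable_times) auto
    have "\<exists>\<epsilon> :: complex set \<Rightarrow> real. (\<forall>I. \<epsilon> I = 1 \<or> \<epsilon> I = -1) \<and>
      (\<Sum>I\<in>F. sq_integral V (u I)) \<le> sq_integral V (\<lambda>z. \<Sum>I\<in>F. of_real (\<epsilon> I) * u I z)"
      unfolding sq_integral_def
      by (rule exists_signs[OF F(1)]) (use um measurable_compose[OF V measurable_ennreal] in simp_all)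
    then obtain \<epsilon> :: "complex set \<Rightarrow> real" where \<epsilon>: "\<forall>I. \<epsilon> I = 1 \<or> \<epsilon> I = -1"
      "(\<Sum>I\<in>F. sq_integral V (u I)) \<le> sq_integral V (\<lambda>z. \<Sum>I\<in>F. of_real (\<epsilon> I) * u I z)"
      by (elim exE conjE)
    define f where "f = atomic_sum F (\<lambda>I. \<epsilon> I * x I)"
    have \<epsilon>2: "(\<epsilon> I * x I)\<^sup>2 = (x I)\<^sup>2" for I using spec[OF \<epsilon>(1), of I] by (auto simp: power_mult_distrib)
    have S: "Qp_seminorm_sq p f \<le> ennreal (atomic_bound p)"
      unfolding f_def
    proof (rule Qp_seminorm_atomic_sum_le[OF p F])
      fix J assume J: "J \<in> nodes"
      have "(\<Sum>I | I \<in> F \<and> I \<subseteq> J. (\<epsilon> I * x I)\<^sup>2 * ?l I powr p) = (\<Sum>I | I \<in> F \<and> I \<subseteq> J. \<mu> I)"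
        using F x2 unfolding \<epsilon>2 by (intro sum.cong) auto
      then show "(\<Sum>I | I \<in> F \<and> I \<subseteq> J. (\<epsilon> I * x I)\<^sup>2 * ?l I powr p) \<le> ?l J powr p" using carl[OF J] by simp
    qed
    have fQ: "f \<in> Qp_space p"
      using S atomic_sum_holomorphic[OF F(2)] unfolding Qp_space_def f_def by (auto simp: order_le_less_trans)
    have "enn2real (Qp_seminorm_sq p f) \<le> atomic_bound p"
    proof (rule enn2real_leI[OF _ S])
      have "0 \<le> decay_const (7/4) (1/4)" "0 \<le> decay_const (p + 3/4) (5/4 - p)" "0 \<le> decay_const (3/4 - p/2) (5/4 - p)"
        using p by (auto intro!: decay_const_nonneg)
      moreover have "2 powr - (p/2) \<le> (1::real)" using p by (simp add: powr_less_one less_imp_le)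
      ultimately show "0 \<le> atomic_bound p" unfolding atomic_bound_def schur_const_def by simp
    qed
    then have "Qp_norm p f \<le> sqrt (atomic_bound p)"
      unfolding Qp_norm_def by (simp add: f_def atomic_sum_0)
    from bound[OF fQ this] have fb: "sq_integral V (deriv f) \<le> ennreal \<eta>" .
    have "sq_integral V (\<lambda>z. \<Sum>I\<in>F. of_real (\<epsilon> I) * u I z) = sq_integral V (deriv f)"
      unfolding f_def u_def
      by (intro sq_integral_cong) (simp add: deriv_atomic_sum[OF F(2)] mult.assoc)
    with \<epsilon>(2) fb have usum: "(\<Sum>I\<in>F. sq_integral V (u I)) \<le> ennreal \<eta>" by simp
    have one: "ennreal (h I * \<mu> I) \<le> ennreal (729\<^sup>2) * sq_integral V (u I)" if IF: "I \<in> F" for I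
    proof -
      have I: "I \<in> nodes" using IF F by auto
      have l: "0 < ?l I" by (rule arc_length_pos[OF I])
      have "h I * \<mu> I = (x I / ?l I)\<^sup>2 * enn2real (N I)"
        unfolding x2[OF I, symmetric] h_def using l by (simp add: powr_add power_divide)
      then have "ennreal (h I * \<mu> I) = ennreal ((x I / ?l I)\<^sup>2) * N I"
        using Nfin[of I] by (simp add: ennreal_mult)
      also have "\<dots> = (\<integral>\<^sup>+z. ennreal ((x I / ?l I)\<^sup>2) * (ennreal (V z) * indicator (upper_half_box I) z) \<partial>area_measure)"
        unfolding N_def
        by (rule nn_integral_cmult[symmetric]) (intro borel_measurable_times_ennreal borel_measurable_indicator box_sets I measurable_compose[OF V] measurable_ennreal)
      also have "\<dots> \<le> (\<integral>\<^sup>+z. ennreal (729\<^sup>2) * (ennreal ((cmod (u I z))\<^sup>2) * ennreal (V z)) \<partial>area_measure)"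
      proof (rule nn_integral_mono)
        fix z
        show "ennreal ((x I / ?l I)\<^sup>2) * (ennreal (V z) * indicator (upper_half_box I) z)
          \<le> ennreal (729\<^sup>2) * (ennreal ((cmod (u I z))\<^sup>2) * ennreal (V z))"
        proof (cases "z \<in> upper_half_box I")
          case True
          have "1 / ?l I \<le> 729 * cmod (atom' I z)"
            using norm_atom'_ge[OF I True] l by (simp add: field_simps)
          then have "\<bar>x I\<bar> * (1 / ?l I) \<le> \<bar>x I\<bar> * (729 * cmod (atom' I z))" by (rule mult_left_mono) simp
          then have "(\<bar>x I\<bar> * (1 / ?l I))\<^sup>2 \<le> (\<bar>x I\<bar> * (729 * cmod (atom' I z)))\<^sup>2"
            using l by (intro power_mono) auto
          moreover have "(\<bar>x I\<bar> * (1 / ?l I))\<^sup>2 = (x I / ?l I)\<^sup>2" by (simp add: power_mult_distrib power_divide)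
          moreover have "(\<bar>x I\<bar> * (729 * cmod (atom' I z)))\<^sup>2 = 729\<^sup>2 * (cmod (u I z))\<^sup>2"
            by (simp add: u_def norm_mult power_mult_distrib)
          ultimately have "ennreal ((x I / ?l I)\<^sup>2) \<le> ennreal (729\<^sup>2 * (cmod (u I z))\<^sup>2)"
            by (intro ennreal_leI) linarith
          also have "\<dots> = ennreal (729\<^sup>2) * ennreal ((cmod (u I z))\<^sup>2)" by (rule ennreal_mult) auto
          finally have "ennreal ((x I / ?l I)\<^sup>2) * ennreal (V z) \<le> ennreal (729\<^sup>2) * ennreal ((cmod (u I z))\<^sup>2) * ennreal (V z)"
            by (rule mult_right_mono) simp
          then show ?thesis using True by (simp add: mult.assoc)
        qed simp
      qed
      also have "\<dots> = ennreal (729\<^sup>2) * sq_integral V (u I)"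
        unfolding sq_integral_def
      proof (rule nn_integral_cmult)
        note [measurable] = um[OF IF]
        show "(\<lambda>z. ennreal ((cmod (u I z))\<^sup>2) * ennreal (V z)) \<in> borel_measurable area_measure" by measurable
      qed
      finally show ?thesis .
    qed
    have "ennreal (\<Sum>I\<in>F. h I * \<mu> I) = (\<Sum>I\<in>F. ennreal (h I * \<mu> I))"
      using h0 \<mu> by (intro sum_ennreal[symmetric]) auto
    also have "\<dots> \<le> (\<Sum>I\<in>F. ennreal (729\<^sup>2) * sq_integral V (u I))" by (intro sum_mono one)
    also have "\<dots> = ennreal (729\<^sup>2) * (\<Sum>I\<in>F. sq_integral V (u I))" by (simp only: sum_distrib_left)
    also have "\<dots> \<le> ennreal (729\<^sup>2) * ennreal \<eta>" by (intro mult_left_mono usum) simp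
    also have "\<dots> = ennreal (729\<^sup>2 * \<eta>)" using \<eta> by (intro ennreal_mult[symmetric]) auto
    finally show "(\<Sum>I\<in>F. h I * \<mu> I) \<le> 729\<^sup>2 * \<eta>" using \<eta> by (subst (asm) ennreal_le_iff) auto
  qed
  then show ?thesis using dyadic_gauge_cong[of nodes "box_average p V" "\<lambda>I. ennreal (h I)" p] hbox by simp
qed

end

section \<open>Compactness and uniform tails\<close>

lemma tilde_weight_nonneg: "(\<And>z. z \<in> unit_disc \<Longrightarrow> 0 \<le> W z) \<Longrightarrow> z \<in> unit_disc \<Longrightarrow> 0 \<le> tilde_weight W z"
  by (simp add: tilde_weight_def)

lemma tilde_weight_le:
  assumes "\<And>z. z \<in> unit_disc \<Longrightarrow> 0 \<le> W z" "z \<in> unit_disc" shows "tilde_weight W z \<le> W z"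
proof -
  have "(1 - cmod z)\<^sup>2 \<le> 1" using assms(2) by (intro power_le_one) auto
  then show ?thesis unfolding tilde_weight_def using assms by (intro mult_left_le_one_le) auto
qed

text \<open>Otherwise there is a bounded sequence whose tails, beyond radii tending to 1, stay above \<open>\<eta>\<close>.
  Along a subsequence it converges in \<open>L\<^sup>2(W dA)\<close>. The limit need not be holomorphic, so the late terms are
  compared with a fixed term \<open>f (s m)\<close> of the sequence instead: by the Littlewood-Paley inequality their derivatives
  are close to that of \<open>f (s m)\<close> in the weighted square integral, and the tail of \<open>f (s m)\<close> itself tends to 0.\<close>

lemma uniform_tails_of_compact_embedding:
  assumes p: "0 < p" and LP: "Littlewood_Paley_weight W"
    and comp: "compact_embedding (Qp_space p) (Qp_norm p) (L2_space (weighted_area W)) (L2_norm (weighted_area W))"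
    and \<eta>: "0 < (\<eta>::real)"
  shows "\<exists>\<rho>0<1. \<forall>\<rho>. \<rho>0 < \<rho> \<and> \<rho> < 1 \<longrightarrow> (\<forall>f\<in>Qp_space p. Qp_norm p f \<le> B \<longrightarrow>
     sq_integral (truncated_weight \<rho> (tilde_weight W)) (deriv f) \<le> ennreal \<eta>)"
proof (rule ccontr)
  assume neg: "\<not> ?thesis"
  obtain K :: real where K: "0 < K" and W: "W \<in> borel_measurable area_measure" "\<And>z. z \<in> unit_disc \<Longrightarrow> 0 \<le> W z"
    and low: "\<And>f. f holomorphic_on unit_disc \<Longrightarrow> sq_integral (tilde_weight W) (deriv f) \<le> ennreal K * sq_integral W f"
    using Littlewood_Paley_first_derivative[OF LP] by metis
  let ?Wt = "tilde_weight W"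
  note Wt = tilde_weight_measurable[OF W(1)]
  have Wt0: "0 \<le> ?Wt z" if "z \<in> unit_disc" for z using W(2) that by (rule tilde_weight_nonneg)
  define r where "r n = 1 - 1 / real (n + 2)" for n :: nat
  have r1: "r n < 1" for n by (simp add: r_def)
  have rlim: "r \<longlonglongrightarrow> 1"
  proof -
    have "(\<lambda>n. 1 / real (n + 2)) \<longlonglongrightarrow> 0"
      using LIMSEQ_ignore_initial_segment[OF lim_1_over_n, of 2] by simp
    then have "r \<longlonglongrightarrow> 1 - 0" unfolding r_def[abs_def] by (intro tendsto_diff tendsto_const)
    then show ?thesis by simp
  qed
  have "\<exists>f\<in>Qp_space p. Qp_norm p f \<le> B \<and> \<not> sq_integral (truncated_weight (r n) ?Wt) (deriv f) \<le> ennreal \<eta>" for n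
  proof -
    from neg r1[of n] obtain \<rho> f where *: "r n < \<rho>" "\<rho> < 1" "f \<in> Qp_space p" "Qp_norm p f \<le> B"
      "\<not> sq_integral (truncated_weight \<rho> ?Wt) (deriv f) \<le> ennreal \<eta>" by blast
    have "sq_integral (truncated_weight \<rho> ?Wt) (deriv f) \<le> sq_integral (truncated_weight (r n) ?Wt) (deriv f)"
      using *(1) Wt0 by (intro sq_integral_mono) (auto simp: truncated_weight_def indicator_def)
    then show ?thesis using * order_trans by blast
  qed
  then obtain f where f: "\<And>n. f n \<in> Qp_space p" "\<And>n. Qp_norm p (f n) \<le> B"
    "\<And>n. \<not> sq_integral (truncated_weight (r n) ?Wt) (deriv (f n)) \<le> ennreal \<eta>" by metis
  have holo: "f n holomorphic_on unit_disc" for n using f(1)[of n] by (simp add: Qp_space_def)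
  note fm = holomorphic_measurable[OF holo]
  have sub: "Qp_space p \<subseteq> L2_space (weighted_area W)" using comp by (simp add: compact_embedding_def)
  from comp f(1,2) obtain s F where s: "strict_mono s" and F: "F \<in> L2_space (weighted_area W)"
    and lim: "(\<lambda>k. L2_norm (weighted_area W) (\<lambda>z. f (s k) z - F z)) \<longlonglongrightarrow> 0"
    unfolding compact_embedding_def by blast
  have Fm: "F \<in> borel_measurable area_measure" and Ffin: "sq_integral W F < \<infinity>" using F L2_space_iff[OF W(1)] by auto
  have ffin: "sq_integral W (f n) < \<infinity>" for n using sub f(1)[of n] L2_space_iff[OF W(1)] by auto
  define X where "X k = sq_integral W (\<lambda>z. f (s k) z - F z)" for k
  have Xfin: "X k < top" for k
  proof -
    have "X k \<le> 2 * sq_integral W (f (s k)) + 2 * sq_integral W F"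
      unfolding X_def by (rule sq_integral_diff_le[OF fm Fm W(1)])
    also have "\<dots> < top" using ffin[of "s k"] Ffin by (simp add: ennreal_mult_less_top)
    finally show ?thesis .
  qed
  \<comment> \<open>chosen so that \<open>K * (4 * \<epsilon>) = \<eta> / 4\<close>\<close>
  define \<epsilon> where "\<epsilon> = \<eta> / (16 * K)"
  have \<epsilon>: "0 < \<epsilon>" using \<eta> K by (simp add: \<epsilon>_def)
  have "eventually (\<lambda>k. L2_norm (weighted_area W) (\<lambda>z. f (s k) z - F z) < sqrt \<epsilon>) sequentially"
    using lim \<epsilon> by (intro order_tendstoD(2)) auto
  then obtain m where m: "\<And>k. m \<le> k \<Longrightarrow> L2_norm (weighted_area W) (\<lambda>z. f (s k) z - F z) < sqrt \<epsilon>"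
    by (auto simp: eventually_sequentially)
  have Xsmall: "X k \<le> ennreal \<epsilon>" if "m \<le> k" for k
  proof -
    have "(\<lambda>z. f (s k) z - F z) \<in> borel_measurable area_measure" by (intro borel_measurable_diff fm Fm)
    then have "sqrt (enn2real (X k)) < sqrt \<epsilon>"
      using m[OF that] by (simp add: L2_norm_weighted_area[OF W(1)] X_def)
    then have "ennreal (enn2real (X k)) \<le> ennreal \<epsilon>" by (intro ennreal_leI) simp
    then show ?thesis using Xfin[of k] by simp
  qed
  let ?g = "f (s m)"
  have gfin: "sq_integral ?Wt (deriv ?g) < \<infinity>"
    using low[OF holo, of "s m"] ffin[of "s m"] by (auto intro: order_le_less_trans simp: ennreal_mult_less_top)
  have "(\<lambda>k. sq_integral (truncated_weight (r (s k)) ?Wt) (deriv ?g)) \<longlonglongrightarrow> 0"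
    using LIMSEQ_subseq_LIMSEQ[OF rlim s]
    by (intro sq_integral_truncated_tendsto_0 Wt deriv_measurable holo gfin Wt0) (auto simp: o_def)
  then have "eventually (\<lambda>k. sq_integral (truncated_weight (r (s k)) ?Wt) (deriv ?g) < ennreal (\<eta> / 4)) sequentially"
    using \<eta> by (intro order_tendstoD(2)) auto
  then obtain k where k: "m \<le> k" "sq_integral (truncated_weight (r (s k)) ?Wt) (deriv ?g) < ennreal (\<eta> / 4)"
    unfolding eventually_sequentially by (meson nat_le_linear order_refl le_trans)
  define d where "d z = ?g z - f (s k) z" for z
  have dholo: "d holomorphic_on unit_disc" unfolding d_def[abs_def] by (intro holomorphic_intros holo)
  have dW: "sq_integral W d \<le> ennreal (4 * \<epsilon>)"
  proof -
    have "sq_integral W d = sq_integral W (\<lambda>z. (?g z - F z) - (f (s k) z - F z))" by (simp add: d_def[abs_def])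
    also have "\<dots> \<le> 2 * X m + 2 * X k"
      unfolding X_def by (intro sq_integral_diff_le borel_measurable_diff fm Fm W(1))
    also have "\<dots> \<le> 2 * ennreal \<epsilon> + 2 * ennreal \<epsilon>"
      using Xsmall[of m] Xsmall[OF k(1)] by (intro add_mono mult_left_mono) auto
    also have "\<dots> = ennreal (4 * \<epsilon>)" using \<epsilon> by (simp add: ennreal_mult' flip: mult_2 distrib_right)
    finally show ?thesis .
  qed
  let ?V = "truncated_weight (r (s k)) ?Wt"
  have "sq_integral ?V (deriv (f (s k))) = sq_integral ?V (\<lambda>z. deriv ?g z - deriv d z)"
  proof (rule sq_integral_cong)
    fix z assume z: "z \<in> unit_disc"
    show "deriv (f (s k)) z = deriv ?g z - deriv d z"
      using deriv_diff_on_disc[OF holo holo z, of "s m" "s k"] by (simp add: d_def[abs_def])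
  qed
  also have "\<dots> \<le> 2 * sq_integral ?V (deriv ?g) + 2 * sq_integral ?V (deriv d)"
    by (intro sq_integral_diff_le deriv_measurable holo dholo truncated_weight_measurable Wt)
  also have "\<dots> \<le> 2 * ennreal (\<eta> / 4) + 2 * ennreal (\<eta> / 4)"
  proof (intro add_mono mult_left_mono)
    have "sq_integral ?V (deriv d) \<le> sq_integral ?Wt (deriv d)"
      using Wt0 by (intro sq_integral_mono) (auto simp: truncated_weight_def indicator_def)
    also have "\<dots> \<le> ennreal K * sq_integral W d" by (rule low[OF dholo])
    also have "\<dots> \<le> ennreal K * ennreal (4 * \<epsilon>)" by (intro mult_left_mono dW) simp
    also have "\<dots> = ennreal (\<eta> / 4)" using K \<eta> by (simp add: \<epsilon>_def ennreal_mult[symmetric])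
    finally show "sq_integral ?V (deriv d) \<le> ennreal (\<eta> / 4)" .
  qed (use k in auto)
  also have "\<dots> = ennreal \<eta>"
    using \<eta> by (simp add: ennreal_mult'[symmetric] ennreal_plus[symmetric] flip: ennreal_numeral del: ennreal_plus)
  finally show False using f(3)[of "s k"] by simp
qed

lemma gauge_tendsto_0_of_compact_embedding:
  assumes p: "0 < p" "p \<le> 1" and LP: "Littlewood_Paley_weight W"
    and comp: "compact_embedding (Qp_space p) (Qp_norm p) (L2_space (weighted_area W)) (L2_norm (weighted_area W))"
  shows "((\<lambda>\<rho>. SUP \<D>\<in>{\<D>. dyadic_system \<D>}.
          dyadic_gauge p \<D> (box_average p (truncated_weight \<rho> (tilde_weight W)))) \<longlongrightarrow> 0) (at_left 1)"
proof (rule tendsto_0_ennrealI)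
  fix \<eta> :: real assume \<eta>: "0 < \<eta>"
  obtain K :: real where W: "W \<in> borel_measurable area_measure" "\<And>z. z \<in> unit_disc \<Longrightarrow> 0 \<le> W z"
    and Wfin: "(\<integral>\<^sup>+z. ennreal (W z) \<partial>area_measure) < \<infinity>"
    using Littlewood_Paley_first_derivative[OF LP] by metis
  let ?Wt = "tilde_weight W"
  let ?G = "\<lambda>\<rho>. SUP \<D>\<in>{\<D>. dyadic_system \<D>}. dyadic_gauge p \<D> (box_average p (truncated_weight \<rho> ?Wt))"
  have "0 < \<eta> / 729\<^sup>2" using \<eta> by simp
  from uniform_tails_of_compact_embedding[OF p(1) LP comp this, of "sqrt (atomic_bound p)"]
  obtain \<rho>0 where \<rho>0: "\<rho>0 < 1" "\<And>\<rho> f. \<rho>0 < \<rho> \<Longrightarrow> \<rho> < 1 \<Longrightarrow> f \<in> Qp_space p \<Longrightarrow>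
      Qp_norm p f \<le> sqrt (atomic_bound p) \<Longrightarrow>
      sq_integral (truncated_weight \<rho> ?Wt) (deriv f) \<le> ennreal (\<eta> / 729\<^sup>2)" by blast
  have "eventually (\<lambda>\<rho>. \<rho>0 < \<rho> \<and> \<rho> < 1) (at_left 1)"
    using eventually_at_left_real[OF \<rho>0(1)] by (rule eventually_mono) auto
  then show "eventually (\<lambda>\<rho>. ?G \<rho> \<le> ennreal \<eta>) (at_left 1)"
  proof (rule eventually_mono)
    fix \<rho> assume \<rho>: "\<rho>0 < \<rho> \<and> \<rho> < 1"
    show "?G \<rho> \<le> ennreal \<eta>"
    proof (rule SUP_least)
      fix \<D> assume "\<D> \<in> {\<D>. dyadic_system \<D>}"
      then obtain D where D: "dyadic_levels D" "\<D> = dyadic_levels.nodes D" using dyadic_systemE by blast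
      have "(\<integral>\<^sup>+z. ennreal (truncated_weight \<rho> ?Wt z) \<partial>area_measure) \<le> (\<integral>\<^sup>+z. ennreal (W z) \<partial>area_measure)"
      proof (intro nn_integral_mono ennreal_leI)
        fix z assume "z \<in> space area_measure"
        then have z: "z \<in> unit_disc" by simp
        show "truncated_weight \<rho> ?Wt z \<le> W z"
          using tilde_weight_le[of W z] W(2) z by (auto simp: truncated_weight_def indicator_def)
      qed
      then have "(\<integral>\<^sup>+z. ennreal (truncated_weight \<rho> ?Wt z) \<partial>area_measure) < \<infinity>"
        using Wfin by (rule order_le_less_trans)
      then have "dyadic_gauge p \<D> (box_average p (truncated_weight \<rho> ?Wt)) \<le> ennreal (729\<^sup>2 * (\<eta> / 729\<^sup>2))"
        unfolding D(2)
        by (intro dyadic_levels.gauge_le_of_Qp_bound D p truncated_weight_measurable tilde_weight_measurable W \<rho>0(2))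
           (use \<rho> \<eta> in auto)
      then show "dyadic_gauge p \<D> (box_average p (truncated_weight \<rho> ?Wt)) \<le> ennreal \<eta>" by simp
    qed
  qed
qed

text \<open>The gauge condition enters through the standard dyadic system.\<close>

lemma uniform_tails_of_gauge:
  assumes p: "0 < p" "p \<le> 1" and V: "V \<in> borel_measurable area_measure"
    and lim: "((\<lambda>\<rho>. SUP \<D>\<in>{\<D>. dyadic_system \<D>}. dyadic_gauge p \<D> (box_average p (truncated_weight \<rho> V))) \<longlongrightarrow> 0) (at_left 1)"
    and e: "0 < (e::real)"
  shows "\<exists>\<rho>. 0 < \<rho> \<and> \<rho> < 1 \<and> (\<forall>f. f holomorphic_on unit_disc \<longrightarrow>
     sq_integral (truncated_weight \<rho> V) (deriv f) \<le> ennreal (2 * carleson_const) * Qp_seminorm_sq p f * ennreal e)"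
proof -
  let ?G = "\<lambda>\<rho>. SUP \<D>\<in>{\<D>. dyadic_system \<D>}. dyadic_gauge p \<D> (box_average p (truncated_weight \<rho> V))"
  interpret dyadic_levels "\<lambda>k. standard_arc k ` {..<2 ^ k}" by (rule dyadic_levels_standard)
  have "eventually (\<lambda>\<rho>. ?G \<rho> < ennreal e) (at_left 1)"
    using lim e by (intro order_tendstoD(2)) auto
  moreover have "eventually (\<lambda>\<rho>::real. \<rho> \<in> {0<..<1}) (at_left 1)" by (rule eventually_at_left_real) simp
  ultimately have "eventually (\<lambda>\<rho>. ?G \<rho> < ennreal e \<and> \<rho> \<in> {0<..<1}) (at_left 1)"
    by (rule eventually_conj)
  then obtain \<rho> where \<rho>: "?G \<rho> < ennreal e" "\<rho> \<in> {0<..<1}"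
    using eventually_happens'[OF trivial_limit_at_left_real] by blast
  have "dyadic_gauge p nodes (box_average p (truncated_weight \<rho> V)) < ennreal e"
    using dyadic_system_nodes by (intro order_le_less_trans[OF _ \<rho>(1)] SUP_upper) simp
  then have "sq_integral (truncated_weight \<rho> V) (deriv f) \<le> ennreal (2 * carleson_const) * Qp_seminorm_sq p f * ennreal e"
    if "f holomorphic_on unit_disc" for f
    unfolding sq_integral_def
    by (intro derivative_integral_le_of_gauge_less p that measurable_compose[OF truncated_weight_measurable[OF V] measurable_ennreal])
  then show ?thesis using \<rho>(2) by auto
qed

lemma Qp_derivative_bound_on_disc:
  assumes p: "0 < p" and \<rho>: "0 < \<rho>" "\<rho> < 1"
  shows "\<exists>C>0. \<forall>f z. f holomorphic_on unit_disc \<longrightarrow> cmod z \<le> \<rho> \<longrightarrow> ennreal ((cmod (deriv f z))\<^sup>2) \<le> ennreal C * Qp_seminorm_sq p f"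
proof (intro exI[of _ "1 / (((1 - \<rho>) / 2)\<^sup>2 * ((1 - \<rho>) / 4) powr p)"] conjI allI impI)
  show "0 < 1 / (((1 - \<rho>) / 2)\<^sup>2 * ((1 - \<rho>) / 4) powr p)" using \<rho> by simp
qed (use Qp_derivative_bound[OF p] \<rho> in auto)

lemma sq_integral_split:
  assumes V: "V \<in> borel_measurable area_measure" and g: "g \<in> borel_measurable area_measure"
  shows "sq_integral V g = sq_integral (truncated_weight \<rho> V) g + sq_integral (\<lambda>z. V z * indicator {z. cmod z \<le> \<rho>} z) g"
proof -
  note [measurable] = V g truncated_weight_measurable[OF V]
  have "{z::complex. cmod z \<le> \<rho>} \<in> sets borel" by measurable
  then have [measurable]: "(indicator {z. cmod z \<le> \<rho>} :: complex \<Rightarrow> real) \<in> borel_measurable area_measure"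
    by (intro borel_imp_measurable_area borel_measurable_indicator)
  have "sq_integral V g = (\<integral>\<^sup>+z. ennreal ((cmod (g z))\<^sup>2) * ennreal (truncated_weight \<rho> V z)
     + ennreal ((cmod (g z))\<^sup>2) * ennreal (V z * indicator {z. cmod z \<le> \<rho>} z) \<partial>area_measure)"
    unfolding sq_integral_def by (intro nn_integral_cong) (auto simp: truncated_weight_def indicator_def)
  also have "\<dots> = sq_integral (truncated_weight \<rho> V) g + sq_integral (\<lambda>z. V z * indicator {z. cmod z \<le> \<rho>} z) g"
    unfolding sq_integral_def by (rule nn_integral_add) measurable
  finally show ?thesis .
qed

text \<open>Fatou's lemma, for every \<open>a\<close> in the supremum.\<close>

lemma Qp_seminorm_le_of_deriv_limit:
  assumes F: "F holomorphic_on unit_disc" and f: "\<And>k. f k holomorphic_on unit_disc"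
    and lim: "\<And>z. z \<in> unit_disc \<Longrightarrow> (\<lambda>k. deriv (f k) z) \<longlonglongrightarrow> deriv F z"
    and bound: "\<And>k. Qp_seminorm_sq p (f k) \<le> C"
  shows "Qp_seminorm_sq p F \<le> C"
  unfolding Qp_seminorm_sq_def
proof (rule SUP_least)
  fix a assume a: "a \<in> unit_disc"
  let ?u = "\<lambda>h z. ennreal ((cmod (deriv h z))\<^sup>2 * green z a powr p)"
  have "(\<integral>\<^sup>+z. ?u F z \<partial>area_measure) = (\<integral>\<^sup>+z. liminf (\<lambda>k. ?u (f k) z) \<partial>area_measure)"
  proof (rule nn_integral_cong)
    fix z assume "z \<in> space area_measure"
    then have "(\<lambda>k. ?u (f k) z) \<longlonglongrightarrow> ?u F z"
      by (intro tendsto_intros lim) simp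
    then show "?u F z = liminf (\<lambda>k. ?u (f k) z)"
      by (rule lim_imp_Liminf[OF trivial_limit_sequentially, symmetric])
  qed
  also have "\<dots> \<le> liminf (\<lambda>k. \<integral>\<^sup>+z. ?u (f k) z \<partial>area_measure)"
    by (rule nn_integral_liminf) (intro Qp_integrand_measurable f)
  also have "\<dots> \<le> C"
  proof (rule Liminf_le)
    show "eventually (\<lambda>k. (\<integral>\<^sup>+z. ?u (f k) z \<partial>area_measure) \<le> C) sequentially"
    proof (rule always_eventually, rule allI)
      fix k
      have "(\<integral>\<^sup>+z. ?u (f k) z \<partial>area_measure) \<le> Qp_seminorm_sq p (f k)"
        unfolding Qp_seminorm_sq_def using a by (rule SUP_upper)
      then show "(\<integral>\<^sup>+z. ?u (f k) z \<partial>area_measure) \<le> C" using bound[of k] by (rule order_trans)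
    qed
  qed simp
  finally show "(\<integral>\<^sup>+z. ?u F z \<partial>area_measure) \<le> C" .
qed

lemma Qp_locally_bounded:
  assumes p: "0 < p" and K: "compact K" "K \<subseteq> unit_disc" and B: "0 \<le> B"
  shows "\<exists>M. \<forall>h\<in>{h. h holomorphic_on unit_disc \<and> cmod (h 0) \<le> B \<and> Qp_seminorm_sq p h \<le> ennreal (B\<^sup>2)}. \<forall>z\<in>K. cmod (h z) \<le> M"
proof -
  obtain R where R: "0 < R" "R < 1" "K \<subseteq> cball 0 R"
  proof (cases "K = {}")
    case True then show ?thesis using that[of "1/2"] by simp
  next
    case False
    have "continuous_on K cmod" by (intro continuous_intros)
    from continuous_attains_sup[OF K(1) False this]
    obtain w where w: "w \<in> K" "\<And>z. z \<in> K \<Longrightarrow> cmod z \<le> cmod w" by blast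
    have "cmod w < 1" using w K by auto
    then show ?thesis using w(2) by (intro that[of "max (cmod w) (1/2)"]) (auto simp: le_max_iff_disj)
  qed
  obtain C where C: "0 < C" "\<And>f z. f holomorphic_on unit_disc \<Longrightarrow> cmod z \<le> R \<Longrightarrow> ennreal ((cmod (deriv f z))\<^sup>2) \<le> ennreal C * Qp_seminorm_sq p f"
    using Qp_derivative_bound_on_disc[OF p R(1,2)] by blast
  have "cmod (h z) \<le> B + sqrt (C * B\<^sup>2)"
    if h: "h holomorphic_on unit_disc" "cmod (h 0) \<le> B" "Qp_seminorm_sq p h \<le> ennreal (B\<^sup>2)" and z: "z \<in> K" for h z
  proof -
    have d: "cmod (deriv h w) \<le> sqrt (C * B\<^sup>2)" if "w \<in> cball 0 R" for w
    proof -
      have "ennreal ((cmod (deriv h w))\<^sup>2) \<le> ennreal C * Qp_seminorm_sq p h" using that by (intro C h) auto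
      also have "\<dots> \<le> ennreal C * ennreal (B\<^sup>2)" by (intro mult_left_mono h) simp
      also have "\<dots> = ennreal (C * B\<^sup>2)" using C by (intro ennreal_mult[symmetric]) auto
      finally have "(cmod (deriv h w))\<^sup>2 \<le> C * B\<^sup>2" using C by (subst (asm) ennreal_le_iff) auto
      then show ?thesis by (rule real_le_rsqrt)
    qed
    have "cmod (h z - h 0) \<le> sqrt (C * B\<^sup>2) * cmod (z - 0)"
    proof (rule field_differentiable_bound[of "cball 0 R" h "deriv h"])
      fix w :: complex assume "w \<in> cball 0 R"
      then have "w \<in> unit_disc" using R by auto
      then show "(h has_field_derivative deriv h w) (at w within cball 0 R)"
        by (rule holomorphic_derivI[OF h(1) open_ball])
    qed (use d z R in auto)
    also have "\<dots> \<le> sqrt (C * B\<^sup>2) * 1" using z K C by (intro mult_left_mono) (auto intro!: less_imp_le)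
    finally show ?thesis using h(2) norm_triangle_ineq2[of "h z" "h 0"] by linarith
  qed
  then show ?thesis by blast
qed

text \<open>A bounded sequence has a locally uniformly convergent subsequence, whose limit \<open>F\<close> is in \<open>\<Q>\<^sub>p\<close>. For the
  differences \<open>d k\<close>, split \<open>\<integral> \<bar>(d k)'\<bar>\<^sup>2 (1 - \<bar>z\<bar>)\<^sup>2 W dA\<close> at \<open>\<bar>z\<bar> = \<rho>\<close>: the outer part is small uniformly in \<open>k\<close> by
  the gauge condition, and the inner part (weight \<open>core \<rho>\<close>) tends to 0 by dominated convergence, as \<open>(d k)'\<close> is
  bounded there and \<open>W\<close> is integrable. The same splitting shows that \<open>\<Q>\<^sub>p\<close> is contained in \<open>L\<^sup>2(W dA)\<close>.\<close>

lemma compact_embedding_of_gauge_tendsto_0: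
  assumes p: "0 < p" "p \<le> 1" and LP: "Littlewood_Paley_weight W"
    and lim: "((\<lambda>\<rho>. SUP \<D>\<in>{\<D>. dyadic_system \<D>}.
          dyadic_gauge p \<D> (box_average p (truncated_weight \<rho> (tilde_weight W)))) \<longlongrightarrow> 0) (at_left 1)"
  shows "compact_embedding (Qp_space p) (Qp_norm p) (L2_space (weighted_area W)) (L2_norm (weighted_area W))"
proof -
  obtain K :: real where K: "0 < K" and W: "W \<in> borel_measurable area_measure" "\<And>z. z \<in> unit_disc \<Longrightarrow> 0 \<le> W z"
    and Wfin: "(\<integral>\<^sup>+z. ennreal (W z) \<partial>area_measure) < \<infinity>"
    and up: "\<And>f. f holomorphic_on unit_disc \<Longrightarrow>
       sq_integral W f \<le> ennreal K * (sq_integral (tilde_weight W) (deriv f) + ennreal ((cmod (f 0))\<^sup>2))"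
    using Littlewood_Paley_first_derivative[OF LP] by metis
  let ?Wt = "tilde_weight W"
  note Wt = tilde_weight_measurable[OF W(1)]
  define core where "core \<rho> z = ?Wt z * indicator {z. cmod z \<le> \<rho>} z" for \<rho> and z :: complex
  have core_le: "core \<rho> z \<le> W z" if "z \<in> unit_disc" for \<rho> z
    using tilde_weight_le[of W z] W(2) that by (auto simp: core_def indicator_def)
  have corem: "core \<rho> \<in> borel_measurable area_measure" for \<rho>
  proof -
    have "{z::complex. cmod z \<le> \<rho>} \<in> sets borel" by measurable
    then have "(indicator {z. cmod z \<le> \<rho>} :: complex \<Rightarrow> real) \<in> borel_measurable area_measure"
      by (intro borel_imp_measurable_area borel_measurable_indicator)
    then show ?thesis unfolding core_def[abs_def] using Wt by (rule borel_measurable_times[rotated])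
  qed
  have split: "sq_integral ?Wt (deriv f) = sq_integral (truncated_weight \<rho> ?Wt) (deriv f) + sq_integral (core \<rho>) (deriv f)"
    if "f holomorphic_on unit_disc" for f \<rho>
    unfolding core_def[abs_def] by (intro sq_integral_split Wt deriv_measurable that)
  have core_pt: "ennreal ((cmod (deriv f z))\<^sup>2) * ennreal (core \<rho> z) \<le> ennreal C * S * ennreal (W z)"
    if C: "\<And>f z. f holomorphic_on unit_disc \<Longrightarrow> cmod z \<le> \<rho> \<Longrightarrow> ennreal ((cmod (deriv f z))\<^sup>2) \<le> ennreal C * Qp_seminorm_sq p f"
      and f: "f holomorphic_on unit_disc" "Qp_seminorm_sq p f \<le> S" and z: "z \<in> unit_disc" for f z \<rho> C S
  proof (cases "cmod z \<le> \<rho>")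
    case True
    have "ennreal ((cmod (deriv f z))\<^sup>2) \<le> ennreal C * Qp_seminorm_sq p f" by (rule C[OF f(1) True])
    also have "\<dots> \<le> ennreal C * S" by (intro mult_left_mono f(2)) simp
    finally show ?thesis by (intro mult_mono ennreal_leI core_le z) auto
  qed (simp add: core_def)
  have dom_fin: "(\<integral>\<^sup>+z. ennreal C * S * ennreal (W z) \<partial>area_measure) < \<infinity>" if "S < top" for C :: real and S
  proof -
    note [measurable] = W(1)
    have "(\<integral>\<^sup>+z. ennreal C * S * ennreal (W z) \<partial>area_measure) = ennreal C * S * (\<integral>\<^sup>+z. ennreal (W z) \<partial>area_measure)"
      by (rule nn_integral_cmult) measurable
    then show ?thesis using Wfin that by (simp add: ennreal_mult_less_top)
  qed
  note tails = uniform_tails_of_gauge[OF p Wt lim]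
  have L2: "f \<in> L2_space (weighted_area W)" if f: "f \<in> Qp_space p" for f
  proof -
    have holo: "f holomorphic_on unit_disc" and S: "Qp_seminorm_sq p f < top" using f by (auto simp: Qp_space_def)
    obtain \<rho> where \<rho>: "0 < \<rho>" "\<rho> < 1"
      "sq_integral (truncated_weight \<rho> ?Wt) (deriv f) \<le> ennreal (2 * carleson_const) * Qp_seminorm_sq p f * ennreal 1"
      using tails[of 1] holo by auto
    obtain C where C: "\<And>f z. f holomorphic_on unit_disc \<Longrightarrow> cmod z \<le> \<rho> \<Longrightarrow> ennreal ((cmod (deriv f z))\<^sup>2) \<le> ennreal C * Qp_seminorm_sq p f"
      using Qp_derivative_bound_on_disc[OF p(1) \<rho>(1,2)] by blast
    have "sq_integral (core \<rho>) (deriv f) \<le> (\<integral>\<^sup>+z. ennreal C * Qp_seminorm_sq p f * ennreal (W z) \<partial>area_measure)"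
      unfolding sq_integral_def by (intro nn_integral_mono core_pt[OF C holo order_refl]) auto
    also have "\<dots> < \<infinity>" by (rule dom_fin[OF S])
    finally have "sq_integral (core \<rho>) (deriv f) < \<infinity>" .
    moreover have "sq_integral (truncated_weight \<rho> ?Wt) (deriv f) < \<infinity>"
      using S by (intro order_le_less_trans[OF \<rho>(3)]) (simp add: ennreal_mult_less_top)
    ultimately have "sq_integral ?Wt (deriv f) < \<infinity>" unfolding split[OF holo, of \<rho>] by simp
    then have "sq_integral W f < \<infinity>"
      by (intro order_le_less_trans[OF up[OF holo]]) (simp add: ennreal_mult_less_top)
    then show ?thesis using holomorphic_measurable[OF holo] by (simp add: L2_space_iff[OF W(1)])
  qed
  have conv: "\<exists>r. strict_mono r \<and> (\<exists>F\<in>L2_space (weighted_area W). (\<lambda>k. L2_norm (weighted_area W) (\<lambda>z. f (r k) z - F z)) \<longlonglongrightarrow> 0)"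
    if f: "\<And>k. f k \<in> Qp_space p" "\<And>k. Qp_norm p (f k) \<le> B" for f :: "nat \<Rightarrow> complex \<Rightarrow> complex" and B
  proof -
    note fB = Qp_norm_le_imp[OF f]
    have fh: "f k holomorphic_on unit_disc" for k using f(1)[of k] by (simp add: Qp_space_def)
    define \<H> where "\<H> = {h. h holomorphic_on unit_disc \<and> cmod (h 0) \<le> B \<and> Qp_seminorm_sq p h \<le> ennreal (B\<^sup>2)}"
    obtain F r where F: "F holomorphic_on unit_disc" and r: "strict_mono r"
      and pw: "\<And>z. z \<in> unit_disc \<Longrightarrow> (\<lambda>n. f (r n) z) \<longlonglongrightarrow> F z"
      and ul: "\<And>K. compact K \<Longrightarrow> K \<subseteq> unit_disc \<Longrightarrow> uniform_limit K (f \<circ> r) F sequentially"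
    proof (rule Montel[of unit_disc \<H> f])
      show "\<exists>M. \<forall>h\<in>\<H>. \<forall>z\<in>K. cmod (h z) \<le> M" if "compact K" "K \<subseteq> unit_disc" for K
        unfolding \<H>_def using Qp_locally_bounded[OF p(1) that fB(3)] .
      show "range f \<subseteq> \<H>" using fh fB by (auto simp: \<H>_def)
    qed (auto simp: \<H>_def)
    have dl: "(\<lambda>k. deriv (f (r k)) z) \<longlonglongrightarrow> deriv F z" if z: "z \<in> unit_disc" for z
    proof -
      define R where "R = (1 + cmod z) / 2"
      have R: "cmod z < R" "R < 1" using z by (auto simp: R_def)
      have "uniform_limit (cball 0 R) (f \<circ> r) F sequentially" using R by (intro ul) auto
      then have "uniform_limit (ball 0 R) (\<lambda>k. f (r k)) F sequentially"
        unfolding o_def by (rule uniform_limit_on_subset) (rule ball_subset_cball)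
      then show ?thesis
        using R fh by (intro deriv_complex_uniform_limit) (auto intro!: always_eventually holomorphic_on_subset[OF fh])
    qed
    have FS: "Qp_seminorm_sq p F \<le> ennreal (B\<^sup>2)"
      by (rule Qp_seminorm_le_of_deriv_limit[OF F fh dl fB(2)])
    then have FQ: "F \<in> Qp_space p" using F by (auto simp: Qp_space_def intro: order_le_less_trans)
    define d where "d k z = f (r k) z - F z" for k z
    have dh: "d k holomorphic_on unit_disc" for k unfolding d_def[abs_def] by (intro holomorphic_intros fh F)
    define S where "S = ennreal (4 * B\<^sup>2)"
    have dS: "Qp_seminorm_sq p (d k) \<le> S" for k
    proof -
      have "Qp_seminorm_sq p (d k) \<le> 2 * Qp_seminorm_sq p (f (r k)) + 2 * Qp_seminorm_sq p F"
        unfolding d_def[abs_def] by (rule Qp_seminorm_diff_le[OF fh F])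
      also have "\<dots> \<le> 2 * ennreal (B\<^sup>2) + 2 * ennreal (B\<^sup>2)"
        by (intro add_mono mult_left_mono fB FS) auto
      also have "\<dots> = S" by (simp add: S_def ennreal_mult' flip: distrib_right)
      finally show ?thesis .
    qed
    have dd: "(\<lambda>k. deriv (d k) z) \<longlonglongrightarrow> 0" if z: "z \<in> unit_disc" for z
    proof -
      have "deriv (d k) z = deriv (f (r k)) z - deriv F z" for k
        unfolding d_def[abs_def] by (rule deriv_diff_on_disc[OF fh F z])
      then show ?thesis using tendsto_diff[OF dl[OF z] tendsto_const[of "deriv F z"]] by simp
    qed
    have d0: "(\<lambda>k. ennreal ((cmod (d k 0))\<^sup>2)) \<longlonglongrightarrow> 0"
    proof -
      have "(\<lambda>k. d k 0) \<longlonglongrightarrow> 0"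
        unfolding d_def using tendsto_diff[OF pw[of 0] tendsto_const[of "F 0"]] by simp
      then have "(\<lambda>k. (cmod (d k 0))\<^sup>2) \<longlonglongrightarrow> (cmod 0)\<^sup>2" by (intro tendsto_intros)
      then show ?thesis by (simp add: ennreal_tendsto_0_iff)
    qed
    have Xlim: "(\<lambda>k. sq_integral W (d k)) \<longlonglongrightarrow> 0"
    proof (rule tendsto_0_ennrealI)
      fix \<eta> :: real assume \<eta>: "0 < \<eta>"
      define A where "A = 2 * carleson_const * (4 * B\<^sup>2)"
      have A: "0 \<le> A" by (simp add: A_def carleson_const_def)
      define e where "e = \<eta> / (3 * K * (A + 1))"
      have e: "0 < e" using \<eta> K A by (simp add: e_def)
      have Ae: "K * (A * e) \<le> \<eta> / 3"
      proof -
        have "K * (A * e) = A / (A + 1) * (\<eta> / 3)" using K by (simp add: e_def)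
        also have "\<dots> \<le> 1 * (\<eta> / 3)" using A \<eta> by (intro mult_right_mono) auto
        finally show ?thesis by simp
      qed
      obtain \<rho> where \<rho>: "0 < \<rho>" "\<rho> < 1"
        "\<And>f. f holomorphic_on unit_disc \<Longrightarrow> sq_integral (truncated_weight \<rho> ?Wt) (deriv f) \<le> ennreal (2 * carleson_const) * Qp_seminorm_sq p f * ennreal e"
        using tails[OF e] by blast
      obtain C where C: "\<And>f z. f holomorphic_on unit_disc \<Longrightarrow> cmod z \<le> \<rho> \<Longrightarrow> ennreal ((cmod (deriv f z))\<^sup>2) \<le> ennreal C * Qp_seminorm_sq p f"
        using Qp_derivative_bound_on_disc[OF p(1) \<rho>(1,2)] by blast
      have tail: "sq_integral (truncated_weight \<rho> ?Wt) (deriv (d k)) \<le> ennreal (A * e)" for k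
      proof -
        have "sq_integral (truncated_weight \<rho> ?Wt) (deriv (d k)) \<le> ennreal (2 * carleson_const) * Qp_seminorm_sq p (d k) * ennreal e"
          by (rule \<rho>(3)[OF dh])
        also have "\<dots> \<le> ennreal (2 * carleson_const) * S * ennreal e"
          by (intro mult_right_mono mult_left_mono dS) auto
        also have "ennreal (2 * carleson_const) * S = ennreal A"
          unfolding S_def A_def by (rule ennreal_mult[symmetric]) (simp_all add: carleson_const_def)
        also have "ennreal A * ennreal e = ennreal (A * e)"
          using e A by (intro ennreal_mult[symmetric]) auto
        finally show ?thesis .
      qed
      have "(\<lambda>k. \<integral>\<^sup>+z. ennreal ((cmod (deriv (d k) z))\<^sup>2) * ennreal (core \<rho> z) \<partial>area_measure) \<longlonglongrightarrow> (\<integral>\<^sup>+z. 0 \<partial>area_measure)"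
      proof (rule nn_integral_dominated_convergence[where w="\<lambda>z. ennreal C * S * ennreal (W z)"])
        note [measurable] = corem W(1) deriv_measurable[OF dh]
        show "(\<lambda>z. ennreal ((cmod (deriv (d k) z))\<^sup>2) * ennreal (core \<rho> z)) \<in> borel_measurable area_measure" for k by measurable
        show "(\<lambda>z. ennreal C * S * ennreal (W z)) \<in> borel_measurable area_measure" by measurable
        show "AE z in area_measure. ennreal ((cmod (deriv (d k) z))\<^sup>2) * ennreal (core \<rho> z) \<le> ennreal C * S * ennreal (W z)" for k
          by (intro AE_I2 core_pt[OF C dh dS]) auto
        show "(\<integral>\<^sup>+z. ennreal C * S * ennreal (W z) \<partial>area_measure) < \<infinity>" by (rule dom_fin) (simp add: S_def)
        show "AE z in area_measure. (\<lambda>k. ennreal ((cmod (deriv (d k) z))\<^sup>2) * ennreal (core \<rho> z)) \<longlonglongrightarrow> 0"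
        proof (intro AE_I2)
          fix z assume "z \<in> space area_measure"
          then have "(\<lambda>k. deriv (d k) z) \<longlonglongrightarrow> 0" by (intro dd) simp
          then have "(\<lambda>k. (cmod (deriv (d k) z))\<^sup>2 * core \<rho> z) \<longlonglongrightarrow> (cmod 0)\<^sup>2 * core \<rho> z" by (intro tendsto_intros)
          then have "(\<lambda>k. ennreal ((cmod (deriv (d k) z))\<^sup>2 * core \<rho> z)) \<longlonglongrightarrow> ennreal ((cmod 0)\<^sup>2 * core \<rho> z)" by (rule tendsto_ennrealI)
          then show "(\<lambda>k. ennreal ((cmod (deriv (d k) z))\<^sup>2) * ennreal (core \<rho> z)) \<longlonglongrightarrow> 0"
            by (simp add: ennreal_mult')
        qed
      qed simp
      then have "(\<lambda>k. sq_integral (core \<rho>) (deriv (d k))) \<longlonglongrightarrow> 0" by (simp add: sq_integral_def)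
      then have "eventually (\<lambda>k. sq_integral (core \<rho>) (deriv (d k)) < ennreal (\<eta> / (3 * K))) sequentially"
        using \<eta> K by (intro order_tendstoD(2)) auto
      moreover have "eventually (\<lambda>k. ennreal ((cmod (d k 0))\<^sup>2) < ennreal (\<eta> / (3 * K))) sequentially"
        using d0 \<eta> K by (intro order_tendstoD(2)) auto
      ultimately show "eventually (\<lambda>k. sq_integral W (d k) \<le> ennreal \<eta>) sequentially"
      proof eventually_elim
        case (elim k)
        have "sq_integral W (d k) \<le> ennreal K * (sq_integral ?Wt (deriv (d k)) + ennreal ((cmod (d k 0))\<^sup>2))" by (rule up[OF dh])
        also have "\<dots> \<le> ennreal K * ((ennreal (A * e) + ennreal (\<eta> / (3 * K))) + ennreal (\<eta> / (3 * K)))"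
          unfolding split[OF dh, of k \<rho>] using elim by (intro mult_left_mono add_mono tail) auto
        also have "\<dots> = ennreal (K * (A * e + \<eta> / (3 * K) + \<eta> / (3 * K)))"
          using K A e \<eta> by (simp add: ennreal_mult[symmetric] ennreal_plus[symmetric] del: ennreal_plus)
        also have "\<dots> \<le> ennreal \<eta>"
          using K Ae by (intro ennreal_leI) (simp add: distrib_left)
        finally show ?case .
      qed
    qed
    have "L2_norm (weighted_area W) (\<lambda>z. f (r k) z - F z) = sqrt (enn2real (sq_integral W (d k)))" for k
      using L2_norm_weighted_area[OF W(1) holomorphic_measurable[OF dh]] by (simp add: d_def[abs_def])
    moreover have "(\<lambda>k. sqrt (enn2real (sq_integral W (d k)))) \<longlonglongrightarrow> sqrt 0"
      using Xlim by (intro tendsto_real_sqrt tendsto_enn2real) auto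
    ultimately have "(\<lambda>k. L2_norm (weighted_area W) (\<lambda>z. f (r k) z - F z)) \<longlonglongrightarrow> 0" by simp
    then show ?thesis using r L2[OF FQ] by blast
  qed
  show ?thesis unfolding compact_embedding_def using L2 conv by blast
qed

theorem theorem6p4:
  fixes p :: real and W :: "complex \<Rightarrow> real"
  assumes "0 < p" and "p \<le> 1"
    and "Littlewood_Paley_weight W"
  shows "compact_embedding (Qp_space p) (Qp_norm p)
           (L2_space (weighted_area W)) (L2_norm (weighted_area W))
     \<longleftrightarrow>
     ((\<lambda>\<rho>. SUP \<D>\<in>{\<D>. dyadic_system \<D>}.
          dyadic_gauge p \<D> (box_average p (truncated_weight \<rho> (tilde_weight W))))
        \<longlongrightarrow> 0) (at_left 1)"
  using gauge_tendsto_0_of_compact_embedding[OF assms] compact_embedding_of_gauge_tendsto_0[OF assms] by blast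

end
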